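(* Let $\Gamma$ be a smooth closed curve bounding $\Omega\subset\mathbb R^2$. Let $g\in L^2(\Gamma)$ have $\int_\Gamma g\,ds=0$, and let $u\in H^2(\Gamma)$ be the solution of $-\Delta_\Gamma u=g$ on $\Gamma$ with $\int_\Gamma u\,ds=0$. Let $U$ be its harmonic extension to $\Omega$. Assume the active-grid geometry assumptions, the local extrapolation assumption and the data/regularity assumption stated in the context. Fix the single-layer or the double-layer construction and assume that the corresponding block $P_2$ is invertible. Assume moreover the reduced-space approximation property: for every mean-zero $\phi\in H^2(\Gamma^h)$ there is $\phi_\star\in W_{h,\diamond}^{\rm red}$ with $\|\phi-\phi_\star\|_{H^1(\Gamma^h)}\le C_{0}h\|\phi\|_{H^2(\Gamma^h)}$, with $C_0$ independent of $h$ and the cut position. Let $u_h\in W_{h,\diamond}^{\mathrm{red}}$ be the reduced trace solution, i.e. $$\int_{\Gamma^h}\nabla_{\Gamma^h}u_h\cdot\nabla_{\Gamma^h}v_h\,ds_h=\int_{\Gamma^h}(g\circ p)\,v_h\,ds_h\qquad\forall v_h\in W_{h,\diamond}^{\mathrm{red}},$$ and let $u^e:=u\circ p-|\Gamma^h|^{-1}\int_{\Gamma^h}u\circ p\,ds_h$. Then $$\|u^e-u_h\|_{L^2(\Gamma^h)}\le C\,h^2\bigl(\|u\|_{H^2(\Gamma)}+\|U\|_{W^{4,\infty}(\Omega\cap U_\Gamma)}\bigr),$$ with $C$ independent of $h$ and of the cut configuration (the position of $\Gamma$ relative to the mesh).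
   Context: **Geometry and mesh.** $\Omega\subset\mathbb R^2$ is a bounded domain (possibly nonconvex) whose boundary $\Gamma$ is a smooth connected closed curve; $\psi$ is a level-set function with $\Gamma=\{\psi=0\}$, $\psi<0$ in $\Omega$, $\psi>0$ outside $\overline\Omega$. $\mathcal T_h$ is the uniform Cartesian mesh of closed squares of side $h$ with vertex set $h\mathbb Z^2$; $x\sim y$ means that $x,y\in h\mathbb Z^2$ are nearest (axial) lattice neighbours. A cell $K$ is active if $K\cap\Gamma\ne\varnothing$; $\mathcal T_h^\Gamma$ is the set of active cells, $\gamma$ the set of their vertices, $\Omega_h^\Gamma$ their union. Put $\gamma_1=\{x\in\gamma:\psi(x)<0\}$, $\gamma_2=\{x\in\gamma:\psi(x)>0,\ x\sim y\text{ for some }y\in\gamma_1\}$, $\gamma_3=\{x\in\gamma:\psi(x)>0\}\setminus\gamma_2$, $\mathcal V_h^{\rm int}=\{\xi\in h\mathbb Z^2:\psi(\xi)<0\}$. *Active-grid geometry assumptions* ($h$ sufficiently small): no lattice vertex lies on $\Gamma$; all intersections of $\Gamma$ with mesh edges are transverse; each active cell is cut by at most one connected interface segment; every active cell has vertices of both signs of $\psi$; $\mathcal V_h^{\rm int}$ is finite and connected as a lattice graph. No lower bound on cut ratios is imposed. **Discrete surface and finite elements.** $V_h$ is the continuous bilinear ($\mathcal Q_1$) finite element space on $\mathcal T_h^\Gamma$ with nodal basis $\{\phi_\xi\}_{\xi\in\gamma}$. In each active cell $K$, $\Gamma_K^h$ is the straight segment joining the zero crossings of $\psi$ on $\partial K$;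 $\Gamma^h=\bigcup_K\Gamma^h_K$. $\operatorname{Tr}_hv_h=v_h|_{\Gamma^h}$. $\nabla_{\Gamma^h}$ is the tangential gradient on $\Gamma^h$, $ds_h$ its arclength, $\|v\|_{H^1(\Gamma^h)}^2=\|v\|_{L^2(\Gamma^h)}^2+\|\nabla_{\Gamma^h}v\|_{L^2(\Gamma^h)}^2$. $H^2(\Gamma^h)$ is the periodic Sobolev space defined through the arclength parametrization of $\Gamma^h$. $p:\Gamma^h\to\Gamma$ is the closest-point projection; the standard estimates $\|p-\mathrm{id}\|_{L^\infty(\Gamma^h)}\lesssim h^2$, $\|\mathbf n\circ p-\mathbf n_h\|_{L^\infty(\Gamma^h)}\lesssim h$, $\|1-ds/ds_h\|_{L^\infty(\Gamma^h)}\lesssim h^2$ hold. **Layer potentials and harmonic extension.** $L_hv(x)=h^{-2}\bigl(\sum_{y\sim x}v(y)-4v(x)\bigr)$. $G_h$ is the lattice Green's function on $h\mathbb Z^2$: $-L_hG_h=\delta_0$ with $\delta_0(0)=h^{-2}$, $\delta_0=0$ elsewhere, normalized by $G_h(0)=0$; explicitly $G_h(hm)=\frac1{4\pi^2}\int_{[-\pi,\pi]^2}\frac{\cos(m\cdot t)-1}{4-2\cos t_1-2\cos t_2}\,dt$. Set $S_{ij}=G_h(x_i-x_j)$ and $D_{ij}=\sum_{x_k\sim x_j,\,x_k\notin\gamma}[G_h(x_i-x_k)-G_h(x_i-x_j)]$. With sources in $\gamma_2$ and targets in $\gamma_1$, resp. $\gamma_2$, one gets the blocks $S_{12},D_{12}$,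 resp. $S_{22},D_{22}$. Either $(P_1,P_2)=(S_{12},S_{22})$ (single layer) or $(P_1,P_2)=(D_{12},D_{22})$ (double layer). If $P_2$ is invertible, $H:=P_1P_2^{-1}$. **Local extrapolation assumption.** For $\eta\in\gamma_3$, a direction $e\in\{\pm e_1,\pm e_2\}$ is admissible if $\eta-he,\eta-2he\in\gamma_1\cup\gamma_2$; then one sets $v(\eta)=2v(\eta-he)-v(\eta-2he)$, averaging over two orthogonal admissible directions when available. Assume every $\eta\in\gamma_3$ has at least one admissible direction, and the stencil patches have diameter $O(h)$ and uniformly finite overlap, independently of the cut position. (A local least-squares affine extrapolation may be substituted provided each stencil uses a uniformly bounded number of nodes with uniformly bounded weights, is exact on affine functions, and patches keep uniformly finite overlap.) The relations are written $R_1u_1+R_2u_2+u_3=0$, where $u_i$ is the vector of values on $\gamma_i$; $J:=R_1H+R_2$. **Reduced spaces.** For $v_2\in\mathcal M_h:=\mathbb R^{|\gamma_2|}$ let $Ev_2=(Hv_2,v_2,-Jv_2)\in\mathbb R^{|\gamma|}$ (blocks on $\gamma_1,\gamma_2,\gamma_3$), $\mathcal E_hv_2=\sum_{\xi\in\gamma}(Ev_2)_\xi\phi_\xi$, $V_h^{\rm red}=\mathcal E_h\mathcal M_h$, $W_h^{\rm red}=\operatorname{Tr}_hV_h^{\rm red}$, and $W_{h,\diamond}^{\rm red}=\{w\in W_h^{\rm red}:\int_{\Gamma^h}w\,ds_h=0\}$. **Data/regularity assumption.** $g\in L^2(\Gamma)$, $\int_\Gamma g\,ds=0$, $\int_\Gamma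 u\,ds=0$, $u\in H^2(\Gamma)$; the harmonic extension $U$ of $u$ to $\Omega$ satisfies $U\in W^{4,\infty}(\Omega\cap U_\Gamma)$ for a fixed tubular neighbourhood $U_\Gamma$ of $\Gamma$. $\mathfrak E:W^{4,\infty}(\Omega)\to W^{4,\infty}(\mathbb R^2)$ is a fixed bounded extension operator (e.g. Stein's), $\widetilde U=\mathfrak EU$, and $\|\widetilde U\|_{W^{4,\infty}(\mathbb R^2)}\lesssim\|U\|_{W^{4,\infty}(\Omega)}\lesssim\|U\|_{W^{4,\infty}(\Omega\cap U_\Gamma)}$. *)

theory Defs
  imports "HOL-Analysis.Analysis"
begin

type_synonym point = "real \<times> real"

definition partial :: "'a::real_normed_vector \<Rightarrow> ('a \<Rightarrow> 'b::real_normed_vector) \<Rightarrow> 'a \<Rightarrow> 'b" where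
  "partial e f = (\<lambda>x. frechet_derivative f (at x) e)"

text \<open>Intended for open \<open>S\<close>.\<close>

primrec Ck_on :: "nat \<Rightarrow> 'a::euclidean_space set \<Rightarrow> ('a \<Rightarrow> 'b::real_normed_vector) \<Rightarrow> bool" where
  "Ck_on 0 S f \<longleftrightarrow> continuous_on S f"
| "Ck_on (Suc k) S f \<longleftrightarrow>
     (\<forall>x\<in>S. f differentiable (at x)) \<and> (\<forall>e\<in>Basis. Ck_on k S (partial e f))"

definition smooth_on :: "'a::euclidean_space set \<Rightarrow> ('a \<Rightarrow> 'b::real_normed_vector) \<Rightarrow> bool" where
  "smooth_on S f \<longleftrightarrow> (\<forall>k. Ck_on k S f)"

definition multi_partial :: "nat \<times> nat \<Rightarrow> (point \<Rightarrow> real) \<Rightarrow> point \<Rightarrow> real" where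
  "multi_partial \<alpha> f = (partial (1, 0) ^^ fst \<alpha>) ((partial (0, 1) ^^ snd \<alpha>) f)"

definition test_function :: "point set \<Rightarrow> (point \<Rightarrow> real) \<Rightarrow> bool" where
  "test_function S \<phi> \<longleftrightarrow> smooth_on UNIV \<phi> \<and>
     (\<exists>K. compact K \<and> K \<subseteq> S \<and> (\<forall>x. x \<notin> K \<longrightarrow> \<phi> x = 0))"

definition has_weak_partial ::
  "point set \<Rightarrow> nat \<times> nat \<Rightarrow> (point \<Rightarrow> real) \<Rightarrow> (point \<Rightarrow> real) \<Rightarrow> bool" where
  "has_weak_partial S \<alpha> f f' \<longleftrightarrow>
     (\<forall>K. compact K \<and> K \<subseteq> S \<longrightarrow> f absolutely_integrable_on K \<and> f' absolutely_integrable_on K) \<and>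
     (\<forall>\<phi>. test_function S \<phi> \<longrightarrow>
        integral\<^sup>L (lebesgue_on S) (\<lambda>x. f x * multi_partial \<alpha> \<phi> x) =
        (- 1) ^ (fst \<alpha> + snd \<alpha>) * integral\<^sup>L (lebesgue_on S) (\<lambda>x. f' x * \<phi> x))"

text \<open>\<open>B\<close> bounds all weak partial derivatives of order at most \<open>k\<close> in \<open>L\<^sup>\<infinity>(S)\<close>; the least such
  \<open>B\<close> is the norm of the Sobolev space \<open>W\<^sup>k\<^sup>,\<^sup>\<infinity>(S)\<close>.\<close>

definition Winf_bound :: "nat \<Rightarrow> point set \<Rightarrow> (point \<Rightarrow> real) \<Rightarrow> real \<Rightarrow> bool" where
  "Winf_bound k S f B \<longleftrightarrow> 0 \<le> B \<and>
     (\<forall>\<alpha>. fst \<alpha> + snd \<alpha> \<le> k \<longrightarrow>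
        (\<exists>f'. has_weak_partial S \<alpha> f f' \<and> (AE x in lebesgue_on S. \<bar>f' x\<bar> \<le> B)))"

definition Winf :: "nat \<Rightarrow> point set \<Rightarrow> (point \<Rightarrow> real) set" where
  "Winf k S = {f. \<exists>B. Winf_bound k S f B}"

definition Winf_norm :: "nat \<Rightarrow> point set \<Rightarrow> (point \<Rightarrow> real) \<Rightarrow> real" where
  "Winf_norm k S f = Inf {B. Winf_bound k S f B}"

text \<open>Linearity holds up to null sets, since the elements of \<open>Winf\<close> represent classes of functions.\<close>

definition bounded_extension_operator ::
  "nat \<Rightarrow> point set \<Rightarrow> real \<Rightarrow> ((point \<Rightarrow> real) \<Rightarrow> point \<Rightarrow> real) \<Rightarrow> bool" where
  "bounded_extension_operator k S B E \<longleftrightarrow>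
     (\<forall>f\<in>Winf k S. E f \<in> Winf k UNIV \<and>
        (AE x in lebesgue_on S. E f x = f x) \<and>
        Winf_norm k UNIV (E f) \<le> B * Winf_norm k S f) \<and>
     (\<forall>f\<in>Winf k S. \<forall>g\<in>Winf k S. \<forall>r.
        AE x in lebesgue. E (\<lambda>y. f y + r * g y) x = E f x + r * E g x)"

definition harmonic_on :: "point set \<Rightarrow> (point \<Rightarrow> real) \<Rightarrow> bool" where
  "harmonic_on S f \<longleftrightarrow> Ck_on 2 S f \<and>
     (\<forall>x\<in>S. partial (1, 0) (partial (1, 0) f) x + partial (0, 1) (partial (0, 1) f) x = 0)"

definition harmonic_extension :: "point set \<Rightarrow> (point \<Rightarrow> real) \<Rightarrow> (point \<Rightarrow> real) \<Rightarrow> bool" where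
  "harmonic_extension S u U \<longleftrightarrow> continuous_on (closure S) U \<and> harmonic_on S U \<and>
     (\<forall>x\<in>frontier S. U x = u x)"

definition L2_per :: "real \<Rightarrow> (real \<Rightarrow> real) set" where
  "L2_per L = {f. f \<in> borel_measurable (lebesgue_on {0..L}) \<and>
     integrable (lebesgue_on {0..L}) (\<lambda>t. (f t)\<^sup>2)}"

definition has_weak_deriv_per :: "real \<Rightarrow> nat \<Rightarrow> (real \<Rightarrow> real) \<Rightarrow> (real \<Rightarrow> real) \<Rightarrow> bool" where
  "has_weak_deriv_per L k f f' \<longleftrightarrow> f \<in> L2_per L \<and> f' \<in> L2_per L \<and>
     (\<forall>\<phi>. smooth_on UNIV \<phi> \<and> (\<forall>t. \<phi> (t + L) = \<phi> t) \<longrightarrow>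
        integral\<^sup>L (lebesgue_on {0..L}) (\<lambda>t. f t * (deriv ^^ k) \<phi> t) =
        (- 1) ^ k * integral\<^sup>L (lebesgue_on {0..L}) (\<lambda>t. f' t * \<phi> t))"

text \<open>The weak derivative is unique up to null sets, so the choice does not affect integrals.\<close>

definition weak_deriv_per :: "real \<Rightarrow> nat \<Rightarrow> (real \<Rightarrow> real) \<Rightarrow> real \<Rightarrow> real" where
  "weak_deriv_per L k f = (SOME f'. has_weak_deriv_per L k f f')"

definition H_per :: "nat \<Rightarrow> real \<Rightarrow> (real \<Rightarrow> real) set" where
  "H_per k L = {f. \<forall>j\<le>k. \<exists>f'. has_weak_deriv_per L j f f'}"

definition H_per_norm :: "nat \<Rightarrow> real \<Rightarrow> (real \<Rightarrow> real) \<Rightarrow> real" where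
  "H_per_norm k L f =
     sqrt (\<Sum>j\<le>k. integral\<^sup>L (lebesgue_on {0..L}) (\<lambda>t. (weak_deriv_per L j f t)\<^sup>2))"

text \<open>\<open>c\<close> is an arclength parametrization, extended \<open>L\<close>-periodically, of the simple closed
  rectifiable curve \<open>S\<close> of length \<open>L\<close>.\<close>

definition arclength_param :: "real \<Rightarrow> (real \<Rightarrow> point) \<Rightarrow> point set \<Rightarrow> bool" where
  "arclength_param L c S \<longleftrightarrow> 0 < L \<and> (\<forall>t. c (t + L) = c t) \<and>
     inj_on c {0..<L} \<and> c ` {0..<L} = S \<and> 1-lipschitz_on UNIV c \<and>
     (AE t in lebesgue. \<exists>v. (c has_vector_derivative v) (at t) \<and> norm v = 1)"

definition smooth_closed_curve :: "real \<Rightarrow> (real \<Rightarrow> point) \<Rightarrow> point set \<Rightarrow> bool" where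
  "smooth_closed_curve L c S \<longleftrightarrow> arclength_param L c S \<and> smooth_on UNIV c"

definition curve_integral :: "real \<Rightarrow> (real \<Rightarrow> point) \<Rightarrow> (point \<Rightarrow> real) \<Rightarrow> real" where
  "curve_integral L c f = integral\<^sup>L (lebesgue_on {0..L}) (\<lambda>t. f (c t))"

definition L2_curve :: "real \<Rightarrow> (real \<Rightarrow> point) \<Rightarrow> (point \<Rightarrow> real) set" where
  "L2_curve L c = {f. f \<circ> c \<in> L2_per L}"

definition L2_curve_norm :: "real \<Rightarrow> (real \<Rightarrow> point) \<Rightarrow> (point \<Rightarrow> real) \<Rightarrow> real" where
  "L2_curve_norm L c f = sqrt (curve_integral L c (\<lambda>x. (f x)\<^sup>2))"

definition H2_curve :: "real \<Rightarrow> (real \<Rightarrow> point) \<Rightarrow> (point \<Rightarrow> real) set" where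
  "H2_curve L c = {f. f \<circ> c \<in> H_per 2 L}"

definition H2_curve_norm :: "real \<Rightarrow> (real \<Rightarrow> point) \<Rightarrow> (point \<Rightarrow> real) \<Rightarrow> real" where
  "H2_curve_norm L c f = H_per_norm 2 L (f \<circ> c)"

text \<open>The tangential gradient at the point \<open>c t\<close>.\<close>

definition tangential_grad ::
  "real \<Rightarrow> (real \<Rightarrow> point) \<Rightarrow> (point \<Rightarrow> real) \<Rightarrow> real \<Rightarrow> point" where
  "tangential_grad L c f t = weak_deriv_per L 1 (f \<circ> c) t *\<^sub>R vector_derivative c (at t)"

definition dirichlet_form ::
  "real \<Rightarrow> (real \<Rightarrow> point) \<Rightarrow> (point \<Rightarrow> real) \<Rightarrow> (point \<Rightarrow> real) \<Rightarrow> real" where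
  "dirichlet_form L c f g =
     integral\<^sup>L (lebesgue_on {0..L}) (\<lambda>t. tangential_grad L c f t \<bullet> tangential_grad L c g t)"

definition H1_curve_norm :: "real \<Rightarrow> (real \<Rightarrow> point) \<Rightarrow> (point \<Rightarrow> real) \<Rightarrow> real" where
  "H1_curve_norm L c f = sqrt ((L2_curve_norm L c f)\<^sup>2 + dirichlet_form L c f f)"

text \<open>\<open>- \<Delta>\<^sub>\<Gamma> u = g\<close>: the Laplace-Beltrami operator of a curve is the second derivative with respect
  to arclength.\<close>

definition solves_laplace_beltrami ::
  "real \<Rightarrow> (real \<Rightarrow> point) \<Rightarrow> (point \<Rightarrow> real) \<Rightarrow> (point \<Rightarrow> real) \<Rightarrow> bool" where
  "solves_laplace_beltrami L c u g \<longleftrightarrow>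
     (AE t in lebesgue_on {0..L}. - weak_deriv_per L 2 (u \<circ> c) t = g (c t))"

definition level_set_function :: "point set \<Rightarrow> point set \<Rightarrow> (point \<Rightarrow> real) \<Rightarrow> bool" where
  "level_set_function \<Omega> \<Gamma> \<psi> \<longleftrightarrow> {x. \<psi> x = 0} = \<Gamma> \<and>
     (\<forall>x\<in>\<Omega>. \<psi> x < 0) \<and> (\<forall>x. x \<notin> closure \<Omega> \<longrightarrow> \<psi> x > 0)"

text \<open>Lattice vertices are represented by their integer indices.  The offset \<open>a\<close> translates the
  lattice \<open>h\<int>\<^sup>2\<close> against the fixed curve \<open>{\<psi> = 0}\<close>; \<open>a = 0\<close> gives \<open>h\<int>\<^sup>2\<close> itself.  The cell with
  index \<open>(i, j)\<close> has \<open>(i, j)\<close> as its lower left vertex.\<close>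

type_synonym lattice = "int \<times> int"

definition vertex :: "real \<Rightarrow> point \<Rightarrow> lattice \<Rightarrow> point" where
  "vertex h a m = a + h *\<^sub>R (real_of_int (fst m), real_of_int (snd m))"

definition nbr :: "lattice \<Rightarrow> lattice \<Rightarrow> bool" where
  "nbr m n \<longleftrightarrow> \<bar>fst m - fst n\<bar> + \<bar>snd m - snd n\<bar> = 1"

definition cell :: "real \<Rightarrow> point \<Rightarrow> lattice \<Rightarrow> point set" where
  "cell h a k = cbox (vertex h a k) (vertex h a (k + (1, 1)))"

definition cell_vertices :: "lattice \<Rightarrow> lattice set" where
  "cell_vertices k = {k, k + (1, 0), k + (0, 1), k + (1, 1)}"

definition active :: "real \<Rightarrow> point \<Rightarrow> (point \<Rightarrow> real) \<Rightarrow> lattice set" where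
  "active h a \<psi> = {k. \<exists>x\<in>cell h a k. \<psi> x = 0}"

definition gam :: "real \<Rightarrow> point \<Rightarrow> (point \<Rightarrow> real) \<Rightarrow> lattice set" where
  "gam h a \<psi> = (\<Union>k\<in>active h a \<psi>. cell_vertices k)"

definition gam1 :: "real \<Rightarrow> point \<Rightarrow> (point \<Rightarrow> real) \<Rightarrow> lattice set" where
  "gam1 h a \<psi> = {m \<in> gam h a \<psi>. \<psi> (vertex h a m) < 0}"

definition gam2 :: "real \<Rightarrow> point \<Rightarrow> (point \<Rightarrow> real) \<Rightarrow> lattice set" where
  "gam2 h a \<psi> = {m \<in> gam h a \<psi>. \<psi> (vertex h a m) > 0 \<and> (\<exists>n\<in>gam1 h a \<psi>. nbr m n)}"

definition gam3 :: "real \<Rightarrow> point \<Rightarrow> (point \<Rightarrow> real) \<Rightarrow> lattice set" where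
  "gam3 h a \<psi> = {m \<in> gam h a \<psi>. \<psi> (vertex h a m) > 0} - gam2 h a \<psi>"

definition interior_vertices :: "real \<Rightarrow> point \<Rightarrow> (point \<Rightarrow> real) \<Rightarrow> lattice set" where
  "interior_vertices h a \<psi> = {m. \<psi> (vertex h a m) < 0}"

definition lattice_connected :: "lattice set \<Rightarrow> bool" where
  "lattice_connected A \<longleftrightarrow>
     (\<forall>m\<in>A. \<forall>n\<in>A. (m, n) \<in> {(p, q). p \<in> A \<and> q \<in> A \<and> nbr p q}\<^sup>*)"

text \<open>The mesh edges fill the grid lines, so transversality only involves the grid line through a
  point of the curve.\<close>

definition transverse_to_mesh :: "real \<Rightarrow> point \<Rightarrow> (real \<Rightarrow> point) \<Rightarrow> bool" where
  "transverse_to_mesh h a c \<longleftrightarrow>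
     (\<forall>t m. fst (c t) = fst (vertex h a m) \<longrightarrow> fst (vector_derivative c (at t)) \<noteq> 0) \<and>
     (\<forall>t m. snd (c t) = snd (vertex h a m) \<longrightarrow> snd (vector_derivative c (at t)) \<noteq> 0)"

definition active_grid_geometry ::
  "real \<Rightarrow> point \<Rightarrow> (point \<Rightarrow> real) \<Rightarrow> (real \<Rightarrow> point) \<Rightarrow> bool" where
  "active_grid_geometry h a \<psi> c \<longleftrightarrow>
     (\<forall>m. \<psi> (vertex h a m) \<noteq> 0) \<and>
     transverse_to_mesh h a c \<and>
     (\<forall>k\<in>active h a \<psi>. connected (cell h a k \<inter> {x. \<psi> x = 0})) \<and>
     (\<forall>k\<in>active h a \<psi>. (\<exists>m\<in>cell_vertices k. \<psi> (vertex h a m) < 0) \<and>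
        (\<exists>m\<in>cell_vertices k. \<psi> (vertex h a m) > 0)) \<and>
     finite (interior_vertices h a \<psi>) \<and> lattice_connected (interior_vertices h a \<psi>)"

definition crossings :: "real \<Rightarrow> point \<Rightarrow> (point \<Rightarrow> real) \<Rightarrow> lattice \<Rightarrow> point set" where
  "crossings h a \<psi> k = {x \<in> frontier (cell h a k). \<psi> x = 0}"

text \<open>Under the active-grid geometry assumptions the boundary of an active cell carries exactly two
  zero crossings.\<close>

definition cell_segment :: "real \<Rightarrow> point \<Rightarrow> (point \<Rightarrow> real) \<Rightarrow> lattice \<Rightarrow> point set" where
  "cell_segment h a \<psi> k =
     (\<Union>x\<in>crossings h a \<psi> k. \<Union>y\<in>crossings h a \<psi> k. closed_segment x y)"

definition discrete_surface :: "real \<Rightarrow> point \<Rightarrow> (point \<Rightarrow> real) \<Rightarrow> point set" where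
  "discrete_surface h a \<psi> = (\<Union>k\<in>active h a \<psi>. cell_segment h a \<psi> k)"

definition outward_normal :: "point set \<Rightarrow> (real \<Rightarrow> point) \<Rightarrow> point \<Rightarrow> point" where
  "outward_normal \<Omega> c y = (THE \<nu>. norm \<nu> = 1 \<and>
     (\<forall>t. c t = y \<longrightarrow> \<nu> \<bullet> vector_derivative c (at t) = 0) \<and>
     (\<exists>\<epsilon>>0. \<forall>s. 0 < s \<and> s < \<epsilon> \<longrightarrow> y + s *\<^sub>R \<nu> \<notin> closure \<Omega>))"

text \<open>The unit normal of the segment in cell \<open>k\<close> that points towards the vertices with \<open>\<psi> > 0\<close>.\<close>

definition segment_normal :: "real \<Rightarrow> point \<Rightarrow> (point \<Rightarrow> real) \<Rightarrow> lattice \<Rightarrow> point" where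
  "segment_normal h a \<psi> k = (THE \<nu>. norm \<nu> = 1 \<and>
     (\<forall>x\<in>crossings h a \<psi> k. (\<forall>y\<in>crossings h a \<psi> k. \<nu> \<bullet> (x - y) = 0) \<and>
        (\<forall>m\<in>cell_vertices k. \<psi> (vertex h a m) > 0 \<longrightarrow> \<nu> \<bullet> (vertex h a m - x) > 0)))"

text \<open>The estimates \<open>|p - id| \<le> B h\<^sup>2\<close>, \<open>|n \<circ> p - n\<^sub>h| \<le> B h\<close> and \<open>|1 - ds/ds\<^sub>h| \<le> B h\<^sup>2\<close> for the
  closest-point projection \<open>p\<close>, where \<open>\<sigma>\<close> is an arclength parametrization of the discrete surface,
  so that \<open>ds/ds\<^sub>h\<close> at \<open>\<sigma> t\<close> is the speed of \<open>p \<circ> \<sigma>\<close> at \<open>t\<close>.\<close>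

definition projection_estimates ::
  "real \<Rightarrow> point set \<Rightarrow> (real \<Rightarrow> point) \<Rightarrow> real \<Rightarrow> point \<Rightarrow> (point \<Rightarrow> real) \<Rightarrow> (real \<Rightarrow> point) \<Rightarrow> bool"
where
  "projection_estimates B \<Omega> c h a \<psi> \<sigma> \<longleftrightarrow>
     (let p = closest_point {x. \<psi> x = 0} in
       (\<forall>x\<in>discrete_surface h a \<psi>. norm (p x - x) \<le> B * h\<^sup>2) \<and>
       (\<forall>k\<in>active h a \<psi>. \<forall>x\<in>cell_segment h a \<psi> k.
          norm (outward_normal \<Omega> c (p x) - segment_normal h a \<psi> k) \<le> B * h) \<and>
       (AE t in lebesgue. \<bar>1 - norm (vector_derivative (p \<circ> \<sigma>) (at t))\<bar> \<le> B * h\<^sup>2))"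

text \<open>The restriction to the cell of each tensor-product hat function is bilinear, and it is \<open>1\<close> at
  the vertex \<open>m\<close> and \<open>0\<close> at the other vertices.\<close>

definition nodal_basis :: "real \<Rightarrow> point \<Rightarrow> lattice \<Rightarrow> point \<Rightarrow> real" where
  "nodal_basis h a m x =
     max 0 (1 - \<bar>fst x - fst (vertex h a m)\<bar> / h) * max 0 (1 - \<bar>snd x - snd (vertex h a m)\<bar> / h)"

text \<open>\<open>lattice_green m\<close> is \<open>G\<^sub>h(h m)\<close>, which does not depend on \<open>h\<close>.\<close>

definition lattice_green :: "lattice \<Rightarrow> real" where
  "lattice_green m = 1 / (4 * pi\<^sup>2) *
     (LINT t:cbox (- pi, - pi) (pi, pi)|lborel.
        (cos (of_int (fst m) * fst t + of_int (snd m) * snd t) - 1) /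
        (4 - 2 * cos (fst t) - 2 * cos (snd t)))"

datatype layer = Single_Layer | Double_Layer

primrec layer_kernel ::
  "layer \<Rightarrow> real \<Rightarrow> point \<Rightarrow> (point \<Rightarrow> real) \<Rightarrow> lattice \<Rightarrow> lattice \<Rightarrow> real" where
  "layer_kernel Single_Layer h a \<psi> i j = lattice_green (i - j)"
| "layer_kernel Double_Layer h a \<psi> i j =
     (\<Sum>k | nbr k j \<and> k \<notin> gam h a \<psi>. lattice_green (i - k) - lattice_green (i - j))"

definition block_inverse :: "'i set \<Rightarrow> ('i \<Rightarrow> 'i \<Rightarrow> real) \<Rightarrow> ('i \<Rightarrow> 'i \<Rightarrow> real) \<Rightarrow> bool" where
  "block_inverse A P Q \<longleftrightarrow> (\<forall>i\<in>A. \<forall>j\<in>A.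
     (\<Sum>k\<in>A. P i k * Q k j) = (if i = j then 1 else 0) \<and>
     (\<Sum>k\<in>A. Q i k * P k j) = (if i = j then 1 else 0))"

definition block_invertible :: "'i set \<Rightarrow> ('i \<Rightarrow> 'i \<Rightarrow> real) \<Rightarrow> bool" where
  "block_invertible A P \<longleftrightarrow> (\<exists>Q. block_inverse A P Q)"

definition block_inv :: "'i set \<Rightarrow> ('i \<Rightarrow> 'i \<Rightarrow> real) \<Rightarrow> 'i \<Rightarrow> 'i \<Rightarrow> real" where
  "block_inv A P = (SOME Q. block_inverse A P Q)"

text \<open>The matrix \<open>H = P\<^sub>1 P\<^sub>2\<inverse>\<close>, with rows in \<open>gam1\<close> and columns in \<open>gam2\<close>.\<close>

definition H_matrix ::
  "layer \<Rightarrow> real \<Rightarrow> point \<Rightarrow> (point \<Rightarrow> real) \<Rightarrow> lattice \<Rightarrow> lattice \<Rightarrow> real" where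
  "H_matrix ly h a \<psi> i j = (\<Sum>k\<in>gam2 h a \<psi>.
     layer_kernel ly h a \<psi> i k * block_inv (gam2 h a \<psi>) (layer_kernel ly h a \<psi>) k j)"

text \<open>An extrapolation rule \<open>v(\<eta>) = \<Sum>\<^sub>\<xi> w \<eta> \<xi> v(\<xi>)\<close>, with \<open>\<eta>\<close> in \<open>gam3\<close> and \<open>\<xi>\<close> in
  \<open>gam1 \<union> gam2\<close>, is given by its weights \<open>w\<close>.\<close>

definition admissible_direction ::
  "real \<Rightarrow> point \<Rightarrow> (point \<Rightarrow> real) \<Rightarrow> lattice \<Rightarrow> lattice \<Rightarrow> bool" where
  "admissible_direction h a \<psi> \<eta> e \<longleftrightarrow> e \<in> {(1, 0), (- 1, 0), (0, 1), (0, - 1)} \<and>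
     \<eta> - e \<in> gam1 h a \<psi> \<union> gam2 h a \<psi> \<and> \<eta> - e - e \<in> gam1 h a \<psi> \<union> gam2 h a \<psi>"

definition orthogonal_directions :: "lattice \<Rightarrow> lattice \<Rightarrow> bool" where
  "orthogonal_directions e e' \<longleftrightarrow> fst e * fst e' + snd e * snd e' = 0"

definition axial_weight :: "lattice \<Rightarrow> lattice \<Rightarrow> lattice \<Rightarrow> real" where
  "axial_weight \<eta> e \<xi> = (if \<xi> = \<eta> - e then 2 else if \<xi> = \<eta> - e - e then - 1 else 0)"

definition axial_extrapolation ::
  "real \<Rightarrow> point \<Rightarrow> (point \<Rightarrow> real) \<Rightarrow> (lattice \<Rightarrow> lattice \<Rightarrow> real) \<Rightarrow> bool" where
  "axial_extrapolation h a \<psi> w \<longleftrightarrow> (\<forall>\<eta>\<in>gam3 h a \<psi>.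
     if \<exists>e e'. admissible_direction h a \<psi> \<eta> e \<and> admissible_direction h a \<psi> \<eta> e' \<and>
          orthogonal_directions e e'
     then \<exists>e e'. admissible_direction h a \<psi> \<eta> e \<and> admissible_direction h a \<psi> \<eta> e' \<and>
          orthogonal_directions e e' \<and>
          (\<forall>\<xi>. w \<eta> \<xi> = (axial_weight \<eta> e \<xi> + axial_weight \<eta> e' \<xi>) / 2)
     else \<exists>e. admissible_direction h a \<psi> \<eta> e \<and> (\<forall>\<xi>. w \<eta> \<xi> = axial_weight \<eta> e \<xi>))"

text \<open>The rules admitted in place of axial extrapolation; local least-squares affine fits with
  boundedly many nodes and bounded weights are of this form.\<close>

definition affine_extrapolation ::
  "real \<Rightarrow> real \<Rightarrow> point \<Rightarrow> (point \<Rightarrow> real) \<Rightarrow> (lattice \<Rightarrow> lattice \<Rightarrow> real) \<Rightarrow> bool" where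
  "affine_extrapolation B h a \<psi> w \<longleftrightarrow> (\<forall>\<eta>\<in>gam3 h a \<psi>.
     {\<xi>. w \<eta> \<xi> \<noteq> 0} \<subseteq> gam1 h a \<psi> \<union> gam2 h a \<psi> \<and>
     real (card {\<xi>. w \<eta> \<xi> \<noteq> 0}) \<le> B \<and> (\<forall>\<xi>. \<bar>w \<eta> \<xi>\<bar> \<le> B) \<and>
     (\<forall>b l. (\<Sum>\<xi>\<in>gam1 h a \<psi> \<union> gam2 h a \<psi>. w \<eta> \<xi> * (b + l \<bullet> vertex h a \<xi>)) =
        b + l \<bullet> vertex h a \<eta>))"

definition stencil_patch :: "(lattice \<Rightarrow> lattice \<Rightarrow> real) \<Rightarrow> lattice \<Rightarrow> lattice set" where
  "stencil_patch w \<eta> = insert \<eta> {\<xi>. w \<eta> \<xi> \<noteq> 0}"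

definition local_extrapolation ::
  "real \<Rightarrow> real \<Rightarrow> point \<Rightarrow> (point \<Rightarrow> real) \<Rightarrow> (lattice \<Rightarrow> lattice \<Rightarrow> real) \<Rightarrow> bool" where
  "local_extrapolation B h a \<psi> w \<longleftrightarrow>
     (axial_extrapolation h a \<psi> w \<or> affine_extrapolation B h a \<psi> w) \<and>
     (\<forall>\<eta>\<in>gam3 h a \<psi>. diameter (vertex h a ` stencil_patch w \<eta>) \<le> B * h) \<and>
     (\<forall>\<xi>. real (card {\<eta> \<in> gam3 h a \<psi>. \<xi> \<in> stencil_patch w \<eta>}) \<le> B)"

text \<open>\<open>J = R\<^sub>1 H + R\<^sub>2\<close>: in the form \<open>R\<^sub>1 u\<^sub>1 + R\<^sub>2 u\<^sub>2 + u\<^sub>3 = 0\<close> of the extrapolation rule, the entries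
  of \<open>R\<^sub>1\<close> and \<open>R\<^sub>2\<close> are the negated weights.\<close>

definition J_matrix :: "layer \<Rightarrow> (lattice \<Rightarrow> lattice \<Rightarrow> real) \<Rightarrow> real \<Rightarrow> point \<Rightarrow>
    (point \<Rightarrow> real) \<Rightarrow> lattice \<Rightarrow> lattice \<Rightarrow> real" where
  "J_matrix ly w h a \<psi> i j =
     (\<Sum>k\<in>gam1 h a \<psi>. (- w i k) * H_matrix ly h a \<psi> k j) + (- w i j)"

text \<open>Only the values of \<open>v\<close> on \<open>gam2\<close> enter.\<close>

definition reduced_values :: "layer \<Rightarrow> (lattice \<Rightarrow> lattice \<Rightarrow> real) \<Rightarrow> real \<Rightarrow> point \<Rightarrow>
    (point \<Rightarrow> real) \<Rightarrow> (lattice \<Rightarrow> real) \<Rightarrow> lattice \<Rightarrow> real" where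
  "reduced_values ly w h a \<psi> v i =
     (if i \<in> gam1 h a \<psi> then \<Sum>j\<in>gam2 h a \<psi>. H_matrix ly h a \<psi> i j * v j
      else if i \<in> gam2 h a \<psi> then v i
      else - (\<Sum>j\<in>gam2 h a \<psi>. J_matrix ly w h a \<psi> i j * v j))"

definition reduced_function :: "layer \<Rightarrow> (lattice \<Rightarrow> lattice \<Rightarrow> real) \<Rightarrow> real \<Rightarrow> point \<Rightarrow>
    (point \<Rightarrow> real) \<Rightarrow> (lattice \<Rightarrow> real) \<Rightarrow> point \<Rightarrow> real" where
  "reduced_function ly w h a \<psi> v x =
     (\<Sum>\<xi>\<in>gam h a \<psi>. reduced_values ly w h a \<psi> v \<xi> * nodal_basis h a \<xi> x)"

definition V_red :: "layer \<Rightarrow> (lattice \<Rightarrow> lattice \<Rightarrow> real) \<Rightarrow> real \<Rightarrow> point \<Rightarrow>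
    (point \<Rightarrow> real) \<Rightarrow> (point \<Rightarrow> real) set" where
  "V_red ly w h a \<psi> = range (reduced_function ly w h a \<psi>)"

definition W_red :: "layer \<Rightarrow> (lattice \<Rightarrow> lattice \<Rightarrow> real) \<Rightarrow> real \<Rightarrow> point \<Rightarrow>
    (point \<Rightarrow> real) \<Rightarrow> (point \<Rightarrow> real) set" where
  "W_red ly w h a \<psi> = (\<lambda>v. restrict v (discrete_surface h a \<psi>)) ` V_red ly w h a \<psi>"

text \<open>Here and below \<open>\<sigma>\<close> is an arclength parametrization of the discrete surface and \<open>Lh\<close> its
  length.\<close>

definition W_red_mean_zero :: "layer \<Rightarrow> (lattice \<Rightarrow> lattice \<Rightarrow> real) \<Rightarrow> real \<Rightarrow> point \<Rightarrow>
    (point \<Rightarrow> real) \<Rightarrow> real \<Rightarrow> (real \<Rightarrow> point) \<Rightarrow> (point \<Rightarrow> real) set" where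
  "W_red_mean_zero ly w h a \<psi> Lh \<sigma> = {v \<in> W_red ly w h a \<psi>. curve_integral Lh \<sigma> v = 0}"

definition reduced_approximation :: "real \<Rightarrow> layer \<Rightarrow> (lattice \<Rightarrow> lattice \<Rightarrow> real) \<Rightarrow> real \<Rightarrow>
    point \<Rightarrow> (point \<Rightarrow> real) \<Rightarrow> real \<Rightarrow> (real \<Rightarrow> point) \<Rightarrow> bool" where
  "reduced_approximation C\<^sub>0 ly w h a \<psi> Lh \<sigma> \<longleftrightarrow>
     (\<forall>\<phi>\<in>H2_curve Lh \<sigma>. curve_integral Lh \<sigma> \<phi> = 0 \<longrightarrow>
        (\<exists>\<phi>'\<in>W_red_mean_zero ly w h a \<psi> Lh \<sigma>.
           H1_curve_norm Lh \<sigma> (\<lambda>x. \<phi> x - \<phi>' x) \<le> C\<^sub>0 * h * H2_curve_norm Lh \<sigma> \<phi>))"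

definition reduced_trace_solution :: "layer \<Rightarrow> (lattice \<Rightarrow> lattice \<Rightarrow> real) \<Rightarrow> real \<Rightarrow>
    point \<Rightarrow> (point \<Rightarrow> real) \<Rightarrow> real \<Rightarrow> (real \<Rightarrow> point) \<Rightarrow> (point \<Rightarrow> real) \<Rightarrow>
    (point \<Rightarrow> real) \<Rightarrow> bool" where
  "reduced_trace_solution ly w h a \<psi> Lh \<sigma> g u\<^sub>h \<longleftrightarrow>
     u\<^sub>h \<in> W_red_mean_zero ly w h a \<psi> Lh \<sigma> \<and>
     (\<forall>v\<in>W_red_mean_zero ly w h a \<psi> Lh \<sigma>.
        dirichlet_form Lh \<sigma> u\<^sub>h v =
        curve_integral Lh \<sigma> (\<lambda>x. g (closest_point {x. \<psi> x = 0} x) * v x))"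

definition lifted_solution ::
  "(point \<Rightarrow> real) \<Rightarrow> real \<Rightarrow> (real \<Rightarrow> point) \<Rightarrow> (point \<Rightarrow> real) \<Rightarrow> point \<Rightarrow> real" where
  "lifted_solution \<psi> Lh \<sigma> u x = u (closest_point {x. \<psi> x = 0} x) -
     curve_integral Lh \<sigma> (\<lambda>y. u (closest_point {x. \<psi> x = 0} y)) / Lh"

end

theory Submission
  imports Defs
begin

text \<open>Parametrized by arclength, everything happens on a circle of length \<open>l = |\<Gamma>\<^sup>h|\<close>.  Test functions have
  mean zero, so the reduced trace solution is exactly the Galerkin approximation of the mean-zero
  periodic solution \<open>P\<close> of \<open>- P'' = f - m\<close>, where \<open>f\<close> is \<open>g \<circ> p\<close> and \<open>m\<close> its mean; since \<open>P\<close>, unlike the lifted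
  solution, lies in \<open>H\<^sup>2\<close> of the polygon, Cea's lemma and the Aubin-Nitsche duality argument give an
  \<open>O(h\<^sup>2)\<close> error in \<open>L\<^sup>2\<close>.

  It remains to compare \<open>P\<close> with \<open>u \<circ> p\<close>.  The arclength parameter \<open>s\<close> of the projected point is a Lipschitz
  function with \<open>\<bar>s'\<bar> = 1 + O(h\<^sup>2)\<close>, so \<open>u \<circ> p\<close> satisfies the equation of \<open>P\<close> up to relative errors \<open>O(h\<^sup>2)\<close>,
  provided that \<open>s\<close> never turns back, since \<open>s'\<close> would then change sign.  This holds because the polygon is
  inscribed in \<open>\<Gamma>\<close>: transversality makes the curve cross each active cell in a single arc that meets
  the cell boundary only at its endpoints, and the chord projects injectively into this arc, so that \<open>p\<close>
  is injective on the polygon.  The harmonic extension enters only through the continuity of \<open>u\<close>.\<close>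

section \<open>Square-integrable functions on an interval\<close>

text \<open>The speed of the projection may jump at the vertices of the polygon, so
  \<open>u \<circ> p\<close> need not have a second derivative in L2 and the approximation property,
  stated for H2, cannot be applied to it; \<open>P\<close> takes its place. On the polygon
  \<open>g \<circ> p\<close> need not have mean zero, hence the subtraction of \<open>m\<close>.
  This \<open>m\<close> is O(h^2), because the integral of \<open>\<bar>s'\<bar>\<close> times
  \<open>g \<circ> p\<close> vanishes exactly.

  Weak derivatives are defined by a choice among functions tested against smooth periodic ones, so
  their uniqueness almost everywhere has to come before any norm can be computed; after that,
  functions are handled as explicit pairs of a primitive and its derivative. Membership in H2 fixes
  \<open>u\<close> only up to null sets, whereas the lifted solution evaluates \<open>u\<close>
  pointwise; continuity makes the primitive identity hold at every point.

  The constants involve only the curve (its curvature bound \<open>K\<close>, its bi-Lipschitz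
  constant, its length \<open>L\<close>) and the given \<open>C\<^sub>0\<close> and
  \<open>C\<^sub>p\<close>; the length of the polygon is removed by
  \<open>l \<le> 2 L\<close>.\<close>

definition L2_norm_on :: "real \<Rightarrow> (real \<Rightarrow> real) \<Rightarrow> real" where
  "L2_norm_on l f = sqrt (integral\<^sup>L (lebesgue_on {0..l}) (\<lambda>t. (f t)\<^sup>2))"

lemma finite_measure_lebesgue_interval: "finite_measure (lebesgue_on {a..b::real})"
proof
  show "emeasure (lebesgue_on {a..b}) (space (lebesgue_on {a..b})) \<noteq> \<infinity>"
    using emeasure_lborel_Icc_eq[of a b] by (simp add: emeasure_restrict_space)
qed

lemma measure_lebesgue_on_interval [simp]: "0 \<le> l \<Longrightarrow> measure (lebesgue_on {0..l}) {0..l} = (l::real)"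
  by (simp add: measure_restrict_space)

lemma L2_per_mult:
  assumes "f \<in> L2_per l" "g \<in> L2_per l"
  shows "integrable (lebesgue_on {0..l}) (\<lambda>t. f t * g t)"
proof (rule Bochner_Integration.integrable_bound)
  show "integrable (lebesgue_on {0..l}) (\<lambda>t. (f t)\<^sup>2 + (g t)\<^sup>2)"
    using assms by (auto simp: L2_per_def)
  show "(\<lambda>t. f t * g t) \<in> borel_measurable (lebesgue_on {0..l})"
    using assms by (auto simp: L2_per_def)
  have "\<bar>x * y\<bar> \<le> x\<^sup>2 + y\<^sup>2" for x y :: real
  proof -
    have "2 * \<bar>x * y\<bar> \<le> x\<^sup>2 + y\<^sup>2"
      using sum_squares_bound[of "\<bar>x\<bar>" "\<bar>y\<bar>"] by (simp add: abs_mult)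
    then show ?thesis by linarith
  qed
  then show "AE t in lebesgue_on {0..l}. norm (f t * g t) \<le> norm ((f t)\<^sup>2 + (g t)\<^sup>2)"
    by simp
qed

lemma L2_per_const [simp]: "(\<lambda>t. k) \<in> L2_per l"
  using finite_measure.integrable_const[OF finite_measure_lebesgue_interval]
  by (simp add: L2_per_def)

lemma L2_per_integrable: "f \<in> L2_per l \<Longrightarrow> integrable (lebesgue_on {0..l}) f"
  using L2_per_mult[of f l "\<lambda>t. 1"] by simp

lemma L2_per_add:
  assumes "f \<in> L2_per l" "g \<in> L2_per l"
  shows "(\<lambda>t. f t + g t) \<in> L2_per l"
proof -
  have "integrable (lebesgue_on {0..l}) (\<lambda>t. (f t)\<^sup>2 + 2 * (f t * g t) + (g t)\<^sup>2)"
    using assms L2_per_mult[OF assms]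
    by (intro Bochner_Integration.integrable_add integrable_mult_right) (auto simp: L2_per_def)
  then show ?thesis using assms by (auto simp: L2_per_def power2_sum algebra_simps)
qed

lemma L2_per_minus: "f \<in> L2_per l \<Longrightarrow> (\<lambda>t. - f t) \<in> L2_per l"
  by (auto simp: L2_per_def)

lemma L2_per_diff:
  assumes "f \<in> L2_per l" "g \<in> L2_per l"
  shows "(\<lambda>t. f t - g t) \<in> L2_per l"
  using L2_per_add[OF assms(1) L2_per_minus[OF assms(2)]] by simp

lemma L2_per_bounded:
  assumes "f \<in> borel_measurable (lebesgue_on {0..l})"
    and "AE t in lebesgue_on {0..l}. \<bar>f t\<bar> \<le> K"
  shows "f \<in> L2_per l"
proof -
  have "integrable (lebesgue_on {0..l}) (\<lambda>t. (f t)\<^sup>2)"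
  proof (rule Bochner_Integration.integrable_bound)
    show "integrable (lebesgue_on {0..l}) (\<lambda>t. K\<^sup>2)"
      using L2_per_const[of K] by (simp add: L2_per_def)
    show "(\<lambda>t. (f t)\<^sup>2) \<in> borel_measurable (lebesgue_on {0..l})" using assms by simp
    show "AE t in lebesgue_on {0..l}. norm ((f t)\<^sup>2) \<le> norm (K\<^sup>2)"
      using assms(2)
    proof eventually_elim
      case (elim t)
      then show ?case using power_mono[of "\<bar>f t\<bar>" K 2] by simp
    qed
  qed
  then show ?thesis using assms by (simp add: L2_per_def)
qed

lemma continuous_on_L2_per:
  assumes "continuous_on {0..l} f"
  shows "f \<in> L2_per l"
proof -
  have "continuous_on {0..l} (\<lambda>t. (f t)\<^sup>2)" by (intro continuous_intros assms)
  then show ?thesis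
    using assms by (auto simp: L2_per_def continuous_imp_integrable_real
        intro!: continuous_imp_measurable_on_sets_lebesgue)
qed

lemma L2_per_cong: "(\<And>t. t \<in> {0..l} \<Longrightarrow> f t = g t) \<Longrightarrow> f \<in> L2_per l \<longleftrightarrow> g \<in> L2_per l"
proof -
  assume eq: "\<And>t. t \<in> {0..l} \<Longrightarrow> f t = g t"
  have "f \<in> borel_measurable (lebesgue_on {0..l}) \<longleftrightarrow> g \<in> borel_measurable (lebesgue_on {0..l})"
    by (intro measurable_cong) (simp add: eq)
  moreover have "integrable (lebesgue_on {0..l}) (\<lambda>t. (f t)\<^sup>2) \<longleftrightarrow> integrable (lebesgue_on {0..l}) (\<lambda>t. (g t)\<^sup>2)"
    by (intro Bochner_Integration.integrable_cong) (simp_all add: eq)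
  ultimately show ?thesis by (simp add: L2_per_def)
qed

lemma L2_norm_on_nonneg [simp]: "0 \<le> L2_norm_on l f"
  by (simp add: L2_norm_on_def)

lemma L2_norm_on_sq:
  "(L2_norm_on l f)\<^sup>2 = integral\<^sup>L (lebesgue_on {0..l}) (\<lambda>t. (f t)\<^sup>2)"
  by (simp add: L2_norm_on_def)

lemma L2_norm_on_cong: "(\<And>t. t \<in> {0..l} \<Longrightarrow> f t = g t) \<Longrightarrow> L2_norm_on l f = L2_norm_on l g"
  unfolding L2_norm_on_def by (auto intro!: arg_cong[of _ _ sqrt] Bochner_Integration.integral_cong)

text \<open>The integral of \<open>(x f + y g)^2\<close> is a nonnegative quadratic form in
  \<open>x\<close> and \<open>y\<close>. The choice \<open>x = b\<^sup>2\<close>,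
  \<open>y = - k\<close> yields the inequality unless \<open>b = 0\<close>, where it says
  nothing.\<close>

lemma Cauchy_Schwarz_L2_per:
  assumes f: "f \<in> L2_per l" and g: "g \<in> L2_per l"
  shows "\<bar>integral\<^sup>L (lebesgue_on {0..l}) (\<lambda>t. f t * g t)\<bar> \<le> L2_norm_on l f * L2_norm_on l g"
proof -
  let ?I = "integral\<^sup>L (lebesgue_on {0..l})"
  define a where "a = L2_norm_on l f"
  define b where "b = L2_norm_on l g"
  define k where "k = ?I (\<lambda>t. f t * g t)"
  have ii: "integrable (lebesgue_on {0..l}) (\<lambda>t. (f t)\<^sup>2)"
    "integrable (lebesgue_on {0..l}) (\<lambda>t. (g t)\<^sup>2)"
    "integrable (lebesgue_on {0..l}) (\<lambda>t. f t * g t)"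
    using f g L2_per_mult[OF f g] by (auto simp: L2_per_def)
  have quad: "0 \<le> x\<^sup>2 * a\<^sup>2 + 2 * x * y * k + y\<^sup>2 * b\<^sup>2" for x y
  proof -
    have "0 \<le> ?I (\<lambda>t. (x * f t + y * g t)\<^sup>2)" by simp
    also have "\<dots> = ?I (\<lambda>t. x\<^sup>2 * (f t)\<^sup>2 + 2 * x * y * (f t * g t) + y\<^sup>2 * (g t)\<^sup>2)"
      by (intro Bochner_Integration.integral_cong) (auto simp: power2_eq_square algebra_simps)
    also have "\<dots> = x\<^sup>2 * a\<^sup>2 + 2 * x * y * k + y\<^sup>2 * b\<^sup>2"
      using ii by (simp add: a_def b_def k_def L2_norm_on_sq)
    finally show ?thesis .
  qed
  have ab: "a \<ge> 0" "b \<ge> 0" by (auto simp: a_def b_def)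
  have "k\<^sup>2 \<le> (a * b)\<^sup>2"
  proof (cases "b = 0")
    case True
    have "k = 0"
    proof (rule ccontr)
      assume "k \<noteq> 0"
      \<comment> \<open>This value of \<open>y\<close>, together with \<open>x = 1\<close>, makes
        the form equal to -1.\<close>
      have "0 \<le> a\<^sup>2 + 2 * (- (a\<^sup>2 + 1) / (2 * k)) * k"
        using quad[of 1 "- (a\<^sup>2 + 1) / (2 * k)"] True by simp
      then show False using \<open>k \<noteq> 0\<close> by (simp add: field_simps)
    qed
    then show ?thesis by simp
  next
    case False
    have "0 \<le> (b\<^sup>2)\<^sup>2 * a\<^sup>2 + 2 * b\<^sup>2 * (- k) * k + (- k)\<^sup>2 * b\<^sup>2" using quad[of "b\<^sup>2" "- k"] by simp
    also have "\<dots> = b\<^sup>2 * ((a * b)\<^sup>2 - k\<^sup>2)" by (simp add: power2_eq_square algebra_simps)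
    finally have "0 \<le> b\<^sup>2 * ((a * b)\<^sup>2 - k\<^sup>2)" .
    moreover have "0 < b\<^sup>2" using False by simp
    ultimately show ?thesis by (simp add: zero_le_mult_iff)
  qed
  then have "\<bar>k\<bar> \<le> \<bar>a * b\<bar>" by (simp add: abs_le_square_iff)
  then show ?thesis using ab by (simp add: k_def a_def b_def)
qed

lemma L2_norm_on_triangle:
  assumes f: "f \<in> L2_per l" and g: "g \<in> L2_per l"
  shows "L2_norm_on l (\<lambda>t. f t + g t) \<le> L2_norm_on l f + L2_norm_on l g"
proof (rule power2_le_imp_le)
  let ?I = "integral\<^sup>L (lebesgue_on {0..l})"
  have ii: "integrable (lebesgue_on {0..l}) (\<lambda>t. (f t)\<^sup>2)"
    "integrable (lebesgue_on {0..l}) (\<lambda>t. (g t)\<^sup>2)"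
    "integrable (lebesgue_on {0..l}) (\<lambda>t. f t * g t)"
    using f g L2_per_mult[OF f g] by (auto simp: L2_per_def)
  have "(L2_norm_on l (\<lambda>t. f t + g t))\<^sup>2 = ?I (\<lambda>t. (f t)\<^sup>2 + 2 * (f t * g t) + (g t)\<^sup>2)"
    unfolding L2_norm_on_sq
    by (intro Bochner_Integration.integral_cong) (auto simp: power2_eq_square algebra_simps)
  also have "\<dots> = (L2_norm_on l f)\<^sup>2 + 2 * ?I (\<lambda>t. f t * g t) + (L2_norm_on l g)\<^sup>2"
    using ii by (simp add: L2_norm_on_sq)
  also have "\<dots> \<le> (L2_norm_on l f + L2_norm_on l g)\<^sup>2"
    using Cauchy_Schwarz_L2_per[OF f g] by (simp add: power2_sum)
  finally show "(L2_norm_on l (\<lambda>t. f t + g t))\<^sup>2 \<le> (L2_norm_on l f + L2_norm_on l g)\<^sup>2" .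
qed simp

lemma L2_norm_on_bound:
  assumes "0 \<le> l" "0 \<le> K" "\<And>t. t \<in> {0..l} \<Longrightarrow> \<bar>f t\<bar> \<le> K"
  shows "L2_norm_on l f \<le> sqrt l * K"
proof (cases "integrable (lebesgue_on {0..l}) (\<lambda>t. (f t)\<^sup>2)")
  case True
  have "integral\<^sup>L (lebesgue_on {0..l}) (\<lambda>t. (f t)\<^sup>2) \<le> integral\<^sup>L (lebesgue_on {0..l}) (\<lambda>t. K\<^sup>2)"
  proof (rule integral_mono_AE[OF True])
    show "integrable (lebesgue_on {0..l}) (\<lambda>t. K\<^sup>2)"
      using L2_per_const[of K l] by (simp add: L2_per_def)
    show "AE t in lebesgue_on {0..l}. (f t)\<^sup>2 \<le> K\<^sup>2"
    proof (rule AE_I2)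
      fix t assume "t \<in> space (lebesgue_on {0..l})"
      then have "\<bar>f t\<bar> \<le> K" using assms by simp
      then show "(f t)\<^sup>2 \<le> K\<^sup>2" using power_mono[of "\<bar>f t\<bar>" K 2] by simp
    qed
  qed
  also have "\<dots> = l * K\<^sup>2" using assms(1) by simp
  finally show ?thesis
    using assms(1,2) real_sqrt_le_mono[of "integral\<^sup>L (lebesgue_on {0..l}) (\<lambda>t. (f t)\<^sup>2)" "l * K\<^sup>2"]
    by (simp add: L2_norm_on_def real_sqrt_mult)
next
  \<comment> \<open>A Bochner integral that does not exist is 0 by convention, so the bound persists
    without measurability of \<open>f\<close>.\<close>
  case False
  then show ?thesis using assms(1,2) by (simp add: L2_norm_on_def not_integrable_integral_eq)
qed

lemma integral_abs_le_L2_norm: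
  assumes f: "f \<in> L2_per l" and "0 \<le> l"
  shows "integral\<^sup>L (lebesgue_on {0..l}) (\<lambda>t. \<bar>f t\<bar>) \<le> sqrt l * L2_norm_on l f"
proof -
  have "(\<lambda>t. \<bar>f t\<bar>) \<in> L2_per l" using f by (auto simp: L2_per_def)
  from Cauchy_Schwarz_L2_per[OF this L2_per_const[of 1]]
  have "integral\<^sup>L (lebesgue_on {0..l}) (\<lambda>t. \<bar>f t\<bar>) \<le>
      L2_norm_on l (\<lambda>t. \<bar>f t\<bar>) * L2_norm_on l (\<lambda>t. 1)" by simp
  then show ?thesis using assms by (simp add: L2_norm_on_def mult.commute)
qed

section \<open>Periodic primitives\<close>

text \<open>An element of H1 of the circle of length \<open>l\<close>, kept as its continuous
  representative \<open>F\<close> together with one derivative \<open>f\<close>. Everything is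
  required on \<open>{0..l}\<close> only, so the functions need not be periodic beyond it.\<close>

definition periodic_primitive :: "real \<Rightarrow> (real \<Rightarrow> real) \<Rightarrow> (real \<Rightarrow> real) \<Rightarrow> bool" where
  "periodic_primitive l F f \<longleftrightarrow> f \<in> L2_per l \<and> F l = F 0 \<and>
     (\<forall>t\<in>{0..l}. F t = F 0 + integral {0..t} f)"

lemma periodic_primitiveD:
  assumes "periodic_primitive l F f"
  shows "f \<in> L2_per l" "F l = F 0" "0 \<le> t \<Longrightarrow> t \<le> l \<Longrightarrow> F t = F 0 + integral {0..t} f"
  using assms unfolding periodic_primitive_def by (blast, blast, metis atLeastAtMost_iff)

lemma periodic_primitiveI:
  assumes "f \<in> L2_per l" "F l = F 0"
    and "\<And>t. 0 \<le> t \<Longrightarrow> t \<le> l \<Longrightarrow> F t = F 0 + integral {0..t} f"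
  shows "periodic_primitive l F f"
  using assms unfolding periodic_primitive_def by (metis atLeastAtMost_iff)

lemma L2_per_integrable_on:
  assumes "f \<in> L2_per l" "0 \<le> a" "b \<le> l"
  shows "f integrable_on {a..b}"
proof -
  have "f integrable_on {0..l}"
    using L2_per_integrable[OF assms(1)] by (simp add: integrable_on_lebesgue_on)
  then show ?thesis using assms integrable_on_subinterval[of f "{0..l}" a b] by auto
qed

lemma L2_per_absolutely_integrable_on:
  assumes "f \<in> L2_per l" "0 \<le> a" "b \<le> l"
  shows "f absolutely_integrable_on {a..b}"
proof -
  have "f absolutely_integrable_on {0..l}"
    using L2_per_integrable[OF assms(1)]
    by (simp add: set_integrable_def integrable_restrict_space)
  then show ?thesis using assms(2,3) by (auto intro: absolutely_integrable_on_subinterval)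
qed

lemma L2_per_integral_eq:
  assumes "f \<in> L2_per l"
  shows "integral\<^sup>L (lebesgue_on {0..l}) f = integral {0..l} f"
  using L2_per_integrable[OF assms] by (simp add: lebesgue_integral_eq_integral)

lemma integral_restrict_lebesgue_on:
  assumes f: "f \<in> L2_per l" and "0 \<le> r" "r \<le> l"
  shows "integral\<^sup>L (lebesgue_on {0..l}) (\<lambda>t. indicator {0..r} t * f t) = integral {0..r} f"
proof -
  have "integral\<^sup>L (lebesgue_on {0..l}) (\<lambda>t. indicator {0..r} t * f t)
      = integral\<^sup>L lebesgue (\<lambda>t. indicator {0..l} t * (indicator {0..r} t * f t))"
    by (subst integral_restrict_space) auto
  also have "\<dots> = integral\<^sup>L lebesgue (\<lambda>t. indicator {0..r} t * f t)"
    by (intro Bochner_Integration.integral_cong) (use assms in \<open>auto split: split_indicator\<close>)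
  also have "\<dots> = integral {0..r} f"
    using set_lebesgue_integral_eq_integral(2)[of "{0..r}" f]
      L2_per_absolutely_integrable_on[OF f, of 0 r] assms
    unfolding set_lebesgue_integral_def by simp
  finally show ?thesis .
qed

lemma periodic_primitive_increment:
  assumes F: "periodic_primitive l F f" and "0 \<le> a" "a \<le> b" "b \<le> l"
  shows "F b - F a = integral {a..b} f"
proof -
  have "f integrable_on {0..b}"
    using periodic_primitiveD(1)[OF F] assms(2-) by (intro L2_per_integrable_on[where l=l]) auto
  then have "integral {0..a} f + integral {a..b} f = integral {0..b} f"
    using assms(2-) by (intro Henstock_Kurzweil_Integration.integral_combine) auto
  then show ?thesis
    using assms(2-) periodic_primitiveD(3)[OF F, of a] periodic_primitiveD(3)[OF F, of b] by auto
qed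

lemma periodic_primitive_continuous:
  assumes "periodic_primitive l F f"
  shows "continuous_on {0..l} F"
proof -
  have "continuous_on {0..l} (\<lambda>t. F 0 + integral {0..t} f)"
    using periodic_primitiveD(1)[OF assms]
    by (intro continuous_intros indefinite_integral_continuous_1 L2_per_integrable_on[where l=l]) auto
  then show ?thesis
    by (rule continuous_on_eq) (metis periodic_primitiveD(3)[OF assms] atLeastAtMost_iff)
qed

lemma periodic_primitive_L2: "periodic_primitive l F f \<Longrightarrow> F \<in> L2_per l"
  by (intro continuous_on_L2_per periodic_primitive_continuous)

lemma periodic_primitive_integral_zero:
  assumes "periodic_primitive l F f" "0 \<le> l"
  shows "integral\<^sup>L (lebesgue_on {0..l}) f = 0"
  using periodic_primitive_increment[OF assms(1), of 0 l] periodic_primitiveD(1,2)[OF assms(1)] assms(2)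
  by (subst L2_per_integral_eq) auto

lemma periodic_primitive_diff:
  assumes F: "periodic_primitive l F f" and G: "periodic_primitive l G g"
  shows "periodic_primitive l (\<lambda>t. F t - G t) (\<lambda>t. f t - g t)"
proof (rule periodic_primitiveI)
  note f = periodic_primitiveD[OF F] and g = periodic_primitiveD[OF G]
  show "(\<lambda>t. f t - g t) \<in> L2_per l" using f(1) g(1) by (rule L2_per_diff)
  show "F l - G l = F 0 - G 0" using f(2) g(2) by simp
  fix t assume t: "0 \<le> t" "t \<le> l"
  have "integral {0..t} (\<lambda>t. f t - g t) = integral {0..t} f - integral {0..t} g"
    using t f(1) g(1)
    by (intro Henstock_Kurzweil_Integration.integral_diff L2_per_integrable_on[where l=l]) auto
  then show "F t - G t = F 0 - G 0 + integral {0..t} (\<lambda>t. f t - g t)"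
    using f(3)[OF t] g(3)[OF t] by simp
qed

lemma periodic_primitive_cong:
  assumes F: "periodic_primitive l F f" and "0 \<le> l" "\<And>t. t \<in> {0..l} \<Longrightarrow> G t = F t"
  shows "periodic_primitive l G f"
proof (rule periodic_primitiveI)
  show "G t = G 0 + integral {0..t} f" if "0 \<le> t" "t \<le> l" for t
    using periodic_primitiveD(3)[OF F that] assms(3)[of t] assms(3)[of 0] that by auto
qed (use assms(2) assms(3)[of 0] assms(3)[of l] periodic_primitiveD(1,2)[OF F] in auto)

lemma periodic_primitive_osc:
  assumes F: "periodic_primitive l F f" and st: "s \<in> {0..l}" "t \<in> {0..l}"
  shows "\<bar>F t - F s\<bar> \<le> integral\<^sup>L (lebesgue_on {0..l}) (\<lambda>t. \<bar>f t\<bar>)"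
proof -
  have f: "f \<in> L2_per l" and fa: "(\<lambda>t. \<bar>f t\<bar>) \<in> L2_per l"
    using periodic_primitiveD(1)[OF F] by (auto simp: L2_per_def)
  have main: "\<bar>F b - F a\<bar> \<le> integral\<^sup>L (lebesgue_on {0..l}) (\<lambda>t. \<bar>f t\<bar>)"
    if "0 \<le> a" "a \<le> b" "b \<le> l" for a b
  proof -
    have "\<bar>F b - F a\<bar> = norm (integral {a..b} f)"
      using periodic_primitive_increment[OF F that] by simp
    also have "\<dots> \<le> integral {a..b} (\<lambda>t. \<bar>f t\<bar>)"
      using that by (intro integral_norm_bound_integral L2_per_integrable_on[OF f] L2_per_integrable_on[OF fa]) auto
    also have "\<dots> \<le> integral {0..l} (\<lambda>t. \<bar>f t\<bar>)"
      using that by (intro integral_subset_le L2_per_integrable_on[OF fa]) auto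
    finally show ?thesis using L2_per_integral_eq[OF fa] by simp
  qed
  show ?thesis
    using main[of s t] main[of t s] st by (cases "s \<le> t") (auto simp: abs_minus_commute)
qed

text \<open>The average of \<open>F t - F s\<close> over \<open>s\<close> is \<open>F t\<close>,
  because \<open>F\<close> has mean zero.\<close>

lemma mean_zero_sup_bound:
  fixes F :: "real \<Rightarrow> real"
  assumes l: "0 < l" and int: "integrable (lebesgue_on {0..l}) F"
    and F0: "integral\<^sup>L (lebesgue_on {0..l}) F = 0"
    and osc: "\<And>s t. s \<in> {0..l} \<Longrightarrow> t \<in> {0..l} \<Longrightarrow> \<bar>F t - F s\<bar> \<le> K" and t: "t \<in> {0..l}"
  shows "\<bar>F t\<bar> \<le> K"
proof -
  let ?I = "integral\<^sup>L (lebesgue_on {0..l})"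
  have c: "integrable (lebesgue_on {0..l}) (\<lambda>s. k)" for k :: real
    using L2_per_integrable[OF L2_per_const] .
  have eq: "?I (\<lambda>s. F t - F s) = l * F t"
    using int c F0 l by simp
  have "l * \<bar>F t\<bar> = \<bar>?I (\<lambda>s. F t - F s)\<bar>" unfolding eq using l by (simp add: abs_mult)
  also have "\<dots> \<le> ?I (\<lambda>s. \<bar>F t - F s\<bar>)" by (rule integral_abs_bound)
  also have "\<dots> \<le> ?I (\<lambda>s. K)"
    using int c osc t by (intro integral_mono_AE integrable_abs Bochner_Integration.integrable_diff)
      (auto intro!: AE_I2)
  also have "\<dots> = l * K" using l by simp
  finally show ?thesis using l by simp
qed

lemma periodic_primitive_Poincare_sup:
  assumes F: "periodic_primitive l F f" and l: "0 < l"
    and F0: "integral\<^sup>L (lebesgue_on {0..l}) F = 0" and t: "t \<in> {0..l}"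
  shows "\<bar>F t\<bar> \<le> sqrt l * L2_norm_on l f"
proof (rule mean_zero_sup_bound[OF l L2_per_integrable[OF periodic_primitive_L2[OF F]] F0 _ t])
  have "f \<in> L2_per l" using F by (rule periodic_primitiveD)
  from integral_abs_le_L2_norm[OF this]
  show "\<bar>F t - F s\<bar> \<le> sqrt l * L2_norm_on l f" if "s \<in> {0..l}" "t \<in> {0..l}" for s t
    using periodic_primitive_osc[OF F that] l by linarith
qed

lemma periodic_primitive_Poincare:
  assumes F: "periodic_primitive l F f" and l: "0 < l"
    and F0: "integral\<^sup>L (lebesgue_on {0..l}) F = 0"
  shows "L2_norm_on l F \<le> l * L2_norm_on l f"
proof -
  have "L2_norm_on l F \<le> sqrt l * (sqrt l * L2_norm_on l f)"
    using l by (intro L2_norm_on_bound periodic_primitive_Poincare_sup[OF F l F0]) auto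
  then show ?thesis using l by (simp flip: mult.assoc)
qed

text \<open>\<open>f\<close> and \<open>g\<close> are merely in L2, so no classical product rule is
  at hand. Instead \<open>f r * g t\<close> is integrated over the square and the square is cut
  along its diagonal; each triangle contributes one of the two integrals by Fubini.\<close>

lemma integral_by_parts_primitives:
  fixes f g :: "real \<Rightarrow> real"
  assumes f: "f \<in> L2_per l" and g: "g \<in> L2_per l" and l: "0 \<le> l"
  shows "integral\<^sup>L (lebesgue_on {0..l}) (\<lambda>t. integral {0..t} f * g t)
       + integral\<^sup>L (lebesgue_on {0..l}) (\<lambda>t. f t * integral {0..t} g)
       = integral {0..l} f * integral {0..l} g"
proof -
  define M where "M = lebesgue_on {0..l}"
  have fm: "finite_measure M" unfolding M_def by (rule finite_measure_lebesgue_interval)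
  interpret P: pair_sigma_finite M M
    using fm by (simp add: pair_sigma_finite_def finite_measure_def)
  have fi: "integrable M f" and gi: "integrable M g"
    using f g L2_per_integrable by (auto simp: M_def)
  have [measurable]: "f \<in> borel_measurable M" "g \<in> borel_measurable M"
    using fi gi by auto
  have id [measurable]: "(\<lambda>x. x) \<in> measurable M borel"
    unfolding M_def by (intro measurable_restrict_space1 measurable_completion) simp
  define A where "A = (\<lambda>(r, t). if r \<le> t then f r * g t else (0::real))"
  define B where "B = (\<lambda>(r, t). if r \<le> t then 0 else f r * g t)"
  have prod: "integrable (M \<Otimes>\<^sub>M M) (\<lambda>(r, t). f r * g t)"
  proof (rule P.Fubini_integrable)
    show "(\<lambda>(r, t). f r * g t) \<in> borel_measurable (M \<Otimes>\<^sub>M M)" by measurable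
    have "integrable M (\<lambda>x. norm (f x) * integral\<^sup>L M (\<lambda>y. norm (g y)))"
      using fi by simp
    then show "integrable M (\<lambda>x. \<integral> y. norm (case (x, y) of (r, t) \<Rightarrow> f r * g t) \<partial>M)"
      by (simp add: abs_mult)
    show "AE x in M. integrable M (\<lambda>y. case (x, y) of (r, t) \<Rightarrow> f r * g t)"
      using gi by simp
  qed
  have Am [measurable]: "A \<in> borel_measurable (M \<Otimes>\<^sub>M M)" and Bm [measurable]: "B \<in> borel_measurable (M \<Otimes>\<^sub>M M)"
    unfolding A_def B_def by measurable
  have Ai: "integrable (M \<Otimes>\<^sub>M M) A"
    by (rule Bochner_Integration.integrable_bound[OF prod Am]) (auto simp: A_def)
  have Bi: "integrable (M \<Otimes>\<^sub>M M) B"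
    by (rule Bochner_Integration.integrable_bound[OF prod Bm]) (auto simp: B_def)
  have total: "integral\<^sup>L (M \<Otimes>\<^sub>M M) A + integral\<^sup>L (M \<Otimes>\<^sub>M M) B = integral\<^sup>L M f * integral\<^sup>L M g"
  proof -
    have "integral\<^sup>L (M \<Otimes>\<^sub>M M) A + integral\<^sup>L (M \<Otimes>\<^sub>M M) B = integral\<^sup>L (M \<Otimes>\<^sub>M M) (\<lambda>x. A x + B x)"
      using Ai Bi by simp
    also have "\<dots> = integral\<^sup>L (M \<Otimes>\<^sub>M M) (\<lambda>(r, t). f r * g t)"
      by (intro Bochner_Integration.integral_cong) (auto simp: A_def B_def)
    also have "\<dots> = integral\<^sup>L M (\<lambda>r. integral\<^sup>L M (\<lambda>t. f r * g t))"
      using P.integral_fst'[OF prod] by simp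
    finally show ?thesis by simp
  qed
  have A1: "integral\<^sup>L (M \<Otimes>\<^sub>M M) A = integral\<^sup>L M (\<lambda>t. integral {0..t} f * g t)"
  proof -
    have "integral\<^sup>L (M \<Otimes>\<^sub>M M) A = integral\<^sup>L M (\<lambda>t. integral\<^sup>L M (\<lambda>r. A (r, t)))"
      using P.integral_snd[of "\<lambda>r t. A (r, t)"] Ai by simp
    also have "\<dots> = integral\<^sup>L M (\<lambda>t. integral {0..t} f * g t)"
    proof (rule Bochner_Integration.integral_cong[OF refl])
      fix t assume "t \<in> space M"
      then have t: "0 \<le> t" "t \<le> l" by (auto simp: M_def)
      have "integral\<^sup>L M (\<lambda>r. A (r, t)) = integral\<^sup>L M (\<lambda>r. (indicator {0..t} r * f r) * g t)"
        by (intro Bochner_Integration.integral_cong)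
          (auto simp: A_def M_def split: split_indicator)
      also have "\<dots> = integral {0..t} f * g t"
        using integral_restrict_lebesgue_on[OF f t] by (simp add: M_def)
      finally show "integral\<^sup>L M (\<lambda>r. A (r, t)) = integral {0..t} f * g t" .
    qed
    finally show ?thesis .
  qed
  have B1: "integral\<^sup>L (M \<Otimes>\<^sub>M M) B = integral\<^sup>L M (\<lambda>t. f t * integral {0..t} g)"
  proof -
    have "integral\<^sup>L (M \<Otimes>\<^sub>M M) B = integral\<^sup>L M (\<lambda>r. integral\<^sup>L M (\<lambda>t. B (r, t)))"
      using P.integral_fst'[OF Bi] by simp
    also have "\<dots> = integral\<^sup>L M (\<lambda>t. f t * integral {0..t} g)"
    proof (rule Bochner_Integration.integral_cong[OF refl])
      fix r assume "r \<in> space M"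
      then have r: "0 \<le> r" "r \<le> l" by (auto simp: M_def)
      \<comment> \<open>\<open>B\<close> leaves the diagonal to \<open>A\<close>, whereas
        \<open>{0..r}\<close> contains its right end point; the difference is the null set
        \<open>{r}\<close>.\<close>
      have "AE t in lebesgue. t \<noteq> r"
        using negligible_sing[of r] by (auto simp: negligible_iff_null_sets intro!: AE_I'[of "{r}"])
      then have "AE t in M. t \<noteq> r"
        unfolding M_def by (subst AE_restrict_space_iff) auto
      then have "AE t in M. B (r, t) = f r * (indicator {0..r} t * g t)"
        using AE_space
      proof eventually_elim
        case (elim t)
        then show ?case by (auto simp: B_def M_def split: split_indicator)
      qed
      then have "integral\<^sup>L M (\<lambda>t. B (r, t)) = integral\<^sup>L M (\<lambda>t. f r * (indicator {0..r} t * g t))"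
        by (intro integral_cong_AE) (auto simp: B_def)
      also have "\<dots> = f r * integral {0..r} g"
        using integral_restrict_lebesgue_on[OF g r] by (simp add: M_def)
      finally show "integral\<^sup>L M (\<lambda>t. B (r, t)) = f r * integral {0..r} g" .
    qed
    finally show ?thesis .
  qed
  show ?thesis
    using total A1 B1 L2_per_integral_eq[OF f] L2_per_integral_eq[OF g] by (simp add: M_def)
qed

lemma periodic_primitive_by_parts:
  assumes F: "periodic_primitive l F f" and G: "periodic_primitive l G g" and l: "0 \<le> l"
  shows "integral\<^sup>L (lebesgue_on {0..l}) (\<lambda>t. F t * g t)
       = - integral\<^sup>L (lebesgue_on {0..l}) (\<lambda>t. f t * G t)"
proof -
  let ?I = "integral\<^sup>L (lebesgue_on {0..l})"
  have f: "f \<in> L2_per l" and g: "g \<in> L2_per l"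
    using periodic_primitiveD(1)[OF F] periodic_primitiveD(1)[OF G] by auto
  have c1: "(\<lambda>t. integral {0..t} f) \<in> L2_per l" "(\<lambda>t. integral {0..t} g) \<in> L2_per l"
    using f g by (auto intro!: continuous_on_L2_per indefinite_integral_continuous_1 L2_per_integrable_on[where l=l])
  have zero: "integral {0..l} f = 0" "integral {0..l} g = 0" "?I f = 0" "?I g = 0"
    using periodic_primitive_increment[OF F, of 0 l] periodic_primitive_increment[OF G, of 0 l] l
      L2_per_integral_eq[OF f] L2_per_integral_eq[OF g]
      periodic_primitiveD(2)[OF F] periodic_primitiveD(2)[OF G]
    by auto
  have "?I (\<lambda>t. F t * g t) = ?I (\<lambda>t. F 0 * g t + integral {0..t} f * g t)"
  proof (rule Bochner_Integration.integral_cong[OF refl])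
    fix t assume "t \<in> space (lebesgue_on {0..l})"
    then have "F t = F 0 + integral {0..t} f" by (intro periodic_primitiveD(3)[OF F]) auto
    then show "F t * g t = F 0 * g t + integral {0..t} f * g t" by (simp only: distrib_right)
  qed
  also have "\<dots> = ?I (\<lambda>t. integral {0..t} f * g t)"
    using L2_per_integrable[OF g] L2_per_mult[OF c1(1) g] zero by simp
  also have "\<dots> = - ?I (\<lambda>t. f t * integral {0..t} g)"
    using integral_by_parts_primitives[OF f g l] zero by simp
  also have "?I (\<lambda>t. f t * integral {0..t} g) = ?I (\<lambda>t. f t * G 0 + f t * integral {0..t} g)"
    using L2_per_integrable[OF f] L2_per_mult[OF f c1(2)] zero by simp
  also have "\<dots> = ?I (\<lambda>t. f t * G t)"
  proof (rule Bochner_Integration.integral_cong[OF refl])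
    fix t assume "t \<in> space (lebesgue_on {0..l})"
    then have "G t = G 0 + integral {0..t} g" by (intro periodic_primitiveD(3)[OF G]) auto
    then show "f t * G 0 + f t * integral {0..t} g = f t * G t" by (simp only: distrib_left)
  qed
  finally show ?thesis .
qed

text \<open>The constant of integration is used to give the primitive mean zero as well, so that the
  lemma applies to its own result: two applications solve a Poisson problem on the circle.\<close>

lemma periodic_primitive_exists:
  assumes f: "f \<in> L2_per l" and f0: "integral\<^sup>L (lebesgue_on {0..l}) f = 0" and l: "0 < l"
  obtains F where "periodic_primitive l F f" "integral\<^sup>L (lebesgue_on {0..l}) F = 0"
proof -
  define P where "P = (\<lambda>t. integral {0..t} f)"
  define k where "k = integral\<^sup>L (lebesgue_on {0..l}) P / l"
  have pl: "P l = 0" using f0 L2_per_integral_eq[OF f] by (simp add: P_def)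
  have pp: "periodic_primitive l (\<lambda>t. P t - k) f"
    using f pl by (intro periodic_primitiveI) (auto simp: P_def)
  have "periodic_primitive l P f"
    using f pl by (intro periodic_primitiveI) (auto simp: P_def)
  from L2_per_integrable[OF periodic_primitive_L2[OF this]]
  have "integral\<^sup>L (lebesgue_on {0..l}) (\<lambda>t. P t - k) = 0"
    using l L2_per_integrable[OF L2_per_const[of k l]] by (simp add: k_def)
  with pp that show thesis by blast
qed

section \<open>Uniqueness of weak derivatives\<close>

lemma has_real_derivative_partial:
  assumes "\<And>x. (f has_real_derivative f' x) (at x)"
  shows "partial 1 f = f'"
proof
  fix x
  have "(f has_derivative (\<lambda>h. f' x * h)) (at x)"
    using assms[of x] by (simp add: has_field_derivative_def)
  then have "frechet_derivative f (at x) = (\<lambda>h. f' x * h)"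
    by (rule frechet_derivative_at[symmetric])
  then show "partial 1 f x = f' x" by (simp add: partial_def)
qed

lemma Ck_on_Suc_deriv:
  assumes "\<And>x. (f has_real_derivative f' x) (at x)"
  shows "Ck_on (Suc k) UNIV f \<longleftrightarrow> Ck_on k UNIV f'"
  using has_real_derivative_partial[OF assms] assms
  by (auto simp: real_differentiable_def)

lemma smooth_on_deriv:
  fixes f :: "real \<Rightarrow> real"
  assumes "smooth_on UNIV f"
  shows "(f has_real_derivative deriv f x) (at x)" "smooth_on UNIV (deriv f)"
    "continuous_on UNIV (deriv f)"
proof -
  have "Ck_on (Suc k) UNIV f" for k using assms unfolding smooth_on_def by blast
  from this[of 0] have d: "(f has_real_derivative deriv f x) (at x)" for x
    by (simp add: DERIV_deriv_iff_real_differentiable)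
  then show "(f has_real_derivative deriv f x) (at x)" .
  show sm: "smooth_on UNIV (deriv f)"
    unfolding smooth_on_def using \<open>\<And>k. Ck_on (Suc k) UNIV f\<close> Ck_on_Suc_deriv[OF d] by blast
  then have "Ck_on 0 UNIV (deriv f)" unfolding smooth_on_def by blast
  then show "continuous_on UNIV (deriv f)" by simp
qed

text \<open>With \<open>w = 2 * pi / l\<close> these are smooth test functions of period
  \<open>l\<close>, closed under differentiation and rich enough to contain the pullback to the
  circle of every polynomial in two variables.\<close>

inductive trig_polynomial :: "real \<Rightarrow> (real \<Rightarrow> real) \<Rightarrow> bool" for w where
  cos: "trig_polynomial w (\<lambda>t. cos (w * t))"
| sin: "trig_polynomial w (\<lambda>t. sin (w * t))"
| const: "trig_polynomial w (\<lambda>t. k)"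
| add: "trig_polynomial w f \<Longrightarrow> trig_polynomial w g \<Longrightarrow> trig_polynomial w (\<lambda>t. f t + g t)"
| mult: "trig_polynomial w f \<Longrightarrow> trig_polynomial w g \<Longrightarrow> trig_polynomial w (\<lambda>t. f t * g t)"

lemma trig_polynomial_deriv:
  assumes "trig_polynomial w f"
  shows "\<exists>f'. trig_polynomial w f' \<and> (\<forall>x. (f has_real_derivative f' x) (at x))"
  using assms
proof induction
  case cos
  have "((\<lambda>t. cos (w * t)) has_real_derivative (- w) * sin (w * x)) (at x)" for x
    by (auto intro!: derivative_eq_intros)
  then show ?case using trig_polynomial.mult[OF trig_polynomial.const trig_polynomial.sin] by blast
next
  case sin
  have "((\<lambda>t. sin (w * t)) has_real_derivative w * cos (w * x)) (at x)" for x
    by (auto intro!: derivative_eq_intros)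
  then show ?case using trig_polynomial.mult[OF trig_polynomial.const trig_polynomial.cos] by blast
next
  case (const k)
  have "((\<lambda>t. k) has_real_derivative 0) (at x)" for x :: real by simp
  then show ?case using trig_polynomial.const[of w 0] by blast
next
  case (add f g)
  then obtain f' g' where fg: "trig_polynomial w f'" "trig_polynomial w g'"
    "\<And>x. (f has_real_derivative f' x) (at x)" "\<And>x. (g has_real_derivative g' x) (at x)" by blast
  have "((\<lambda>t. f t + g t) has_real_derivative f' x + g' x) (at x)" for x
    using fg by (intro DERIV_add) auto
  then show ?case using trig_polynomial.add[OF fg(1,2)] by blast
next
  case (mult f g)
  then obtain f' g' where fg: "trig_polynomial w f'" "trig_polynomial w g'"
    "\<And>x. (f has_real_derivative f' x) (at x)" "\<And>x. (g has_real_derivative g' x) (at x)" by blast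
  have "((\<lambda>t. f t * g t) has_real_derivative f' x * g x + g' x * f x) (at x)" for x
    using fg by (intro DERIV_mult) auto
  moreover have "trig_polynomial w (\<lambda>x. f' x * g x + g' x * f x)"
    using fg mult by (intro trig_polynomial.add trig_polynomial.mult)
  ultimately show ?case by blast
qed

lemma trig_polynomial_smooth:
  assumes "trig_polynomial w f"
  shows "smooth_on UNIV f"
proof -
  have "trig_polynomial w f \<Longrightarrow> Ck_on k UNIV f" for k f
  proof (induction k arbitrary: f)
    case 0
    then obtain f' where "\<And>x. (f has_real_derivative f' x) (at x)" using trig_polynomial_deriv by blast
    then show ?case by (auto intro!: DERIV_isCont continuous_at_imp_continuous_on)
  next
    case (Suc k)
    then obtain f' where f': "trig_polynomial w f'" "\<And>x. (f has_real_derivative f' x) (at x)"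
      using trig_polynomial_deriv by blast
    show ?case unfolding Ck_on_Suc_deriv[OF f'(2)] by (rule Suc.IH[OF f'(1)])
  qed
  then show ?thesis using assms by (simp add: smooth_on_def)
qed

lemma trig_polynomial_periodic:
  assumes "trig_polynomial (2 * pi / l) f" "l \<noteq> 0"
  shows "f (t + l) = f t"
  using assms
proof induction
  case cos
  have "2 * pi / l * (t + l) = 2 * pi / l * t + 2 * pi" using cos by (simp add: field_simps)
  then show ?case by simp
next
  case sin
  have "2 * pi / l * (t + l) = 2 * pi / l * t + 2 * pi" using sin by (simp add: field_simps)
  then show ?case by simp
qed auto

text \<open>Polynomials on the circle, which are what Stone-Weierstrass approximation provides,
  thereby become admissible test functions.\<close>

lemma real_polynomial_function_trig:
  fixes p :: "real \<times> real \<Rightarrow> real"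
  assumes "real_polynomial_function p"
  shows "trig_polynomial w (\<lambda>t. p (cos (w * t), sin (w * t)))"
  using assms
proof induction
  case (linear f)
  interpret bounded_linear f by fact
  have eq: "f (a, b) = a * f (1, 0) + b * f (0, 1)" for a b
  proof -
    have "f (a, b) = f (a *\<^sub>R (1, 0) + b *\<^sub>R (0, 1))" by simp
    also have "\<dots> = a * f (1, 0) + b * f (0, 1)" by (simp only: add scaleR real_scaleR_def)
    finally show ?thesis .
  qed
  have "(\<lambda>t. f (cos (w * t), sin (w * t))) = (\<lambda>t. cos (w * t) * f (1, 0) + sin (w * t) * f (0, 1))"
    by (rule ext) (rule eq)
  moreover have "trig_polynomial w (\<lambda>t. cos (w * t) * f (1, 0) + sin (w * t) * f (0, 1))"
    by (intro trig_polynomial.intros)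
  ultimately show ?case by metis
qed (intro trig_polynomial.intros; assumption)+

text \<open>By the Lebesgue differentiation theorem the averages of \<open>f\<close> over
  \<open>{x..x+h}\<close> tend to \<open>f x\<close> outside a null set, and all of these averages
  vanish. Extension by zero makes \<open>f\<close> integrable over every box, as the theorem
  requires.\<close>

lemma primitive_zero_imp_AE_zero:
  fixes f :: "real \<Rightarrow> real"
  assumes f: "f \<in> L2_per l" and zero: "\<And>r. r \<in> {0..l} \<Longrightarrow> integral {0..r} f = 0"
  shows "AE t in lebesgue_on {0..l}. f t = 0"
proof -
  define f0 where "f0 = (\<lambda>t. if t \<in> {0..l} then f t else 0)"
  have int: "f integrable_on {0..l}" using L2_per_integrable_on[OF f, of 0 l] by simp
  have i0: "f0 integrable_on cbox a b" for a b
  proof -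
    have "f0 integrable_on UNIV" using int unfolding f0_def by (rule integrable_restrict_UNIV[THEN iffD2])
    then show ?thesis by (rule integrable_on_subcbox) simp
  qed
  obtain N where N: "negligible N"
    "\<And>x e. \<lbrakk>x \<notin> N; 0 < e\<rbrakk> \<Longrightarrow> \<exists>d>0. \<forall>h. 0 < h \<and> h < d \<longrightarrow>
        norm (integral (cbox x (x + h *\<^sub>R One)) f0 /\<^sub>R h ^ DIM(real) - f0 x) < e"
    using integrable_ccontinuous_explicit[OF i0] by blast
  have key: "f x = 0" if x: "x \<notin> N" "0 < x" "x < l" for x
  proof (rule ccontr)
    assume ne: "f x \<noteq> 0"
    then obtain d where d: "d > 0" "\<And>h. 0 < h \<and> h < d \<Longrightarrow>
        norm (integral (cbox x (x + h *\<^sub>R One)) f0 /\<^sub>R h ^ DIM(real) - f0 x) < \<bar>f x\<bar>"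
      using N(2)[OF x(1), of "\<bar>f x\<bar>"] by auto
    define h where "h = min (d / 2) ((l - x) / 2)"
    have h: "0 < h" "h < d" "x + h \<le> l" using d x by (auto simp: h_def min_def field_simps)
    have "integral {0..x} f + integral {x..x+h} f = integral {0..x+h} f"
      using h x L2_per_integrable_on[OF f, of 0 "x + h"]
      by (intro Henstock_Kurzweil_Integration.integral_combine) auto
    then have "integral {x..x+h} f = 0" using zero[of x] zero[of "x + h"] h x by auto
    moreover have "integral {x..x+h} f0 = integral {x..x+h} f"
      using h x by (intro Henstock_Kurzweil_Integration.integral_cong) (auto simp: f0_def)
    ultimately have "norm (0 - f0 x) < \<bar>f x\<bar>" using d(2)[of h] h by simp
    then show False using x by (simp add: f0_def)
  qed
  have "negligible (N \<union> {0, l})" using N(1) by (simp add: negligible_Un)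
  then have "AE t in lebesgue. t \<notin> N \<union> {0, l}"
    by (intro AE_not_in) (simp add: negligible_iff_null_sets)
  then have "AE t in lebesgue. t \<in> {0..l} \<longrightarrow> f t = 0"
  proof eventually_elim
    case (elim t)
    then show ?case using key[of t] by force
  qed
  then show ?thesis by (simp add: AE_restrict_space_iff)
qed

text \<open>Glues the ends of \<open>{0..l}\<close>, so that every continuous function on the plane
  pulls back to a continuous periodic one.\<close>

definition circle_point :: "real \<Rightarrow> real \<Rightarrow> real \<times> real" where
  "circle_point l t = (cos (2 * pi / l * t), sin (2 * pi / l * t))"

lemma circle_point_eq_iff:
  assumes "l \<noteq> 0"
  shows "circle_point l t = circle_point l s \<longleftrightarrow> (\<exists>n::int. t = s + of_int n * l)"
proof -
  have 1: "circle_point l t = circle_point l s \<longleftrightarrow>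
      (\<exists>n::int. 2 * pi / l * t = 2 * pi / l * s + 2 * pi * n)"
    unfolding circle_point_def prod.inject by (subst conj_commute) (rule sin_cos_eq_iff)
  have 2: "(2 * pi / l * t = 2 * pi / l * s + 2 * pi * real_of_int n) \<longleftrightarrow> t = s + of_int n * l" for n
  proof -
    have "2 * pi / l * t = 2 * pi / l * s + 2 * pi * n \<longleftrightarrow> 2 * pi * t = 2 * pi * (s + n * l)"
      using assms by (simp add: field_simps)
    also have "\<dots> \<longleftrightarrow> t = s + of_int n * l" by (subst mult_cancel_left) simp
    finally show ?thesis .
  qed
  show ?thesis unfolding 1 2 ..
qed

lemma continuous_on_circle_point [continuous_intros]: "continuous_on S (circle_point l)"
  unfolding circle_point_def by (intro continuous_intros)

text \<open>By the Stone-Weierstrass theorem, vanishing against trigonometric polynomials extends to all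
  continuous functions on the circle, and these approximate the indicators of arcs.\<close>

lemma weak_zero_imp_AE_zero:
  assumes f: "f \<in> L2_per l" and l: "0 < l"
    and zero: "\<And>\<phi>. smooth_on UNIV \<phi> \<Longrightarrow> (\<And>t. \<phi> (t + l) = \<phi> t) \<Longrightarrow>
        integral\<^sup>L (lebesgue_on {0..l}) (\<lambda>t. f t * \<phi> t) = 0"
  shows "AE t in lebesgue_on {0..l}. f t = 0"
proof (rule primitive_zero_imp_AE_zero[OF f])
  let ?I = "integral\<^sup>L (lebesgue_on {0..l})"
  let ?z = "circle_point l"
  have fi: "integrable (lebesgue_on {0..l}) f" using L2_per_integrable[OF f] .
  have fai: "integrable (lebesgue_on {0..l}) (\<lambda>t. \<bar>f t\<bar>)" using fi by simp
  have poly: "?I (\<lambda>t. f t * p (?z t)) = 0" if "real_polynomial_function p" for p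
    unfolding circle_point_def
  proof (rule zero)
    note tp = real_polynomial_function_trig[OF that, of "2 * pi / l"]
    show "smooth_on UNIV (\<lambda>t. p (cos (2 * pi / l * t), sin (2 * pi / l * t)))"
      by (rule trig_polynomial_smooth[OF tp])
    show "p (cos (2 * pi / l * (t + l)), sin (2 * pi / l * (t + l))) =
        p (cos (2 * pi / l * t), sin (2 * pi / l * t))" for t
      using trig_polynomial_periodic[OF tp, of t] l by simp
  qed
  have fL: "(\<lambda>t. F (?z t)) \<in> L2_per l" if "continuous_on UNIV F" for F :: "real \<times> real \<Rightarrow> real"
    by (intro continuous_on_L2_per continuous_on_compose2[OF that] continuous_intros) auto
  have contF: "?I (\<lambda>t. f t * F (?z t)) = 0" if F: "continuous_on UNIV F" for F
  proof (rule ccontr)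
    assume ne: "?I (\<lambda>t. f t * F (?z t)) \<noteq> 0"
    \<comment> \<open>The added 1 keeps \<open>A\<close> positive and makes the last comparison, of
      \<open>e * (A - 1)\<close> with \<open>e * A\<close>, strict.\<close>
    define A where "A = ?I (\<lambda>t. \<bar>f t\<bar>) + 1"
    have A: "A > 0" unfolding A_def by (intro add_nonneg_pos integral_nonneg_AE) auto
    define e where "e = \<bar>?I (\<lambda>t. f t * F (?z t))\<bar> / A"
    have e: "e > 0" using ne A by (simp add: e_def)
    have cpt: "compact (?z ` {0..l})" by (intro compact_continuous_image continuous_intros) auto
    have cont: "continuous_on (?z ` {0..l}) F" using continuous_on_subset[OF F] by simp
    obtain p where p: "polynomial_function p" "\<forall>x\<in>?z ` {0..l}. norm (F x - p x) < e"
      using Stone_Weierstrass_polynomial_function[OF cpt cont e] by blast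
    then have rp: "real_polynomial_function p" by (simp add: real_polynomial_function_eq)
    have pc: "continuous_on UNIV p"
      using continuous_on_polymonial_function[OF p(1)] .
    have i1: "integrable (lebesgue_on {0..l}) (\<lambda>t. f t * F (?z t))"
      "integrable (lebesgue_on {0..l}) (\<lambda>t. f t * p (?z t))"
      by (intro L2_per_mult f fL F pc)+
    have "\<bar>?I (\<lambda>t. f t * F (?z t))\<bar> = \<bar>?I (\<lambda>t. f t * F (?z t) - f t * p (?z t))\<bar>"
      using i1 poly[OF rp] by simp
    also have "\<dots> \<le> ?I (\<lambda>t. \<bar>f t * F (?z t) - f t * p (?z t)\<bar>)" by (rule integral_abs_bound)
    also have "\<dots> \<le> ?I (\<lambda>t. e * \<bar>f t\<bar>)"
    proof (rule integral_mono_AE)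
      show "AE t in lebesgue_on {0..l}. \<bar>f t * F (?z t) - f t * p (?z t)\<bar> \<le> e * \<bar>f t\<bar>"
      proof (rule AE_I2)
        fix t assume "t \<in> space (lebesgue_on {0..l})"
        then have "\<bar>F (?z t) - p (?z t)\<bar> \<le> e" using p(2) by force
        then have "\<bar>f t\<bar> * \<bar>F (?z t) - p (?z t)\<bar> \<le> \<bar>f t\<bar> * e" by (intro mult_left_mono) auto
        then show "\<bar>f t * F (?z t) - f t * p (?z t)\<bar> \<le> e * \<bar>f t\<bar>"
          by (simp add: mult.commute flip: right_diff_distrib abs_mult)
      qed
    qed (use i1 fai in auto)
    also have "\<dots> = e * (A - 1)" using fai by (simp add: A_def)
    also have "\<dots> < e * A" using e by simp
    also have "\<dots> = \<bar>?I (\<lambda>t. f t * F (?z t))\<bar>" using A by (simp add: e_def)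
    finally show False by simp
  qed
  fix r assume r: "r \<in> {0..l}"
  consider "r = 0" | "r = l" | "0 < r" "r < l" using r by fastforce
  then show "integral {0..r} f = 0"
  proof cases
    case 2
    then show ?thesis using contF[of "\<lambda>x. 1"] L2_per_integral_eq[OF f] by simp
  next
    case 3
    define K where "K = ?z ` {r..l}"
    have K: "closed K" "K \<noteq> {}"
      using 3 unfolding K_def
      by (auto intro!: compact_imp_closed compact_continuous_image continuous_intros)
    \<comment> \<open>Away from the closed arc \<open>K\<close> these functions increase to 1, and
      on \<open>K\<close> they are 0. The point \<open>t = 0\<close> is glued to
      \<open>t = l\<close> and so belongs to \<open>K\<close>; the limit is therefore the indicator
      of an open interval.\<close>
    define F where "F n x = min 1 (real n * infdist x K)" for n x
    have Fc: "continuous_on UNIV (F n)" for n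
      unfolding F_def by (intro continuous_intros)
    have lim: "(\<lambda>n. f t * F n (?z t)) \<longlonglongrightarrow> indicator {0<..<r} t * f t" if t: "t \<in> {0..l}" for t
    proof (cases "t \<in> {0<..<r}")
      case True
      have "?z t \<notin> K"
      proof
        assume "?z t \<in> K"
        then obtain s where s: "s \<in> {r..l}" "?z s = ?z t" by (auto simp: K_def)
        then obtain n :: int where n: "s = t + n * l"
          using l circle_point_eq_iff[of l s t] by auto
        have st: "r \<le> s" "s \<le> l" "0 < t" "t < r" using s(1) True by auto
        have nl: "0 < n * l" "n * l < 1 * l" using n st by linarith+
        have "0 < n" using nl(1) l by (simp add: zero_less_mult_iff)
        moreover have "real_of_int n < 1" using nl(2) l by (subst (asm) mult_less_cancel_right) auto
        ultimately show False by simp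
      qed
      then have d: "infdist (?z t) K > 0"
        by (intro infdist_pos_not_in_closed K)
      obtain n0 where n0: "1 < real n0 * infdist (?z t) K" using reals_Archimedean3[OF d] by metis
      have "F n (?z t) = 1" if "n \<ge> n0" for n
      proof -
        have "real n0 * infdist (?z t) K \<le> real n * infdist (?z t) K"
          using that d by (intro mult_right_mono) auto
        then show ?thesis using n0 by (simp add: F_def)
      qed
      then have "eventually (\<lambda>n. f t * F n (?z t) = f t) sequentially"
        by (auto simp: eventually_sequentially)
      then show ?thesis using True by (simp add: tendsto_eventually)
    next
      case False
      have "?z t \<in> K"
      proof (cases "t = 0")
        case True
        then have "?z t = ?z l" using l by (subst circle_point_eq_iff) (auto intro!: exI[of _ "-1::int"])
        then show ?thesis using 3 by (auto simp: K_def)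
      next
        case f: False
        then show ?thesis using False t by (auto simp: K_def)
      qed
      then have "F n (?z t) = 0" for n by (simp add: F_def)
      then show ?thesis using False by simp
    qed
    have F01: "0 \<le> F n x" "F n x \<le> 1" for n x 
      by (auto simp: F_def infdist_nonneg)
    have indm: "(\<lambda>t. indicator A t * f t) \<in> borel_measurable (lebesgue_on {0..l})"
      if "A \<in> sets lebesgue" for A
    proof (rule borel_measurable_times)
      show "indicat_real A \<in> borel_measurable (lebesgue_on {0..l})"
        using that by (intro measurable_restrict_space1 borel_measurable_indicator)
    qed (use fi in auto)
    have "(\<lambda>n. ?I (\<lambda>t. f t * F n (?z t))) \<longlonglongrightarrow> ?I (\<lambda>t. indicator {0<..<r} t * f t)"
    proof (rule integral_dominated_convergence[where w="\<lambda>t. \<bar>f t\<bar>"])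
      show "(\<lambda>t. indicator {0<..<r} t * f t) \<in> borel_measurable (lebesgue_on {0..l})"
        by (rule indm) simp
      show "(\<lambda>t. f t * F n (?z t)) \<in> borel_measurable (lebesgue_on {0..l})" for n
        using L2_per_mult[OF f fL[OF Fc[of n]]] by auto
      show "AE t in lebesgue_on {0..l}. norm (f t * F n (?z t)) \<le> \<bar>f t\<bar>" for n
        using F01[of n] by (intro AE_I2) (simp add: abs_mult mult_left_le)
    qed (use lim fai in auto)
    then have "?I (\<lambda>t. indicator {0<..<r} t * f t) = 0"
      using contF[OF Fc] by (simp add: LIMSEQ_const_iff)
    moreover have "?I (\<lambda>t. indicator {0<..<r} t * f t) = ?I (\<lambda>t. indicator {0..r} t * f t)"
    proof (rule integral_cong_AE)
      have "AE t in lebesgue. t \<notin> {0, r}"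
        by (intro AE_not_in) (simp flip: negligible_iff_null_sets)
      then have "AE t in lebesgue. t \<in> {0..l} \<longrightarrow> t \<notin> {0, r}" by (rule eventually_mono) blast
      then have "AE t in lebesgue_on {0..l}. t \<notin> {0, r}" by (subst AE_restrict_space_iff) simp_all
      then show "AE t in lebesgue_on {0..l}. indicator {0<..<r} t * f t = indicator {0..r} t * f t"
        by eventually_elim (auto split: split_indicator)
    qed (auto intro!: indm)
    ultimately show ?thesis using integral_restrict_lebesgue_on[OF f, of r] r by simp
  qed simp
qed

section \<open>Weak derivatives and iterated periodic primitives\<close>

lemma continuous_on_UNIV_L2_per: "continuous_on UNIV f \<Longrightarrow> f \<in> L2_per l"
  by (rule continuous_on_L2_per, erule continuous_on_subset, simp)

lemma smooth_on_L2_per: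
  assumes "smooth_on UNIV f"
  shows "f \<in> L2_per l"
proof -
  have "Ck_on 0 UNIV f" using assms unfolding smooth_on_def by blast
  then show ?thesis by (simp add: continuous_on_UNIV_L2_per)
qed

lemma has_weak_deriv_perD:
  assumes "has_weak_deriv_per l k F f"
  shows "F \<in> L2_per l" "f \<in> L2_per l"
    and "smooth_on UNIV \<phi> \<Longrightarrow> (\<And>t. \<phi> (t + l) = \<phi> t) \<Longrightarrow>
      integral\<^sup>L (lebesgue_on {0..l}) (\<lambda>t. F t * (deriv ^^ k) \<phi> t) =
      (- 1) ^ k * integral\<^sup>L (lebesgue_on {0..l}) (\<lambda>t. f t * \<phi> t)"
  using assms unfolding has_weak_deriv_per_def by blast+

lemma weak_deriv_AE_unique:
  assumes l: "0 < l" and f: "has_weak_deriv_per l k F f" and g: "has_weak_deriv_per l k F g"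
  shows "AE t in lebesgue_on {0..l}. f t = g t"
proof -
  have fL: "f \<in> L2_per l" and gL: "g \<in> L2_per l"
    using f g by (auto simp: has_weak_deriv_per_def)
  have "AE t in lebesgue_on {0..l}. f t - g t = 0"
  proof (rule weak_zero_imp_AE_zero[OF L2_per_diff[OF fL gL] l])
    fix \<phi> :: "real \<Rightarrow> real" assume sm: "smooth_on UNIV \<phi>" and per: "\<And>t. \<phi> (t + l) = \<phi> t"
    have pL: "\<phi> \<in> L2_per l" by (rule smooth_on_L2_per[OF sm])
    have "(- 1) ^ k * integral\<^sup>L (lebesgue_on {0..l}) (\<lambda>t. f t * \<phi> t) =
        (- 1) ^ k * integral\<^sup>L (lebesgue_on {0..l}) (\<lambda>t. g t * \<phi> t)"
      using has_weak_deriv_perD(3)[OF f sm per] has_weak_deriv_perD(3)[OF g sm per] by (rule trans[OF sym])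
    then have "integral\<^sup>L (lebesgue_on {0..l}) (\<lambda>t. f t * \<phi> t) = integral\<^sup>L (lebesgue_on {0..l}) (\<lambda>t. g t * \<phi> t)"
      by simp
    then show "integral\<^sup>L (lebesgue_on {0..l}) (\<lambda>t. (f t - g t) * \<phi> t) = 0"
      using L2_per_mult[OF fL pL] L2_per_mult[OF gL pL] by (simp add: left_diff_distrib)
  qed
  then show ?thesis by simp
qed

text \<open>Inside an integral, the weak derivative picked by \<open>SOME\<close> may thus be
  replaced by any one that is known explicitly.\<close>

lemma weak_deriv_per_eq:
  assumes l: "0 < l" and f: "has_weak_deriv_per l k F f"
  shows "weak_deriv_per l k F \<in> L2_per l"
    and "AE t in lebesgue_on {0..l}. weak_deriv_per l k F t = f t"
proof -
  have w: "has_weak_deriv_per l k F (weak_deriv_per l k F)"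
    unfolding weak_deriv_per_def using f by (rule someI[of "has_weak_deriv_per l k F"])
  then show "weak_deriv_per l k F \<in> L2_per l" by (simp add: has_weak_deriv_per_def)
  show "AE t in lebesgue_on {0..l}. weak_deriv_per l k F t = f t"
    by (rule weak_deriv_AE_unique[OF l w f])
qed

lemma C1_periodic_primitive:
  fixes \<phi> :: "real \<Rightarrow> real"
  assumes "0 \<le> l" "\<And>x. (\<phi> has_real_derivative \<phi>' x) (at x)" "continuous_on UNIV \<phi>'" "\<phi> l = \<phi> 0"
  shows "periodic_primitive l \<phi> \<phi>'"
proof (rule periodic_primitiveI)
  show "\<phi>' \<in> L2_per l" using assms(3) by (rule continuous_on_UNIV_L2_per)
  show "\<phi> l = \<phi> 0" by fact
  fix t assume t: "0 \<le> t" "t \<le> l"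
  have "(\<phi>' has_integral (\<phi> t - \<phi> 0)) {0..t}"
    using t assms(2)
    by (intro fundamental_theorem_of_calculus)
      (auto simp flip: has_real_derivative_iff_has_vector_derivative intro: has_field_derivative_at_within)
  then show "\<phi> t = \<phi> 0 + integral {0..t} \<phi>'" by (simp add: integral_unique)
qed

lemma smooth_periodic_primitive:
  assumes "0 \<le> l" "smooth_on UNIV \<phi>" "\<And>t. \<phi> (t + l) = \<phi> t"
  shows "periodic_primitive l \<phi> (deriv \<phi>)"
  using smooth_on_deriv[OF assms(2)] assms(3)[of 0] assms(1) by (intro C1_periodic_primitive) auto

lemma deriv_periodic:
  fixes \<phi> :: "real \<Rightarrow> real"
  assumes "smooth_on UNIV \<phi>" "\<And>t. \<phi> (t + l) = \<phi> t"
  shows "deriv \<phi> (t + l) = deriv \<phi> t"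
proof -
  have "((\<lambda>x. \<phi> (x + l)) has_real_derivative deriv \<phi> (t + l)) (at t)"
    using smooth_on_deriv(1)[OF assms(1), of "t + l"] by (simp add: DERIV_shift)
  then have "(\<phi> has_real_derivative deriv \<phi> (t + l)) (at t)" using assms(2) by simp
  then show ?thesis by (simp add: DERIV_imp_deriv)
qed

lemma has_weak_deriv_per_0: "f \<in> L2_per l \<Longrightarrow> has_weak_deriv_per l 0 f f"
  by (simp add: has_weak_deriv_per_def)

lemma periodic_primitive_weak_deriv_1:
  assumes F: "periodic_primitive l F f" and l: "0 \<le> l"
  shows "has_weak_deriv_per l 1 F f"
  unfolding has_weak_deriv_per_def
proof (intro conjI allI impI)
  show "F \<in> L2_per l" "f \<in> L2_per l" using periodic_primitive_L2[OF F] periodic_primitiveD(1)[OF F] by auto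
  fix \<phi> :: "real \<Rightarrow> real" assume \<phi>: "smooth_on UNIV \<phi> \<and> (\<forall>t. \<phi> (t + l) = \<phi> t)"
  then have "periodic_primitive l \<phi> (deriv \<phi>)" using smooth_periodic_primitive[OF l] by blast
  from periodic_primitive_by_parts[OF F this l]
  show "integral\<^sup>L (lebesgue_on {0..l}) (\<lambda>t. F t * (deriv ^^ 1) \<phi> t) =
      (- 1) ^ 1 * integral\<^sup>L (lebesgue_on {0..l}) (\<lambda>t. f t * \<phi> t)" by simp
qed

lemma periodic_primitive_weak_deriv_2:
  assumes F: "periodic_primitive l F f" and f: "periodic_primitive l f f2" and l: "0 \<le> l"
  shows "has_weak_deriv_per l 2 F f2"
  unfolding has_weak_deriv_per_def
proof (intro conjI allI impI)
  show "F \<in> L2_per l" "f2 \<in> L2_per l" using periodic_primitive_L2[OF F] periodic_primitiveD(1)[OF f] by auto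
  fix \<phi> :: "real \<Rightarrow> real" assume \<phi>: "smooth_on UNIV \<phi> \<and> (\<forall>t. \<phi> (t + l) = \<phi> t)"
  then have p1: "periodic_primitive l \<phi> (deriv \<phi>)" using smooth_periodic_primitive[OF l] by blast
  have p2: "periodic_primitive l (deriv \<phi>) (deriv (deriv \<phi>))"
    using \<phi> by (intro smooth_periodic_primitive l smooth_on_deriv deriv_periodic) auto
  show "integral\<^sup>L (lebesgue_on {0..l}) (\<lambda>t. F t * (deriv ^^ 2) \<phi> t) =
      (- 1) ^ 2 * integral\<^sup>L (lebesgue_on {0..l}) (\<lambda>t. f2 t * \<phi> t)"
    using periodic_primitive_by_parts[OF F p2 l] periodic_primitive_by_parts[OF f p1 l]
    by (simp add: numeral_2_eq_2)
qed

lemma H_per_2_primitives: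
  assumes F: "periodic_primitive l F f" and f: "periodic_primitive l f f2" and l: "0 < l"
  shows "F \<in> H_per 2 l"
    and "H_per_norm 2 l F = sqrt ((L2_norm_on l F)\<^sup>2 + (L2_norm_on l f)\<^sup>2 + (L2_norm_on l f2)\<^sup>2)"
proof -
  have w: "has_weak_deriv_per l 0 F F" "has_weak_deriv_per l 1 F f" "has_weak_deriv_per l 2 F f2"
    using has_weak_deriv_per_0[OF periodic_primitive_L2[OF F]]
      periodic_primitive_weak_deriv_1[OF F] periodic_primitive_weak_deriv_2[OF F f] l by auto
  have "\<exists>f'. has_weak_deriv_per l j F f'" if "j \<le> 2" for j
  proof -
    have "j = 0 \<or> j = 1 \<or> j = 2" using that by auto
    then show ?thesis using w by metis
  qed
  then show "F \<in> H_per 2 l" by (simp add: H_per_def)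
  have eq: "integral\<^sup>L (lebesgue_on {0..l}) (\<lambda>t. (weak_deriv_per l j F t)\<^sup>2) = (L2_norm_on l h)\<^sup>2"
    if "has_weak_deriv_per l j F h" for j h
    unfolding L2_norm_on_sq
  proof (rule integral_cong_AE)
    show "(\<lambda>t. (weak_deriv_per l j F t)\<^sup>2) \<in> borel_measurable (lebesgue_on {0..l})"
      using weak_deriv_per_eq(1)[OF l that] by (auto simp: L2_per_def)
    show "(\<lambda>t. (h t)\<^sup>2) \<in> borel_measurable (lebesgue_on {0..l})"
      using has_weak_deriv_perD(2)[OF that] by (auto simp: L2_per_def)
    show "AE t in lebesgue_on {0..l}. (weak_deriv_per l j F t)\<^sup>2 = (h t)\<^sup>2"
      using weak_deriv_per_eq(2)[OF l that] by eventually_elim simp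
  qed
  have "{..2::nat} = {0, 1, 2}" by auto
  then show "H_per_norm 2 l F = sqrt ((L2_norm_on l F)\<^sup>2 + (L2_norm_on l f)\<^sup>2 + (L2_norm_on l f2)\<^sup>2)"
    unfolding H_per_norm_def using eq[OF w(1)] eq[OF w(2)] eq[OF w(3)] by (simp add: add.assoc)
qed

text \<open>\<open>Q (t + l) - Q t\<close> is constant because \<open>\<eta>\<close> is periodic,
  and the constant is the integral of \<open>\<eta>\<close> over a period.\<close>

lemma smooth_periodic_antiderivative:
  fixes \<eta> :: "real \<Rightarrow> real"
  assumes l: "0 < l" and sm: "smooth_on UNIV \<eta>" and per: "\<And>t. \<eta> (t + l) = \<eta> t"
    and zero: "integral\<^sup>L (lebesgue_on {0..l}) \<eta> = 0"
  obtains P where "smooth_on UNIV P" "\<And>t. P (t + l) = P t" "deriv P = \<eta>"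
    "integral\<^sup>L (lebesgue_on {0..l}) P = 0"
proof -
  have c: "continuous_on UNIV \<eta>" using sm unfolding smooth_on_def by (metis Ck_on.simps(1))
  then have iso: "isCont \<eta> x" for x by (simp add: continuous_on_eq_continuous_at)
  have "\<exists>F. \<forall>x::real. -\<infinity> < ereal x \<longrightarrow> ereal x < \<infinity> \<longrightarrow> (F has_vector_derivative \<eta> x) (at x)"
    by (rule einterval_antiderivative) (auto simp: iso)
  then obtain Q where Q: "\<And>x. (Q has_real_derivative \<eta> x) (at x)"
    by (auto simp: has_real_derivative_iff_has_vector_derivative)
  have Ql: "Q l = Q 0"
  proof -
    have "(\<eta> has_integral (Q l - Q 0)) {0..l}"
      using l Q by (intro fundamental_theorem_of_calculus)
        (auto simp flip: has_real_derivative_iff_has_vector_derivative intro: has_field_derivative_at_within)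
    moreover have "\<eta> \<in> L2_per l" using c by (rule continuous_on_UNIV_L2_per)
    ultimately show ?thesis using zero by (simp add: L2_per_integral_eq integral_unique)
  qed
  have Qper: "Q (t + l) = Q t" for t
  proof -
    have "((\<lambda>x. Q (x + l) - Q x) has_real_derivative 0) (at x)" for x
    proof -
      have "((\<lambda>x. Q (x + l)) has_real_derivative \<eta> (x + l)) (at x)"
        using Q[of "x + l"] by (simp add: DERIV_shift)
      from DERIV_diff[OF this Q[of x]] show ?thesis by (simp add: per)
    qed
    then have "Q (t + l) - Q t = Q (0 + l) - Q 0" by (intro DERIV_isconst_all[rule_format]) auto
    then show ?thesis using Ql by simp
  qed
  define P where "P = (\<lambda>t. Q t - integral\<^sup>L (lebesgue_on {0..l}) Q / l)"
  have P: "(P has_real_derivative \<eta> x) (at x)" for x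
    unfolding P_def using DERIV_diff[OF Q[of x] DERIV_const] by simp
  have "Ck_on k UNIV P" for k
  proof (cases k)
    case 0
    then show ?thesis using P by (auto intro!: DERIV_isCont continuous_at_imp_continuous_on)
  next
    case (Suc j)
    show ?thesis unfolding Suc Ck_on_Suc_deriv[OF P] using sm by (simp add: smooth_on_def)
  qed
  then have "smooth_on UNIV P" by (simp add: smooth_on_def)
  moreover have "deriv P = \<eta>" using P by (auto simp: DERIV_imp_deriv)
  moreover have "P (t + l) = P t" for t by (simp add: P_def Qper)
  moreover have "integral\<^sup>L (lebesgue_on {0..l}) P = 0"
  proof -
    have "continuous_on UNIV Q" using Q by (auto intro!: DERIV_isCont continuous_at_imp_continuous_on)
    then have "Q \<in> L2_per l" by (rule continuous_on_UNIV_L2_per)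
    then show ?thesis
      using l L2_per_integrable[OF L2_per_const[of "integral\<^sup>L (lebesgue_on {0..l}) Q / l" l]]
      by (simp add: P_def L2_per_integrable)
  qed
  ultimately show thesis using that by blast
qed

lemma continuous_AE_eq_imp_eq:
  fixes f g :: "real \<Rightarrow> real"
  assumes l: "0 < l" and c: "continuous_on {0..l} f" "continuous_on {0..l} g"
    and ae: "AE t in lebesgue_on {0..l}. f t = g t" and t: "t \<in> {0..l}"
  shows "f t = g t"
proof -
  have cc: "continuous_on {0..l} (\<lambda>t. (f t - g t)\<^sup>2)" by (intro continuous_intros c)
  have "integral\<^sup>L (lebesgue_on {0..l}) (\<lambda>t. (f t - g t)\<^sup>2) = integral\<^sup>L (lebesgue_on {0..l}) (\<lambda>t. 0)"
    using ae c by (intro integral_cong_AE)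
      (auto intro!: continuous_imp_measurable_on_sets_lebesgue cc elim!: eventually_mono)
  then have "(f t - g t)\<^sup>2 = 0"
    using integralL_eq_0_iff[OF cc l] t by simp
  then show ?thesis by simp
qed

text \<open>A du Bois-Reymond argument. Integrating \<open>f2\<close> twice yields a
  \<open>G\<close> with the same second weak derivative as \<open>f\<close>. Every smooth periodic
  function of mean zero is the second derivative of a smooth periodic function, so
  \<open>f - G\<close> is orthogonal to all of them and hence constant almost everywhere; continuity
  of \<open>f\<close> removes the exceptional set.\<close>

lemma weak_deriv_2_primitives:
  assumes l: "0 < l" and w: "has_weak_deriv_per l 2 f f2" and c: "continuous_on {0..l} f"
  obtains f1 where "periodic_primitive l f f1" "periodic_primitive l f1 f2"
proof -
  let ?I = "integral\<^sup>L (lebesgue_on {0..l})"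
  have fL: "f \<in> L2_per l" and f2L: "f2 \<in> L2_per l" using w by (auto simp: has_weak_deriv_per_def)
  have wd: "?I (\<lambda>t. f t * deriv (deriv \<phi>) t) = ?I (\<lambda>t. f2 t * \<phi> t)"
    if "smooth_on UNIV \<phi>" "\<And>t. \<phi> (t + l) = \<phi> t" for \<phi>
    using has_weak_deriv_perD(3)[OF w that] by (simp add: numeral_2_eq_2)
  have "deriv (\<lambda>t::real. 1::real) = (\<lambda>t. 0)" by (intro ext DERIV_imp_deriv) simp
  moreover have "deriv (\<lambda>t::real. 0::real) = (\<lambda>t. 0)" by (intro ext DERIV_imp_deriv) simp
  \<comment> \<open>The constant test function shows that \<open>f2\<close> has mean zero, as the
    derivative of a periodic function must.\<close>
  ultimately have "?I f2 = 0"
    using wd[of "\<lambda>t. 1"] trig_polynomial_smooth[OF trig_polynomial.const[of 0 1]] by simp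
  then obtain g where g: "periodic_primitive l g f2" "?I g = 0"
    using periodic_primitive_exists[OF f2L _ l] by blast
  then obtain G where G: "periodic_primitive l G g"
    using periodic_primitive_exists[OF periodic_primitive_L2[OF g(1)] _ l] by blast
  have GL: "G \<in> L2_per l" by (rule periodic_primitive_L2[OF G])
  have wG: "?I (\<lambda>t. G t * deriv (deriv \<phi>) t) = ?I (\<lambda>t. f2 t * \<phi> t)"
    if "smooth_on UNIV \<phi>" "\<And>t. \<phi> (t + l) = \<phi> t" for \<phi>
    using has_weak_deriv_perD(3)[OF periodic_primitive_weak_deriv_2[OF G g(1)] that] l
    by (simp add: numeral_2_eq_2)
  define D where "D t = f t - G t" for t
  have DL: "D \<in> L2_per l" unfolding D_def by (rule L2_per_diff[OF fL GL])
  define m where "m = ?I D / l"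
  have "AE t in lebesgue_on {0..l}. D t - m = 0"
  proof (rule weak_zero_imp_AE_zero[OF L2_per_diff[OF DL L2_per_const] l])
    fix \<eta> :: "real \<Rightarrow> real" assume sm: "smooth_on UNIV \<eta>" and per: "\<And>t. \<eta> (t + l) = \<eta> t"
    define n where "n = ?I \<eta> / l"
    have cL: "\<eta> \<in> L2_per l"
      by (rule smooth_on_L2_per[OF sm])
    note ci = L2_per_integrable[OF cL] and Di = L2_per_integrable[OF DL]
    have ki: "integrable (lebesgue_on {0..l}) (\<lambda>t. k)" for k :: real
      using L2_per_integrable[OF L2_per_const] .
    define \<eta>0 where "\<eta>0 = (\<lambda>t. \<eta> t - n)"
    have sm0: "smooth_on UNIV \<eta>0"
      unfolding smooth_on_def
    proof
      fix k
      have d: "(\<eta>0 has_real_derivative deriv \<eta> x) (at x)" for x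
        unfolding \<eta>0_def using DERIV_diff[OF smooth_on_deriv(1)[OF sm] DERIV_const] by simp
      show "Ck_on k UNIV \<eta>0"
      proof (cases k)
        case 0
        then show ?thesis using d by (auto intro!: DERIV_isCont continuous_at_imp_continuous_on)
      next
        case (Suc j)
        show ?thesis unfolding Suc Ck_on_Suc_deriv[OF d]
          using smooth_on_deriv(2)[OF sm] by (simp add: smooth_on_def)
      qed
    qed
    have z0: "?I \<eta>0 = 0" using l ci ki by (simp add: \<eta>0_def n_def)
    obtain P where P: "smooth_on UNIV P" "\<And>t. P (t + l) = P t" "deriv P = \<eta>0" "?I P = 0"
      using smooth_periodic_antiderivative[OF l sm0 _ z0] per by (auto simp: \<eta>0_def)
    obtain R where R: "smooth_on UNIV R" "\<And>t. R (t + l) = R t" "deriv R = P"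
      using smooth_periodic_antiderivative[OF l P(1) P(2) P(4)] by metis
    have "\<eta>0 \<in> L2_per l" unfolding \<eta>0_def by (intro L2_per_diff cL L2_per_const)
    then have i0: "integrable (lebesgue_on {0..l}) (\<lambda>t. f t * \<eta>0 t)" "integrable (lebesgue_on {0..l}) (\<lambda>t. G t * \<eta>0 t)"
      using L2_per_mult fL GL by auto
    have "?I (\<lambda>t. D t * \<eta>0 t) = 0"
      using wd[OF R(1,2)] wG[OF R(1,2)] i0 unfolding R(3) P(3) D_def by (simp add: left_diff_distrib)
    moreover have "?I (\<lambda>t. D t * \<eta>0 t) = ?I (\<lambda>t. D t * \<eta> t) - n * ?I D"
      using L2_per_mult[OF DL cL] Di by (simp add: \<eta>0_def right_diff_distrib mult.commute)
    moreover have "?I (\<lambda>t. (D t - m) * \<eta> t) = ?I (\<lambda>t. D t * \<eta> t) - m * ?I \<eta>"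
      using L2_per_mult[OF DL cL] ci by (simp add: left_diff_distrib)
    ultimately show "?I (\<lambda>t. (D t - m) * \<eta> t) = 0" by (simp add: m_def n_def)
  qed
  then have "AE t in lebesgue_on {0..l}. f t = G t + m"
    by eventually_elim (simp add: D_def)
  then have eq: "f t = G t + m" if "t \<in> {0..l}" for t
    using that c periodic_primitive_continuous[OF G]
    by (intro continuous_AE_eq_imp_eq[OF l]) (auto intro!: continuous_intros)
  have "periodic_primitive l (\<lambda>t. G t + m) g"
  proof (rule periodic_primitiveI)
    show "G t + m = G 0 + m + integral {0..t} g" if "0 \<le> t" "t \<le> l" for t
      using periodic_primitiveD(3)[OF G that] by linarith
  qed (use periodic_primitiveD(1,2)[OF G] in auto)
  then have "periodic_primitive l f g"
    by (rule periodic_primitive_cong) (use l eq in auto)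
  then show thesis using g(1) by (rule that)
qed

section \<open>Lipschitz functions that are differentiable almost everywhere\<close>

text \<open>The difference quotients are bounded by the Lipschitz constant, so the fundamental theorem of
  calculus follows by dominated convergence.\<close>

lemma lipschitz_has_bochner_integral_deriv:
  fixes f :: "real \<Rightarrow> real"
  assumes lip: "C-lipschitz_on UNIV f" and ae: "AE t in lebesgue. f differentiable (at t)"
    and ab: "a \<le> b"
  shows "AE t in lebesgue_on {a..b}. \<bar>deriv f t\<bar> \<le> C"
    and "has_bochner_integral (lebesgue_on {a..b}) (deriv f) (f b - f a)"
proof -
  define k :: "nat \<Rightarrow> real" where "k n = inverse (real (Suc n))" for n
  have kpos: "k n > 0" for n by (simp add: k_def)
  have k0: "k \<longlonglongrightarrow> 0" unfolding k_def by (rule LIMSEQ_inverse_real_of_nat)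
  have klim: "filterlim k (at 0) sequentially"
    using k0 kpos by (auto simp: filterlim_at intro!: always_eventually less_imp_neq[symmetric])
  define q where "q n t = (f (t + k n) - f t) / k n" for n t
  have fc: "continuous_on UNIV f" using lip by (rule lipschitz_on_continuous_on)
  have qb: "\<bar>q n t\<bar> \<le> C" for n t
  proof -
    have "dist (f (t + k n)) (f t) \<le> C * dist (t + k n) t" using lip by (rule lipschitz_onD) auto
    then show ?thesis using kpos[of n] by (simp add: q_def dist_real_def field_simps)
  qed
  have qlim: "(\<lambda>n. q n t) \<longlonglongrightarrow> deriv f t" if "f differentiable (at t)" for t
  proof -
    have "(f has_real_derivative deriv f t) (at t)"
      using that by (simp add: DERIV_deriv_iff_real_differentiable)
    then have "((\<lambda>h. (f (t + h) - f t) / h) \<longlongrightarrow> deriv f t) (at 0)" by (simp add: DERIV_def)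
    then show ?thesis unfolding q_def by (rule filterlim_compose[OF _ klim])
  qed
  have ael: "AE t in lebesgue_on {a..b}. (\<lambda>n. q n t) \<longlonglongrightarrow> deriv f t"
    using ae by (auto simp: AE_restrict_space_iff qlim elim!: eventually_mono)
  then show bd: "AE t in lebesgue_on {a..b}. \<bar>deriv f t\<bar> \<le> C"
  proof eventually_elim
    case (elim t)
    have "(\<lambda>n. \<bar>q n t\<bar>) \<longlonglongrightarrow> \<bar>deriv f t\<bar>" by (intro tendsto_intros elim)
    then show ?case by (rule LIMSEQ_le_const2) (use qb in auto)
  qed
  have qc: "continuous_on UNIV (q n)" for n
    unfolding q_def using kpos[of n]
    by (intro continuous_intros continuous_on_compose2[OF fc] fc) auto
  have qm: "q n \<in> borel_measurable lebesgue" for n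
    using qc by (intro measurable_completion) (simp add: borel_measurable_continuous_onI)
  \<comment> \<open>\<open>deriv f\<close> is unspecified where \<open>f\<close> is not
    differentiable; it is measurable because it agrees almost everywhere with a limit of continuous
    functions.\<close>
  have "AE t in lebesgue. lim (\<lambda>n. q n t) = deriv f t"
    using ae by eventually_elim (simp add: limI qlim)
  moreover have "(\<lambda>t. lim (\<lambda>n. q n t)) \<in> borel_measurable lebesgue"
    using qm by (rule borel_measurable_lim_metric)
  ultimately have dm: "deriv f \<in> borel_measurable lebesgue" by (rule borel_measurable_AE[rotated])
  have fm: "finite_measure (lebesgue_on {a..b})" by (rule finite_measure_lebesgue_interval)
  have Ci: "integrable (lebesgue_on {a..b}) (\<lambda>t. C)" using finite_measure.integrable_const[OF fm] .
  have di: "integrable (lebesgue_on {a..b}) (deriv f)"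
    by (rule Bochner_Integration.integrable_bound[OF Ci])
      (use dm bd in \<open>auto intro: measurable_restrict_space1 elim!: eventually_mono\<close>)
  have "(\<lambda>n. integral\<^sup>L (lebesgue_on {a..b}) (q n)) \<longlonglongrightarrow> integral\<^sup>L (lebesgue_on {a..b}) (deriv f)"
    by (rule integral_dominated_convergence[where w="\<lambda>t. C"])
      (use dm qm qb Ci ael in \<open>auto intro: measurable_restrict_space1\<close>)
  moreover have "(\<lambda>n. integral\<^sup>L (lebesgue_on {a..b}) (q n)) \<longlonglongrightarrow> f b - f a"
  proof -
    have iso: "isCont f x" for x using fc by (simp add: continuous_on_eq_continuous_at)
    have "\<exists>F. \<forall>x::real. -\<infinity> < ereal x \<longrightarrow> ereal x < \<infinity> \<longrightarrow> (F has_vector_derivative f x) (at x)"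
      by (rule einterval_antiderivative) (auto simp: iso)
    then obtain F where F: "\<And>x. (F has_real_derivative f x) (at x)"
      by (auto simp: has_real_derivative_iff_has_vector_derivative)
    \<comment> \<open>With an antiderivative \<open>F\<close> of \<open>f\<close>, the integral of
      the difference quotient of \<open>f\<close> becomes a difference quotient of \<open>F\<close>
      at \<open>b\<close> minus one at \<open>a\<close>, and these tend to \<open>f b\<close> and
      \<open>f a\<close>.\<close>
    have eq: "integral\<^sup>L (lebesgue_on {a..b}) (q n) = (F (b + k n) - F b) / k n - (F (a + k n) - F a) / k n"
      for n
    proof -
      have d: "((\<lambda>t. (F (t + k n) - F t) / k n) has_real_derivative q n t) (at t)" for t
        unfolding q_def
        using F[of "t + k n"] F[of t] by (intro DERIV_cdivide DERIV_diff) (auto simp: DERIV_shift)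
      have "(q n has_integral ((F (b + k n) - F b) / k n - (F (a + k n) - F a) / k n)) {a..b}"
        using ab d by (intro fundamental_theorem_of_calculus)
          (auto simp flip: has_real_derivative_iff_has_vector_derivative intro: has_field_derivative_at_within)
      moreover have "integral\<^sup>L (lebesgue_on {a..b}) (q n) = integral {a..b} (q n)"
        using qc by (intro lebesgue_integral_eq_integral continuous_imp_integrable_real)
          (auto intro: continuous_on_subset)
      ultimately show ?thesis by (simp add: integral_unique)
    qed
    have "((\<lambda>h. (F (x + h) - F x) / h) \<longlongrightarrow> f x) (at 0)" for x
      using F[of x] by (simp add: DERIV_def)
    then have "(\<lambda>n. (F (x + k n) - F x) / k n) \<longlonglongrightarrow> f x" for x
      by (rule filterlim_compose[OF _ klim])
    then show ?thesis unfolding eq by (intro tendsto_intros)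
  qed
  ultimately have "integral\<^sup>L (lebesgue_on {a..b}) (deriv f) = f b - f a" by (rule LIMSEQ_unique)
  then show "has_bochner_integral (lebesgue_on {a..b}) (deriv f) (f b - f a)"
    using di by (simp add: has_bochner_integral_iff)
qed

lemma lipschitz_deriv_L2_per:
  fixes f :: "real \<Rightarrow> real"
  assumes lip: "C-lipschitz_on UNIV f" and ae: "AE t in lebesgue. f differentiable (at t)" and l: "0 \<le> l"
  shows "deriv f \<in> L2_per l"
  using lipschitz_has_bochner_integral_deriv[OF lip ae l]
  by (intro L2_per_bounded) (auto simp: has_bochner_integral_iff)

lemma lipschitz_integral_deriv:
  fixes f :: "real \<Rightarrow> real"
  assumes lip: "C-lipschitz_on UNIV f" and ae: "AE t in lebesgue. f differentiable (at t)" and ab: "a \<le> b"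
  shows "integral {a..b} (deriv f) = f b - f a"
  using lipschitz_has_bochner_integral_deriv(2)[OF lip ae ab]
  by (metis has_bochner_integral_iff lebesgue_integral_eq_integral sets_completionI_sets sets_lborel
      borel_closed closed_atLeastAtMost)

lemma lipschitz_periodic_primitive:
  fixes f :: "real \<Rightarrow> real"
  assumes lip: "C-lipschitz_on UNIV f" and ae: "AE t in lebesgue. f differentiable (at t)"
    and l: "0 \<le> l" and per: "f l = f 0"
  shows "periodic_primitive l f (deriv f)"
proof (rule periodic_primitiveI)
  show "f t = f 0 + integral {0..t} (deriv f)" if "0 \<le> t" for t
    using lipschitz_integral_deriv[OF lip ae that] by simp
qed (use lipschitz_deriv_L2_per[OF lip ae l] per in auto)

text \<open>Differentiability almost everywhere is carried along with the Lipschitz condition: it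
  starts at the arclength parametrization and is passed on by every operation that builds a nodal
  basis function.\<close>

definition ae_diff_lipschitz :: "(real \<Rightarrow> real) \<Rightarrow> bool" where
  "ae_diff_lipschitz f \<longleftrightarrow> (\<exists>C. C-lipschitz_on UNIV f) \<and> (AE t in lebesgue. f differentiable (at t))"

lemma ae_diff_lipschitz_const: "ae_diff_lipschitz (\<lambda>t. k)"
  unfolding ae_diff_lipschitz_def by (auto intro!: exI[of _ 0] lipschitz_onI)

lemma ae_diff_lipschitz_add:
  assumes "ae_diff_lipschitz f" "ae_diff_lipschitz g"
  shows "ae_diff_lipschitz (\<lambda>t. f t + g t)"
proof -
  obtain C D where "C-lipschitz_on UNIV f" "D-lipschitz_on UNIV g"
    using assms unfolding ae_diff_lipschitz_def by blast
  then have "(C + D)-lipschitz_on UNIV (\<lambda>t. f t + g t)" by (rule lipschitz_on_add)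
  moreover have "AE t in lebesgue. f differentiable (at t)" "AE t in lebesgue. g differentiable (at t)"
    using assms by (auto simp: ae_diff_lipschitz_def)
  then have "AE t in lebesgue. (\<lambda>t. f t + g t) differentiable (at t)"
    by eventually_elim (rule differentiable_add)
  ultimately show ?thesis unfolding ae_diff_lipschitz_def by blast
qed

lemma ae_diff_lipschitz_mult:
  assumes "ae_diff_lipschitz f" "ae_diff_lipschitz g"
    and K: "\<And>t. \<bar>f t\<bar> \<le> K" "\<And>t. \<bar>g t\<bar> \<le> K"
  shows "ae_diff_lipschitz (\<lambda>t. f t * g t)"
proof -
  obtain C D where CD: "C-lipschitz_on UNIV f" "D-lipschitz_on UNIV g"
    using assms unfolding ae_diff_lipschitz_def by blast
  have K0: "K \<ge> 0" using K(1)[of 0] by linarith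
  have "(K * C + K * D)-lipschitz_on UNIV (\<lambda>t. f t * g t)"
  proof (rule lipschitz_onI)
    fix x y
    have "\<bar>f x - f y\<bar> \<le> C * \<bar>x - y\<bar>" "\<bar>g x - g y\<bar> \<le> D * \<bar>x - y\<bar>"
      using lipschitz_onD[OF CD(1), of x y] lipschitz_onD[OF CD(2), of x y] by (auto simp: dist_real_def)
    then have "\<bar>f x - f y\<bar> * \<bar>g x\<bar> + \<bar>f y\<bar> * \<bar>g x - g y\<bar> \<le> C * \<bar>x - y\<bar> * K + K * (D * \<bar>x - y\<bar>)"
      using K K0 by (intro add_mono mult_mono) (auto intro: mult_nonneg_nonneg lipschitz_on_nonneg[OF CD(1)])
    moreover have "f x * g x - f y * g y = (f x - f y) * g x + f y * (g x - g y)"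
      by (simp add: algebra_simps)
    then have "\<bar>f x * g x - f y * g y\<bar> \<le> \<bar>f x - f y\<bar> * \<bar>g x\<bar> + \<bar>f y\<bar> * \<bar>g x - g y\<bar>"
      by (metis abs_mult abs_triangle_ineq)
    ultimately show "dist (f x * g x) (f y * g y) \<le> (K * C + K * D) * dist x y"
      by (simp add: dist_real_def algebra_simps)
  qed (use K0 lipschitz_on_nonneg[OF CD(1)] lipschitz_on_nonneg[OF CD(2)] in auto)
  moreover have "AE t in lebesgue. f differentiable (at t)" "AE t in lebesgue. g differentiable (at t)"
    using assms by (auto simp: ae_diff_lipschitz_def)
  then have "AE t in lebesgue. (\<lambda>t. f t * g t) differentiable (at t)"
    by eventually_elim (rule differentiable_mult)
  ultimately show ?thesis unfolding ae_diff_lipschitz_def by blast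
qed

lemma ae_diff_lipschitz_cmult:
  assumes "ae_diff_lipschitz f"
  shows "ae_diff_lipschitz (\<lambda>t. k * f t)"
proof -
  obtain C where "C-lipschitz_on UNIV f" using assms unfolding ae_diff_lipschitz_def by blast
  then have "(\<bar>k\<bar> * C)-lipschitz_on UNIV (\<lambda>t. k * f t)" by (rule lipschitz_on_cmult_real)
  moreover have "AE t in lebesgue. f differentiable (at t)" using assms by (auto simp: ae_diff_lipschitz_def)
  then have "AE t in lebesgue. (\<lambda>t. k * f t) differentiable (at t)"
    by eventually_elim (intro differentiable_mult differentiable_const)
  ultimately show ?thesis unfolding ae_diff_lipschitz_def by blast
qed

lemma ae_diff_lipschitz_sum:
  assumes "\<And>i. i \<in> A \<Longrightarrow> ae_diff_lipschitz (f i)"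
  shows "ae_diff_lipschitz (\<lambda>t. \<Sum>i\<in>A. f i t)"
  using assms
  by (induction A rule: infinite_finite_induct) (auto intro: ae_diff_lipschitz_const ae_diff_lipschitz_add)

text \<open>At such a zero \<open>f\<close> leaves 0 at a nonzero rate, so the zero is isolated.
  Sorting the zeros by a radius of isolation gives sets without limit points, which are countable.
  Among the points where \<open>f\<close> is differentiable, these zeros are the only ones where
  passing to the absolute value can destroy this.\<close>

lemma countable_transversal_zeros:
  fixes f :: "real \<Rightarrow> real"
  shows "countable {t. f t = 0 \<and> f differentiable (at t) \<and> deriv f t \<noteq> 0}"
proof -
  define Z where "Z n = {t. f t = 0 \<and> (\<forall>s. 0 < \<bar>s - t\<bar> \<and> \<bar>s - t\<bar> < inverse (real (Suc n)) \<longrightarrow> f s \<noteq> 0)}" for n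
  have "countable (Z n)" for n
  proof (rule no_limpt_imp_countable)
    fix x show "\<not> x islimpt Z n"
    proof
      assume "x islimpt Z n"
      \<comment> \<open>Two points closer to \<open>x\<close> than half the radius are closer to
        each other than the radius. \<open>z\<close> will be taken nearer to \<open>x\<close> than
        \<open>y\<close> is, hence differs from \<open>y\<close>.\<close>
      define e where "e = inverse (real (Suc n)) / 2"
      have "e > 0" by (simp add: e_def)
      then obtain y where y: "y \<in> Z n" "y \<noteq> x" "dist y x < e"
        using \<open>x islimpt Z n\<close> islimpt_approachable by blast
      then have "dist y x > 0" by simp
      then obtain z where z: "z \<in> Z n" "z \<noteq> x" "dist z x < dist y x"
        using \<open>x islimpt Z n\<close> islimpt_approachable by blast
      have "0 < \<bar>z - y\<bar>" "\<bar>z - y\<bar> < inverse (real (Suc n))"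
        using y z unfolding e_def dist_real_def by linarith+
      then show False using y(1) z(1) unfolding Z_def by blast
    qed
  qed
  then have "countable (\<Union>n. Z n)" by blast
  moreover have "{t. f t = 0 \<and> f differentiable (at t) \<and> deriv f t \<noteq> 0} \<subseteq> (\<Union>n. Z n)"
  proof
    fix t assume "t \<in> {t. f t = 0 \<and> f differentiable (at t) \<and> deriv f t \<noteq> 0}"
    then have t: "f t = 0" "(f has_real_derivative deriv f t) (at t)" "deriv f t \<noteq> 0"
      by (auto simp: DERIV_deriv_iff_real_differentiable)
    then have "((\<lambda>s. (f s - f t) / (s - t)) \<longlongrightarrow> deriv f t) (at t)" by (simp add: has_field_derivative_iff)
    then have "eventually (\<lambda>s. (f s - f t) / (s - t) \<noteq> 0) (at t)"
      using t(3) tendsto_imp_eventually_ne by blast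
    then obtain d where d: "d > 0" "\<And>s. s \<noteq> t \<Longrightarrow> dist s t < d \<Longrightarrow> (f s - f t) / (s - t) \<noteq> 0"
      unfolding eventually_at by blast
    obtain n where n: "inverse (real (Suc n)) < d" using reals_Archimedean[OF d(1)] by blast
    have "t \<in> Z n" unfolding Z_def
    proof (intro CollectI conjI allI impI)
      fix s assume "0 < \<bar>s - t\<bar> \<and> \<bar>s - t\<bar> < inverse (real (Suc n))"
      then show "f s \<noteq> 0" using d(2)[of s] n t(1) by (auto simp: dist_real_def)
    qed fact
    then show "t \<in> (\<Union>n. Z n)" by blast
  qed
  ultimately show ?thesis by (rule countable_subset[rotated])
qed

text \<open>At a zero with derivative 0 the difference quotients of \<open>\<bar>f\<bar>\<close>
  have the same size as those of \<open>f\<close>, so they tend to 0 as well.\<close>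

lemma abs_differentiable:
  fixes f :: "real \<Rightarrow> real"
  assumes f: "f differentiable (at t)" and nz: "f t \<noteq> 0 \<or> deriv f t = 0"
  shows "(\<lambda>t. \<bar>f t\<bar>) differentiable (at t)"
proof -
  have d: "(f has_real_derivative deriv f t) (at t)"
    using f by (simp add: DERIV_deriv_iff_real_differentiable)
  show ?thesis
  proof (cases "f t = 0")
    case True
    then have d0: "(f has_real_derivative 0) (at t)" using d nz by simp
    have "((\<lambda>s. (f s - f t) / (s - t)) \<longlongrightarrow> 0) (at t)"
      using d0 by (simp add: has_field_derivative_iff)
    then have l: "((\<lambda>s. \<bar>(f s - f t) / (s - t)\<bar>) \<longlongrightarrow> 0) (at t)" by (rule tendsto_rabs_zero)
    have "((\<lambda>s. (\<bar>f s\<bar> - \<bar>f t\<bar>) / (s - t)) \<longlongrightarrow> 0) (at t)"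
      by (rule Lim_null_comparison[OF _ l]) (simp add: True abs_divide)
    then have "((\<lambda>s. \<bar>f s\<bar>) has_real_derivative 0) (at t)" by (simp add: has_field_derivative_iff)
    then show ?thesis by (auto simp: real_differentiable_def)
  next
    case False
    then have "(norm \<circ> f) differentiable (at t)"
      by (intro differentiable_chain_at f differentiable_norm_at)
    then show ?thesis by (simp add: o_def)
  qed
qed

lemma ae_diff_lipschitz_abs:
  assumes "ae_diff_lipschitz f"
  shows "ae_diff_lipschitz (\<lambda>t. \<bar>f t\<bar>)"
proof -
  obtain C where C: "C-lipschitz_on UNIV f" using assms unfolding ae_diff_lipschitz_def by blast
  have "C-lipschitz_on UNIV (\<lambda>t. \<bar>f t\<bar>)"
  proof (rule lipschitz_onI)
    fix x y
    have "\<bar>\<bar>f x\<bar> - \<bar>f y\<bar>\<bar> \<le> \<bar>f x - f y\<bar>" by (rule abs_triangle_ineq3)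
    then show "dist \<bar>f x\<bar> \<bar>f y\<bar> \<le> C * dist x y"
      using lipschitz_onD[OF C, of x y] by (simp add: dist_real_def)
  qed (rule lipschitz_on_nonneg[OF C])
  moreover have "AE t in lebesgue. (\<lambda>t. \<bar>f t\<bar>) differentiable (at t)"
  proof -
    have "AE t in lebesgue. t \<notin> {t. f t = 0 \<and> f differentiable (at t) \<and> deriv f t \<noteq> 0}"
      by (intro AE_not_in null_sets_completionI countable_imp_null_set_lborel countable_transversal_zeros)
    moreover have "AE t in lebesgue. f differentiable (at t)" using assms by (auto simp: ae_diff_lipschitz_def)
    ultimately show ?thesis by eventually_elim (auto intro: abs_differentiable)
  qed
  ultimately show ?thesis unfolding ae_diff_lipschitz_def by blast
qed

lemma ae_diff_lipschitz_hat:
  assumes "ae_diff_lipschitz f"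
  shows "ae_diff_lipschitz (\<lambda>t. max 0 (1 - \<bar>f t - k\<bar> / h))"
proof -
  define g where "g = (\<lambda>t. 1 + (- 1 / h) * \<bar>f t + (- k)\<bar>)"
  have "ae_diff_lipschitz g"
    unfolding g_def
    by (intro ae_diff_lipschitz_add ae_diff_lipschitz_cmult ae_diff_lipschitz_abs ae_diff_lipschitz_const assms)
  \<comment> \<open>\<open>max 0 x\<close> is half of \<open>x + \<bar>x\<bar>\<close>, so closure
    under absolute values is enough.\<close>
  then have "ae_diff_lipschitz (\<lambda>t. (1/2) * (g t + \<bar>g t\<bar>))"
    by (intro ae_diff_lipschitz_add ae_diff_lipschitz_cmult ae_diff_lipschitz_abs)
  moreover have "(\<lambda>t. (1/2) * (g t + \<bar>g t\<bar>)) = (\<lambda>t. max 0 (1 - \<bar>f t - k\<bar> / h))"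
    unfolding g_def by (auto simp: fun_eq_iff max_def)
  ultimately show ?thesis by simp
qed

section \<open>The reduced trace space\<close>

lemma arclength_paramD:
  assumes "arclength_param L c S"
  shows "0 < L" "c (t + L) = c t" "inj_on c {0..<L}" "c ` {0..<L} = S" "1-lipschitz_on UNIV c"
    "AE t in lebesgue. \<exists>v. (c has_vector_derivative v) (at t) \<and> norm v = 1"
  using assms unfolding arclength_param_def by blast+

lemma periodic_int_shift:
  fixes c :: "real \<Rightarrow> 'a"
  assumes per: "\<And>t. c (t + L) = c t"
  shows "c (t + of_int n * L) = c t"
proof (induction n rule: int_induct[where k=0])
  case (step1 i)
  have "c (t + of_int (i + 1) * L) = c ((t + of_int i * L) + L)" by (simp add: algebra_simps)
  then show ?case using step1 per by simp
next
  case (step2 i)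
  have "c (t + of_int i * L) = c ((t + of_int (i - 1) * L) + L)" by (simp add: algebra_simps)
  then show ?case using step2 per by simp
qed simp

lemma period_representative:
  fixes L :: real
  assumes "0 < L"
  obtains n :: int where "t + of_int n * L \<in> {b..<b + L}"
proof
  define m where "m = \<lfloor>(t - b) / L\<rfloor>"
  have "of_int m \<le> (t - b) / L" "(t - b) / L < of_int m + 1" by (auto simp: m_def)
  then show "t + of_int (- m) * L \<in> {b..<b + L}" using assms by (auto simp: field_simps)
qed

lemma arclength_param_in:
  assumes "arclength_param L c S"
  shows "c t \<in> S"
proof -
  note ap = arclength_paramD[OF assms]
  obtain n :: int where "t + of_int n * L \<in> {0..<0 + L}" by (rule period_representative[OF ap(1)])
  then have "c (t + of_int n * L) \<in> S" using ap(4) by auto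
  then show ?thesis using periodic_int_shift[of c L, OF ap(2)] by simp
qed

lemma ae_diff_lipschitz_nodal_basis:
  assumes ap: "arclength_param L c S" and h: "0 < h"
  shows "ae_diff_lipschitz (\<lambda>t. nodal_basis h a m (c t))"
proof -
  note ap = arclength_paramD[OF ap]
  have proj: "ae_diff_lipschitz (\<lambda>t. p (c t))"
    if p: "bounded_linear p" and le: "\<And>x y. dist (p x) (p y) \<le> dist x y" for p :: "point \<Rightarrow> real"
  proof -
    have "1-lipschitz_on UNIV (\<lambda>t. p (c t))"
    proof (rule lipschitz_onI)
      show "dist (p (c x)) (p (c y)) \<le> 1 * dist x y" for x y
        using le[of "c x" "c y"] lipschitz_onD[OF ap(5), of x y] by simp
    qed simp
    moreover have "AE t in lebesgue. (\<lambda>t. p (c t)) differentiable (at t)"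
      using ap(6)
    proof eventually_elim
      case (elim t)
      then obtain v where "(c has_vector_derivative v) (at t)" by blast
      from bounded_linear.has_vector_derivative[OF p this]
      show ?case by (auto simp: has_vector_derivative_def differentiable_def)
    qed
    ultimately show ?thesis unfolding ae_diff_lipschitz_def by (intro conjI exI)
  qed
  have fs: "ae_diff_lipschitz (\<lambda>t. fst (c t))" "ae_diff_lipschitz (\<lambda>t. snd (c t))"
    by (intro proj bounded_linear_fst bounded_linear_snd dist_fst_le dist_snd_le)+
  have "\<bar>max 0 (1 - \<bar>x\<bar> / h)\<bar> \<le> 1" for x :: real using h by (simp add: max_def)
  then show ?thesis
    unfolding nodal_basis_def
    by (intro ae_diff_lipschitz_mult[where K=1] ae_diff_lipschitz_hat fs) blast+
qed

text \<open>A nodal basis function is a product of hats of the coordinates, hence Lipschitz along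
  the 1-Lipschitz curve \<open>\<sigma>\<close>. The value \<open>undefined\<close> given by
  \<open>restrict\<close> is never met, since \<open>\<sigma>\<close> stays on the surface.\<close>

lemma W_red_primitive:
  assumes ap: "arclength_param L \<sigma> (discrete_surface h a \<psi>)" and h: "0 < h"
    and v: "v \<in> W_red ly w h a \<psi>"
  shows "periodic_primitive L (v \<circ> \<sigma>) (deriv (v \<circ> \<sigma>))"
proof -
  obtain u where u: "v = restrict (reduced_function ly w h a \<psi> u) (discrete_surface h a \<psi>)"
    using v unfolding W_red_def V_red_def by blast
  have eq: "v \<circ> \<sigma> = (\<lambda>t. \<Sum>\<xi>\<in>gam h a \<psi>. reduced_values ly w h a \<psi> u \<xi> * nodal_basis h a \<xi> (\<sigma> t))"
    using arclength_param_in[OF ap] by (auto simp: u reduced_function_def fun_eq_iff)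
  have "ae_diff_lipschitz (v \<circ> \<sigma>)"
    unfolding eq
    by (intro ae_diff_lipschitz_sum ae_diff_lipschitz_cmult ae_diff_lipschitz_nodal_basis[OF ap] h)
  then obtain C where "C-lipschitz_on UNIV (v \<circ> \<sigma>)" "AE t in lebesgue. (v \<circ> \<sigma>) differentiable (at t)"
    unfolding ae_diff_lipschitz_def by blast
  then show ?thesis
    by (rule lipschitz_periodic_primitive)
      (use arclength_paramD(1)[OF ap] arclength_paramD(2)[OF ap, of 0] in auto)
qed

lemma reduced_function_diff:
  "reduced_function ly w h a \<psi> (\<lambda>i. u i - v i) x =
     reduced_function ly w h a \<psi> u x - reduced_function ly w h a \<psi> v x"
proof -
  have "reduced_values ly w h a \<psi> (\<lambda>i. u i - v i) \<xi> =
      reduced_values ly w h a \<psi> u \<xi> - reduced_values ly w h a \<psi> v \<xi>" for \<xi>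
    by (auto simp: reduced_values_def right_diff_distrib sum_subtractf)
  then show ?thesis by (simp add: reduced_function_def left_diff_distrib sum_subtractf)
qed

text \<open>Off the surface the pointwise difference of two restricted functions need not be
  \<open>undefined\<close>, so the difference is formed before restricting and is compared with
  \<open>u x - v x\<close> on the surface only.\<close>

lemma W_red_diff:
  assumes "u \<in> W_red ly w h a \<psi>" "v \<in> W_red ly w h a \<psi>"
  obtains z where "z \<in> W_red ly w h a \<psi>" "\<And>x. x \<in> discrete_surface h a \<psi> \<Longrightarrow> z x = u x - v x"
proof -
  let ?D = "discrete_surface h a \<psi>"
  obtain u' v' where uv: "u = restrict (reduced_function ly w h a \<psi> u') ?D"
    "v = restrict (reduced_function ly w h a \<psi> v') ?D"
    using assms unfolding W_red_def V_red_def by blast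
  show thesis
  proof (rule that[of "restrict (reduced_function ly w h a \<psi> (\<lambda>i. u' i - v' i)) ?D"])
    show "restrict (reduced_function ly w h a \<psi> (\<lambda>i. u' i - v' i)) ?D \<in> W_red ly w h a \<psi>"
      unfolding W_red_def V_red_def by blast
  qed (simp add: uv reduced_function_diff)
qed

text \<open>Lebesgue measure is complete, and extension by zero passes from \<open>S\<close> to the
  whole line.\<close>

lemma borel_measurable_lebesgue_on_AE:
  fixes f g :: "real \<Rightarrow> real"
  assumes f: "f \<in> borel_measurable (lebesgue_on S)" and S: "S \<in> sets lebesgue"
    and ae: "AE t in lebesgue_on S. f t = g t"
  shows "g \<in> borel_measurable (lebesgue_on S)"
proof -
  have "(\<lambda>t. if t \<in> S then f t else 0) \<in> borel_measurable lebesgue"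
    using f S by (simp add: borel_measurable_if)
  moreover have "AE t in lebesgue. (if t \<in> S then f t else 0) = (if t \<in> S then g t else 0)"
    using ae S by (auto simp: AE_restrict_space_iff elim!: eventually_mono)
  ultimately have "(\<lambda>t. if t \<in> S then g t else 0) \<in> borel_measurable lebesgue"
    by (rule borel_measurable_AE)
  then show ?thesis using S by (simp add: borel_measurable_if)
qed

text \<open>The tangent in \<open>tangential_grad\<close> has norm 1 almost everywhere and drops out
  of the inner product.\<close>

lemma dirichlet_form_primitives:
  assumes ap: "arclength_param L \<sigma> S"
    and f: "periodic_primitive L (f \<circ> \<sigma>) f1" and g: "periodic_primitive L (g \<circ> \<sigma>) g1"
  shows "dirichlet_form L \<sigma> f g = integral\<^sup>L (lebesgue_on {0..L}) (\<lambda>t. f1 t * g1 t)"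
proof -
  note D = arclength_paramD[OF ap]
  have wf: "AE t in lebesgue_on {0..L}. weak_deriv_per L 1 (f \<circ> \<sigma>) t = f1 t"
    using periodic_primitive_weak_deriv_1[OF f] weak_deriv_per_eq(2)[OF D(1)] D(1) by auto
  have wg: "AE t in lebesgue_on {0..L}. weak_deriv_per L 1 (g \<circ> \<sigma>) t = g1 t"
    using periodic_primitive_weak_deriv_1[OF g] weak_deriv_per_eq(2)[OF D(1)] D(1) by auto
  have v: "AE t in lebesgue_on {0..L}. \<exists>v. (\<sigma> has_vector_derivative v) (at t) \<and> norm v = 1"
    using D(6) by (auto simp: AE_restrict_space_iff elim!: eventually_mono)
  have ae: "AE t in lebesgue_on {0..L}. f1 t * g1 t = tangential_grad L \<sigma> f t \<bullet> tangential_grad L \<sigma> g t"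
    using wf wg v
  proof eventually_elim
    case (elim t)
    then obtain v where v: "(\<sigma> has_vector_derivative v) (at t)" "norm v = 1" by blast
    then have "vector_derivative \<sigma> (at t) = v" "v \<bullet> v = 1"
      by (auto simp: vector_derivative_at dot_square_norm)
    then show ?case using elim by (simp add: tangential_grad_def)
  qed
  have m: "(\<lambda>t. f1 t * g1 t) \<in> borel_measurable (lebesgue_on {0..L})"
    using L2_per_mult[OF periodic_primitiveD(1)[OF f] periodic_primitiveD(1)[OF g]] by auto
  show ?thesis
    unfolding dirichlet_form_def
    by (intro integral_cong_AE borel_measurable_lebesgue_on_AE[OF m _ ae] m)
      (use ae in \<open>auto elim!: eventually_mono\<close>)
qed

lemma L2_curve_norm_eq: "L2_curve_norm L \<sigma> f = L2_norm_on L (f \<circ> \<sigma>)"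
  by (simp add: L2_curve_norm_def L2_norm_on_def curve_integral_def)

text \<open>The approximation property carried over to the circle and stated in terms of
  \<open>P2\<close> alone: since \<open>P\<close> and \<open>P1\<close> have mean zero, two Poincare
  inequalities bound the H2 norm by \<open>1 + L + L\<^sup>2\<close> times the norm of
  \<open>P2\<close>.\<close>

lemma W_red_mean_zero_approx:
  assumes ap: "arclength_param L \<sigma> (discrete_surface h a \<psi>)" and h: "0 < h"
    and appr: "reduced_approximation C\<^sub>0 ly w h a \<psi> L \<sigma>"
    and P: "periodic_primitive L P P1" "periodic_primitive L P1 P2"
    and P0: "integral\<^sup>L (lebesgue_on {0..L}) P = 0" "integral\<^sup>L (lebesgue_on {0..L}) P1 = 0"
  obtains v where "v \<in> W_red_mean_zero ly w h a \<psi> L \<sigma>"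
    "L2_norm_on L (\<lambda>t. P1 t - deriv (v \<circ> \<sigma>) t) \<le> \<bar>C\<^sub>0\<bar> * h * (1 + L + L\<^sup>2) * L2_norm_on L P2"
proof -
  note D = arclength_paramD[OF ap]
  \<comment> \<open>A function on the polygon with \<open>F \<circ> \<sigma> = P\<close> on
    \<open>{0..L}\<close>. At the end point the inverse returns the parameter 0 instead of
    \<open>L\<close>, which is harmless because \<open>P L = P 0\<close>.\<close>
  define F where "F x = P (the_inv_into {0..<L} \<sigma> x)" for x
  have F: "(F \<circ> \<sigma>) t = P t" if t: "t \<in> {0..L}" for t
  proof (cases "t = L")
    case True
    have "\<sigma> L = \<sigma> 0" using D(2)[of 0] by simp
    then have "(F \<circ> \<sigma>) t = P 0" using True the_inv_into_f_f[OF D(3), of 0] D(1) by (simp add: F_def)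
    then show ?thesis using True periodic_primitiveD(2)[OF P(1)] by simp
  next
    case False
    then show ?thesis using t the_inv_into_f_f[OF D(3), of t] by (simp add: F_def)
  qed
  have pF: "periodic_primitive L (F \<circ> \<sigma>) P1"
    by (rule periodic_primitive_cong[OF P(1)]) (use F D(1) in auto)
  have "F \<in> H2_curve L \<sigma>" using H_per_2_primitives(1)[OF pF P(2) D(1)] by (simp add: H2_curve_def)
  moreover have "curve_integral L \<sigma> F = 0"
  proof -
    have "integral\<^sup>L (lebesgue_on {0..L}) (\<lambda>t. F (\<sigma> t)) = integral\<^sup>L (lebesgue_on {0..L}) P"
      using F by (intro Bochner_Integration.integral_cong) auto
    then show ?thesis using P0 by (simp add: curve_integral_def)
  qed
  ultimately obtain v where v: "v \<in> W_red_mean_zero ly w h a \<psi> L \<sigma>"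
    "H1_curve_norm L \<sigma> (\<lambda>x. F x - v x) \<le> C\<^sub>0 * h * H2_curve_norm L \<sigma> F"
    using appr unfolding reduced_approximation_def by blast
  have pv: "periodic_primitive L (v \<circ> \<sigma>) (deriv (v \<circ> \<sigma>))"
    using v(1) W_red_primitive[OF ap h] by (auto simp: W_red_mean_zero_def)
  have pd: "periodic_primitive L ((\<lambda>x. F x - v x) \<circ> \<sigma>) (\<lambda>t. P1 t - deriv (v \<circ> \<sigma>) t)"
    using periodic_primitive_diff[OF pF pv] by (simp add: o_def)
  let ?N = "L2_norm_on L"
  have dir: "dirichlet_form L \<sigma> (\<lambda>x. F x - v x) (\<lambda>x. F x - v x) = (?N (\<lambda>t. P1 t - deriv (v \<circ> \<sigma>) t))\<^sup>2"
    unfolding dirichlet_form_primitives[OF ap pd pd] L2_norm_on_sq by (simp add: power2_eq_square)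
  have n1: "?N P1 \<le> L * ?N P2" by (rule periodic_primitive_Poincare[OF P(2) D(1) P0(2)])
  have n0: "?N P \<le> L * ?N P1" by (rule periodic_primitive_Poincare[OF P(1) D(1) P0(1)])
  have "L * ?N P1 \<le> L * (L * ?N P2)" using n1 D(1) by (intro mult_left_mono) auto
  then have n0': "?N P \<le> L\<^sup>2 * ?N P2" using n0 by (simp add: power2_eq_square)
  have "H2_curve_norm L \<sigma> F = sqrt ((?N (F \<circ> \<sigma>))\<^sup>2 + (?N P1)\<^sup>2 + (?N P2)\<^sup>2)"
    unfolding H2_curve_norm_def by (rule H_per_2_primitives(2)[OF pF P(2) D(1)])
  also have "?N (F \<circ> \<sigma>) = ?N P" by (rule L2_norm_on_cong) (rule F)
  also have "sqrt ((?N P)\<^sup>2 + (?N P1)\<^sup>2 + (?N P2)\<^sup>2) \<le> ?N P + ?N P1 + ?N P2"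
    by (rule order_trans[OF sqrt_add_le_add_sqrt])
      (auto intro: order_trans[OF sqrt_add_le_add_sqrt])
  also have "\<dots> \<le> (1 + L + L\<^sup>2) * ?N P2" using n0' n1 by (simp add: algebra_simps)
  finally have H2: "H2_curve_norm L \<sigma> F \<le> (1 + L + L\<^sup>2) * ?N P2" .
  have H20: "0 \<le> H2_curve_norm L \<sigma> F"
    unfolding H2_curve_norm_def H_per_norm_def by (auto intro!: sum_nonneg)
  have "?N (\<lambda>t. P1 t - deriv (v \<circ> \<sigma>) t) \<le> H1_curve_norm L \<sigma> (\<lambda>x. F x - v x)"
    unfolding H1_curve_norm_def dir by (rule real_le_rsqrt) simp
  also have "\<dots> \<le> C\<^sub>0 * h * H2_curve_norm L \<sigma> F" by (rule v(2))
  \<comment> \<open>No sign is assumed for \<open>C\<^sub>0\<close>; its absolute value keeps the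
    bound monotone in the H2 norm.\<close>
  also have "\<dots> \<le> \<bar>C\<^sub>0\<bar> * h * H2_curve_norm L \<sigma> F"
    using h H20 by (intro mult_right_mono) auto
  also have "\<dots> \<le> \<bar>C\<^sub>0\<bar> * h * ((1 + L + L\<^sup>2) * ?N P2)"
    using H2 h by (intro mult_left_mono) auto
  finally show thesis using v(1) that by (simp add: mult.assoc)
qed

text \<open>The reduced trace solution is the Galerkin approximation of the solution \<open>P\<close> of the problem
  with right-hand side \<open>F - m\<close>, since the test functions have mean zero.  The estimate is the
  Aubin-Nitsche duality argument.\<close>

lemma galerkin_L2_estimate:
  assumes ap: "arclength_param L \<sigma> (discrete_surface h a \<psi>)" and h: "0 < h"
    and appr: "reduced_approximation C\<^sub>0 ly w h a \<psi> L \<sigma>"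
    and uh: "u\<^sub>h \<in> W_red_mean_zero ly w h a \<psi> L \<sigma>"
    and F: "F \<in> L2_per L"
    and sol: "\<And>v. v \<in> W_red_mean_zero ly w h a \<psi> L \<sigma> \<Longrightarrow>
        dirichlet_form L \<sigma> u\<^sub>h v = integral\<^sup>L (lebesgue_on {0..L}) (\<lambda>t. F t * v (\<sigma> t))"
    and P: "periodic_primitive L P P1" "periodic_primitive L P1 (\<lambda>t. - (F t - m))"
    and P0: "integral\<^sup>L (lebesgue_on {0..L}) P = 0"
  shows "L2_norm_on L (\<lambda>t. P t - u\<^sub>h (\<sigma> t)) \<le>
      (\<bar>C\<^sub>0\<bar> * h * (1 + L + L\<^sup>2))\<^sup>2 * L2_norm_on L (\<lambda>t. F t - m)"
proof -
  note D = arclength_paramD[OF ap]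
  let ?I = "integral\<^sup>L (lebesgue_on {0..L})"
  let ?N = "L2_norm_on L"
  let ?W = "W_red_mean_zero ly w h a \<psi> L \<sigma>"
  define k where "k = \<bar>C\<^sub>0\<bar> * h * (1 + L + L\<^sup>2)"
  have k0: "k \<ge> 0" using h D(1) by (simp add: k_def)
  have pW: "periodic_primitive L (v \<circ> \<sigma>) (deriv (v \<circ> \<sigma>))" if "v \<in> ?W" for v
    using that W_red_primitive[OF ap h] by (auto simp: W_red_mean_zero_def)
  have meanW: "?I (\<lambda>t. v (\<sigma> t)) = 0" if "v \<in> ?W" for v
    using that by (simp add: W_red_mean_zero_def curve_integral_def)
  have intW: "integrable (lebesgue_on {0..L}) (\<lambda>t. v (\<sigma> t))" if "v \<in> ?W" for v
    using L2_per_integrable[OF periodic_primitive_L2[OF pW[OF that]]] by (simp add: comp_def)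
  define e where "e = (\<lambda>t. P t - u\<^sub>h (\<sigma> t))"
  define e1 where "e1 = (\<lambda>t. P1 t - deriv (u\<^sub>h \<circ> \<sigma>) t)"
  have pe: "periodic_primitive L e e1"
    using periodic_primitive_diff[OF P(1) pW[OF uh]] by (simp add: e_def e1_def o_def)
  have eL: "e \<in> L2_per L" and e1L: "e1 \<in> L2_per L"
    using periodic_primitive_L2[OF pe] periodic_primitiveD(1)[OF pe] by auto
  have P1L: "P1 \<in> L2_per L" using periodic_primitiveD(1)[OF P(1)] .
  have P1z: "?I P1 = 0" using periodic_primitive_integral_zero[OF P(1)] D(1) by simp
  have orth: "?I (\<lambda>t. e1 t * v1 t) = 0" if v: "v \<in> ?W" and v1: "periodic_primitive L (v \<circ> \<sigma>) v1" for v v1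
  proof -
    have vL: "(v \<circ> \<sigma>) \<in> L2_per L" "v1 \<in> L2_per L"
      using periodic_primitive_L2[OF v1] periodic_primitiveD(1)[OF v1] by auto
    have "?I (\<lambda>t. P1 t * v1 t) = - ?I (\<lambda>t. - (F t - m) * (v \<circ> \<sigma>) t)"
      using periodic_primitive_by_parts[OF P(2) v1] D(1) by simp
    also have "\<dots> = ?I (\<lambda>t. F t * v (\<sigma> t) - m * v (\<sigma> t))"
      by (simp add: algebra_simps flip: Bochner_Integration.integral_minus)
    also have "\<dots> = ?I (\<lambda>t. F t * v (\<sigma> t))"
      using L2_per_mult[OF F vL(1)] L2_per_integrable[OF vL(1)] meanW[OF v] by (simp add: o_def)
    also have "\<dots> = ?I (\<lambda>t. deriv (u\<^sub>h \<circ> \<sigma>) t * v1 t)"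
      using sol[OF v] dirichlet_form_primitives[OF ap pW[OF uh] v1] by simp
    finally show ?thesis
      using L2_per_mult[OF P1L vL(2)] L2_per_mult[OF periodic_primitiveD(1)[OF pW[OF uh]] vL(2)]
      by (simp add: e1_def left_diff_distrib)
  qed
  have le: "?N x \<le> y" if "(?N x)\<^sup>2 \<le> ?N x * y" "0 \<le> y" for x y
  proof (cases "?N x = 0")
    case False
    then have "?N x > 0" using L2_norm_on_nonneg[of L x] by linarith
    then show ?thesis using that(1) by (simp add: power2_eq_square)
  qed (use that in simp)
  \<comment> \<open>Cea's lemma with constant 1, as the form is the L2 inner product of derivatives:
    \<open>e1\<close> is orthogonal to the derivative of \<open>u\<^sub>h - v\<close>.\<close>
  have energy: "?N e1 \<le> k * ?N (\<lambda>t. F t - m)"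
  proof -
    obtain v where v: "v \<in> ?W" "?N (\<lambda>t. P1 t - deriv (v \<circ> \<sigma>) t) \<le> k * ?N (\<lambda>t. - (F t - m))"
      unfolding k_def by (rule W_red_mean_zero_approx[OF ap h appr P P0 P1z])
    obtain z where z: "z \<in> W_red ly w h a \<psi>" "\<And>x. x \<in> discrete_surface h a \<psi> \<Longrightarrow> z x = u\<^sub>h x - v x"
      using W_red_diff uh v(1) unfolding W_red_mean_zero_def by blast
    have zs: "z (\<sigma> t) = u\<^sub>h (\<sigma> t) - v (\<sigma> t)" for t using z(2) arclength_param_in[OF ap] by blast
    have "?I (\<lambda>t. z (\<sigma> t)) = 0"
      unfolding zs using intW[OF uh] intW[OF v(1)] meanW[OF uh] meanW[OF v(1)] by simp
    then have zW: "z \<in> ?W" using z(1) by (simp add: W_red_mean_zero_def curve_integral_def)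
    have z1: "periodic_primitive L (z \<circ> \<sigma>) (\<lambda>t. deriv (u\<^sub>h \<circ> \<sigma>) t - deriv (v \<circ> \<sigma>) t)"
      using periodic_primitive_diff[OF pW[OF uh] pW[OF v(1)]] by (simp add: o_def zs)
    have dL: "(\<lambda>t. P1 t - deriv (v \<circ> \<sigma>) t) \<in> L2_per L"
      by (intro L2_per_diff P1L periodic_primitiveD(1)[OF pW[OF v(1)]])
    have "(?N e1)\<^sup>2 = ?I (\<lambda>t. e1 t * (P1 t - deriv (v \<circ> \<sigma>) t)
        - e1 t * (deriv (u\<^sub>h \<circ> \<sigma>) t - deriv (v \<circ> \<sigma>) t))"
      unfolding L2_norm_on_sq
      by (intro Bochner_Integration.integral_cong) (auto simp: e1_def power2_eq_square algebra_simps)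
    also have "\<dots> = ?I (\<lambda>t. e1 t * (P1 t - deriv (v \<circ> \<sigma>) t))"
      using L2_per_mult[OF e1L dL] L2_per_mult[OF e1L periodic_primitiveD(1)[OF z1]] orth[OF zW z1]
      by simp
    also have "\<dots> \<le> ?N e1 * ?N (\<lambda>t. P1 t - deriv (v \<circ> \<sigma>) t)"
      using Cauchy_Schwarz_L2_per[OF e1L dL] by linarith
    finally have "?N e1 \<le> ?N (\<lambda>t. P1 t - deriv (v \<circ> \<sigma>) t)" by (rule le) simp
    moreover have "?N (\<lambda>t. - (F t - m)) = ?N (\<lambda>t. F t - m)"
      by (simp add: L2_norm_on_def power2_commute)
    ultimately show ?thesis using v(2) by simp
  qed
  have dual: "?N e \<le> k * ?N e1"
  proof -
    have ez: "?I (\<lambda>t. - e t) = 0"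
      using P0 meanW[OF uh] L2_per_integrable[OF periodic_primitive_L2[OF P(1)]] intW[OF uh]
      by (simp add: e_def)
    \<comment> \<open>The dual problem \<open>z'' = - e\<close>, solvable because \<open>e\<close>
      has mean zero. Subtracting the derivative of an approximation of \<open>z\<close> costs
      nothing by orthogonality and gains the second factor \<open>k\<close>.\<close>
    obtain z1 where z1: "periodic_primitive L z1 (\<lambda>t. - e t)" "?I z1 = 0"
      using periodic_primitive_exists[OF L2_per_minus[OF eL] ez D(1)] by blast
    obtain z where z: "periodic_primitive L z z1" "?I z = 0"
      using periodic_primitive_exists[OF periodic_primitive_L2[OF z1(1)] z1(2) D(1)] by blast
    obtain v where v: "v \<in> ?W" "?N (\<lambda>t. z1 t - deriv (v \<circ> \<sigma>) t) \<le> k * ?N (\<lambda>t. - e t)"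
      unfolding k_def by (rule W_red_mean_zero_approx[OF ap h appr z(1) z1(1) z(2) z1(2)])
    have z1L: "z1 \<in> L2_per L" using periodic_primitive_L2[OF z1(1)] .
    have vL: "deriv (v \<circ> \<sigma>) \<in> L2_per L" by (rule periodic_primitiveD(1)[OF pW[OF v(1)]])
    have "(?N e)\<^sup>2 = - ?I (\<lambda>t. e t * - e t)"
      unfolding L2_norm_on_sq by (simp add: power2_eq_square)
    also have "\<dots> = ?I (\<lambda>t. e1 t * z1 t)"
      using periodic_primitive_by_parts[OF pe z1(1)] D(1) by simp
    also have "\<dots> = ?I (\<lambda>t. e1 t * (z1 t - deriv (v \<circ> \<sigma>) t))"
      using L2_per_mult[OF e1L z1L] L2_per_mult[OF e1L vL] orth[OF v(1) pW[OF v(1)]]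
      by (simp add: right_diff_distrib)
    also have "\<dots> \<le> ?N e1 * ?N (\<lambda>t. z1 t - deriv (v \<circ> \<sigma>) t)"
      using Cauchy_Schwarz_L2_per[OF e1L L2_per_diff[OF z1L vL]] by linarith
    also have "\<dots> \<le> ?N e1 * (k * ?N e)"
      using v(2) by (intro mult_left_mono) (auto simp: L2_norm_on_def)
    finally have "(?N e)\<^sup>2 \<le> ?N e * (k * ?N e1)" by (simp add: mult_ac)
    then show ?thesis by (rule le) (use k0 in simp)
  qed
  have "?N e \<le> k * (k * ?N (\<lambda>t. F t - m))"
    using dual energy k0 by (meson mult_left_mono order_trans)
  then show ?thesis by (simp add: k_def e_def power2_eq_square mult.assoc)
qed

section \<open>Smooth closed curves and closest points\<close>

text \<open>Two derivatives and a bound \<open>K\<close> for the curvature are all that is kept of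
  the smoothness; \<open>1 \<le> K\<close> makes \<open>K\<close> safe to divide by.\<close>

locale unit_speed_closed_curve =
  fixes L :: real and c :: "real \<Rightarrow> point" and \<Gamma> :: "point set"
    and c1 c2 :: "real \<Rightarrow> point" and K :: real
  assumes L: "0 < L" and per: "\<And>t. c (t + L) = c t" and inj: "inj_on c {0..<L}"
    and image: "c ` {0..<L} = \<Gamma>"
    and c1: "\<And>t. (c has_vector_derivative c1 t) (at t)"
    and c2: "\<And>t. (c1 has_vector_derivative c2 t) (at t)"
    and unit: "\<And>t. norm (c1 t) = 1" and K: "\<And>t. norm (c2 t) \<le> K" and K1: "1 \<le> K"

lemma differentiable_has_vector_derivative_partial:
  fixes f :: "real \<Rightarrow> 'b::real_normed_vector"
  assumes "f differentiable (at x)"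
  shows "(f has_vector_derivative partial 1 f x) (at x)"
proof -
  have d: "(f has_vector_derivative vector_derivative f (at x)) (at x)"
    using assms by (simp add: vector_derivative_works)
  then have "(f has_derivative (\<lambda>h. h *\<^sub>R vector_derivative f (at x))) (at x)"
    by (simp add: has_vector_derivative_def)
  then have "frechet_derivative f (at x) = (\<lambda>h. h *\<^sub>R vector_derivative f (at x))"
    by (rule frechet_derivative_at[symmetric])
  then show ?thesis using d by (simp add: partial_def)
qed

lemma vector_derivative_periodic:
  fixes f :: "real \<Rightarrow> 'b::real_normed_vector"
  assumes "\<And>t. f (t + L) = f t" "\<And>t. (f has_vector_derivative f' t) (at t)"
  shows "f' (t + L) = f' t"
proof -
  have "((\<lambda>x. f (x + L)) has_vector_derivative 1 *\<^sub>R f' (t + L)) (at t)"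
  proof -
    have "((\<lambda>x. x + L) has_vector_derivative 1) (at t)"
      by (auto simp flip: has_real_derivative_iff_has_vector_derivative intro!: derivative_eq_intros)
    from vector_diff_chain_at[OF this assms(2)[of "t + L"]] show ?thesis by (simp add: o_def)
  qed
  then have "(f has_vector_derivative f' (t + L)) (at t)" using assms(1) by simp
  then show ?thesis using assms(2)[of t] by (rule vector_derivative_unique_at)
qed

lemma onorm_scaleR_le:
  fixes v :: "'b::real_normed_vector"
  assumes "norm v \<le> B"
  shows "onorm (\<lambda>h::real. h *\<^sub>R v) \<le> B"
proof (rule onorm_bound)
  show "0 \<le> B" using assms norm_ge_zero order_trans by blast
  show "norm (h *\<^sub>R v) \<le> B * norm h" for h :: real
    using mult_right_mono[OF assms, of "\<bar>h\<bar>"] by (simp add: mult.commute)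
qed

text \<open>Unit speed is given only almost everywhere, but \<open>c1\<close> is continuous, so the
  set of other speeds is open, and an open null set is empty. The bound on \<open>c2\<close> comes
  from compactness of one period.\<close>

lemma smooth_closed_curve_unit_speed:
  assumes "smooth_closed_curve L c \<Gamma>"
  obtains c1 c2 K where "unit_speed_closed_curve L c \<Gamma> c1 c2 K"
proof -
  have ap: "arclength_param L c \<Gamma>" and sm: "smooth_on UNIV c"
    using assms by (auto simp: smooth_closed_curve_def)
  note D = arclength_paramD[OF ap]
  have "Ck_on (Suc (Suc 0)) UNIV c" using sm unfolding smooth_on_def by blast
  then have diff: "\<And>x. c differentiable (at x)" "\<And>x. partial 1 c differentiable (at x)"
    "continuous_on UNIV (partial 1 (partial 1 c))" by auto
  define c1 where "c1 = partial 1 c"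
  define c2 where "c2 = partial 1 c1"
  have d1: "(c has_vector_derivative c1 t) (at t)" for t
    unfolding c1_def by (intro differentiable_has_vector_derivative_partial diff)
  have d2: "(c1 has_vector_derivative c2 t) (at t)" for t
    unfolding c1_def c2_def by (intro differentiable_has_vector_derivative_partial diff)
  have per1: "c1 (t + L) = c1 t" for t by (rule vector_derivative_periodic[OF D(2) d1])
  have per2: "c2 (t + L) = c2 t" for t by (rule vector_derivative_periodic[OF per1 d2])
  have c1c: "continuous_on UNIV c1"
    using d2 by (auto intro!: continuous_at_imp_continuous_on has_vector_derivative_continuous)
  have unit: "norm (c1 t) = 1" for t
  proof (rule ccontr)
    assume "norm (c1 t) \<noteq> 1"
    define U where "U = {t. norm (c1 t) \<noteq> 1}"
    have "open U" unfolding U_def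
      by (intro open_Collect_neq continuous_intros c1c)
    moreover have "U \<noteq> {}" using \<open>norm (c1 t) \<noteq> 1\<close> by (auto simp: U_def)
    moreover have "negligible U"
    proof -
      have "AE t in lebesgue. t \<notin> U"
        using D(6)
      proof eventually_elim
        case (elim t)
        then obtain v where v: "(c has_vector_derivative v) (at t)" "norm v = 1" by blast
        have "c1 t = v" by (rule vector_derivative_unique_at[OF d1 v(1)])
        then show ?case using v(2) by (simp add: U_def)
      qed
      then have "U \<in> null_sets lebesgue" using \<open>open U\<close> by (simp add: AE_iff_null_sets)
      then show ?thesis by (simp add: negligible_iff_null_sets)
    qed
    ultimately show False using open_not_negligible[of U] by simp
  qed
  have "compact (c2 ` {0..L})"
    by (intro compact_continuous_image continuous_on_subset[OF diff(3)[folded c1_def c2_def]]) auto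
  then have "bounded (c2 ` {0..L})" by (rule compact_imp_bounded)
  then obtain B where B0: "\<forall>x\<in>c2 ` {0..L}. norm x \<le> B" unfolding bounded_iff by (elim exE)
  have B: "norm (c2 t) \<le> B" if "t \<in> {0..L}" for t by (rule bspec[OF B0 imageI[OF that]])
  have KB: "norm (c2 t) \<le> max 1 B" for t
  proof -
    obtain n :: int where n: "t + of_int n * L \<in> {0..<0 + L}" by (rule period_representative[OF D(1)])
    then have "norm (c2 (t + of_int n * L)) \<le> B" by (intro B) auto
    then show ?thesis using periodic_int_shift[of c2 L, OF per2] by simp
  qed
  have "unit_speed_closed_curve L c \<Gamma> c1 c2 (max 1 B)"
    by unfold_locales (use D d1 d2 unit KB in auto)
  then show thesis by (rule that)
qed

context unit_speed_closed_curve
begin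

lemma c_eq_iff: "c t = c s \<longleftrightarrow> (\<exists>n::int. t = s + of_int n * L)"
proof
  assume eq: "c t = c s"
  obtain i :: int where i: "t + of_int i * L \<in> {0..<0 + L}" by (rule period_representative[OF L])
  obtain j :: int where j: "s + of_int j * L \<in> {0..<0 + L}" by (rule period_representative[OF L])
  have "c (t + of_int i * L) = c (s + of_int j * L)" using eq periodic_int_shift[of c L, OF per] by simp
  then have "t + of_int i * L = s + of_int j * L" using inj_onD[OF inj] i j by auto
  then have "t = s + of_int (j - i) * L" by (simp add: algebra_simps)
  then show "\<exists>n::int. t = s + of_int n * L" by blast
qed (use periodic_int_shift[of c L, OF per] in auto)

lemma c_in: "c t \<in> \<Gamma>"
proof -
  obtain i :: int where i: "t + of_int i * L \<in> {0..<0 + L}" by (rule period_representative[OF L])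
  then have "c (t + of_int i * L) \<in> \<Gamma>" using image by auto
  then show ?thesis using periodic_int_shift[of c L, OF per] by simp
qed

lemma representative:
  assumes "y \<in> \<Gamma>"
  obtains t where "c t = y" "t \<in> {b..<b + L}"
proof -
  obtain s where s: "c s = y" using assms image by blast
  obtain n :: int where "s + of_int n * L \<in> {b..<b + L}" by (rule period_representative[OF L])
  then show thesis using that[of "s + of_int n * L"] s periodic_int_shift[of c L, OF per] by simp
qed

lemma c_continuous: "continuous_on S c"
  using c1 by (auto intro!: continuous_at_imp_continuous_on has_vector_derivative_continuous)

lemma c1_continuous: "continuous_on S c1"
  using c2 by (auto intro!: continuous_at_imp_continuous_on has_vector_derivative_continuous)

lemma compact_curve: "compact \<Gamma>"
proof -
  have "\<Gamma> = c ` {0..L}" using image c_in by (auto simp: image_iff) 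
  then show ?thesis using compact_continuous_image[OF c_continuous, of "{0..L}"] by simp
qed

lemma curve_closed_nonempty: "closed \<Gamma>" "\<Gamma> \<noteq> {}"
  using compact_curve compact_imp_closed c_in by auto

lemma c_lipschitz: "norm (c t - c s) \<le> \<bar>t - s\<bar>"
proof -
  have "norm (c t - c s) \<le> 1 * norm (t - s)"
    using c1 unit
    by (intro differentiable_bound[where S=UNIV and f'="\<lambda>x h. h *\<^sub>R c1 x"])
      (auto simp: has_vector_derivative_def intro!: onorm_scaleR_le)
  then show ?thesis by simp
qed

lemma c1_lipschitz: "norm (c1 t - c1 s) \<le> K * \<bar>t - s\<bar>"
proof -
  have "norm (c1 t - c1 s) \<le> K * norm (t - s)"
    using c2 K
    by (intro differentiable_bound[where S=UNIV and f'="\<lambda>x h. h *\<^sub>R c2 x"])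
      (auto simp: has_vector_derivative_def intro!: onorm_scaleR_le)
  then show ?thesis by simp
qed

text \<open>Mean value inequality for \<open>c t - (t - s) c1 s\<close>, whose derivative is bounded
  by \<open>K * \<bar>t - s\<bar>\<close> between \<open>s\<close> and \<open>t\<close>; the
  constant is twice that of Taylor's formula.\<close>

lemma c_taylor: "norm (c t - c s - (t - s) *\<^sub>R c1 s) \<le> K * (t - s)\<^sup>2"
proof -
  define f where "f = (\<lambda>t. c t - (t - s) *\<^sub>R c1 s)"
  have "norm (f t - f s) \<le> (K * \<bar>t - s\<bar>) * norm (t - s)"
  proof (rule differentiable_bound[where S="closed_segment s t" and f'="\<lambda>x h. h *\<^sub>R (c1 x - c1 s)"])
    fix x assume x: "x \<in> closed_segment s t"
    have "(f has_vector_derivative c1 x - c1 s) (at x)"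
      unfolding f_def by (auto intro!: derivative_eq_intros c1)
    then show "(f has_derivative (\<lambda>h. h *\<^sub>R (c1 x - c1 s))) (at x within closed_segment s t)"
      unfolding has_vector_derivative_def by (rule has_derivative_at_withinI)
    have "\<bar>x - s\<bar> \<le> \<bar>t - s\<bar>" using x by (auto simp: closed_segment_eq_real_ivl split: if_splits)
    then have "K * \<bar>x - s\<bar> \<le> K * \<bar>t - s\<bar>" using K1 by (intro mult_left_mono) auto
    then have "norm (c1 x - c1 s) \<le> K * \<bar>t - s\<bar>" using c1_lipschitz[of x s] by linarith
    then show "onorm (\<lambda>h. h *\<^sub>R (c1 x - c1 s)) \<le> K * \<bar>t - s\<bar>"
      by (rule onorm_scaleR_le)
  qed auto
  then show ?thesis by (simp add: f_def power2_eq_square algebra_simps)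
qed

lemma c1_dot_self: "c1 t \<bullet> c1 t = 1"
  using unit[of t] by (simp add: dot_square_norm)

lemma c_dot: "\<bar>(c t - c s) \<bullet> c1 s - (t - s)\<bar> \<le> K * (t - s)\<^sup>2"
proof -
  have "(c t - c s) \<bullet> c1 s - (t - s) = (c t - c s - (t - s) *\<^sub>R c1 s) \<bullet> c1 s"
    by (simp add: inner_diff_left c1_dot_self)
  also have "\<bar>\<dots>\<bar> \<le> norm (c t - c s - (t - s) *\<^sub>R c1 s) * norm (c1 s)"
    by (rule Cauchy_Schwarz_ineq2)
  finally show ?thesis using c_taylor[of t s] unit by simp
qed

text \<open>For nearby parameters the linear term in \<open>c_dot\<close> dominates the quadratic
  remainder.\<close>

lemma c_dot_pos:
  assumes "s < t" "K * (t - s) < 1"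
  shows "0 < (c t - c s) \<bullet> c1 s"
proof -
  have aux: "0 < X" if "\<bar>X - d\<bar> \<le> Q" "Q < 1 * d" for X Q d :: real using that by linarith
  have "K * (t - s)\<^sup>2 < 1 * (t - s)"
    using assms mult_strict_right_mono[OF assms(2), of "t - s"] by (simp add: power2_eq_square mult.assoc)
  then show ?thesis by (rule aux[OF c_dot])
qed

lemma c_dot_neg:
  assumes "t < s" "K * (s - t) < 1"
  shows "(c t - c s) \<bullet> c1 s < 0"
proof -
  have aux: "X < 0" if "\<bar>X - d\<bar> \<le> Q" "Q < - d" for X Q d :: real using that by linarith
  have "K * (t - s)\<^sup>2 < - (t - s)"
    using assms mult_strict_right_mono[OF assms(2), of "s - t"]
    by (simp add: power2_eq_square mult.assoc algebra_simps)
  then show ?thesis by (rule aux[OF c_dot])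
qed

text \<open>For close parameters this follows from Taylor's formula. The remaining pairs, shifted so
  that one parameter lies in \<open>{0..L}\<close>, form a compact set on which the distance is
  positive: parameters at most \<open>L / 2\<close> apart give the same point only if they are
  equal.\<close>

lemma bi_lipschitz:
  obtains m where "0 < m" "m \<le> 1" "\<And>s t. \<bar>t - s\<bar> \<le> L / 2 \<Longrightarrow> m * \<bar>t - s\<bar> \<le> norm (c t - c s)"
proof -
  define A where "A = {z::real \<times> real. fst z \<in> {0..L} \<and> snd z - fst z \<in> {-(L/2)..L/2} \<and> 1 / (2 * K) \<le> \<bar>snd z - fst z\<bar>}"
  have near: "1 / 2 * \<bar>t - s\<bar> \<le> norm (c t - c s)" if "\<bar>t - s\<bar> < 1 / (2 * K)" for s t
  proof -
    have "K * \<bar>t - s\<bar> \<le> 1 / 2" using that K1 by (simp add: field_simps)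
    then have "K * \<bar>t - s\<bar> * \<bar>t - s\<bar> \<le> 1 / 2 * \<bar>t - s\<bar>" by (intro mult_right_mono) auto
    then have "K * (t - s)\<^sup>2 \<le> 1 / 2 * \<bar>t - s\<bar>"
      by (simp add: power2_eq_square mult.assoc flip: abs_mult)
    moreover have "\<bar>t - s\<bar> = norm ((t - s) *\<^sub>R c1 s)" using unit by simp
    moreover have "norm ((t - s) *\<^sub>R c1 s) \<le> norm (c t - c s) + norm (c t - c s - (t - s) *\<^sub>R c1 s)"
      by (metis norm_minus_commute norm_triangle_sub add.commute)
    moreover have "1 / 2 * a \<le> x" if "Q \<le> 1 / 2 * a" "a = b" "b \<le> x + y" "y \<le> Q" for a b x y Q :: real
      using that by linarith
    ultimately show ?thesis using c_taylor[of t s] by blast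
  qed
  have "\<exists>\<mu>>0. \<forall>z\<in>A. \<mu> \<le> norm (c (snd z) - c (fst z))"
  proof (cases "A = {}")
    case False
    have "closed A" unfolding A_def by (intro closed_Collect_conj closed_Collect_le continuous_intros closed_vimage_snd)
        (auto simp: atLeastAtMost_def intro!: closed_Collect_conj closed_Collect_le continuous_intros)
    moreover have "bounded A"
    proof (rule bounded_subset)
      show "A \<subseteq> {0..L} \<times> {-L..2*L}" unfolding A_def by auto
    qed (intro bounded_Times; simp)
    ultimately have "compact A" by (simp add: compact_eq_bounded_closed)
    moreover have "continuous_on A (\<lambda>z. norm (c (snd z) - c (fst z)))"
      by (intro continuous_intros continuous_on_compose2[OF c_continuous]) auto
    ultimately obtain z0 where z0: "z0 \<in> A" "\<forall>z\<in>A. norm (c (snd z0) - c (fst z0)) \<le> norm (c (snd z) - c (fst z))"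
      using continuous_attains_inf[OF _ False] by blast
    have "c (snd z0) \<noteq> c (fst z0)"
    proof
      assume "c (snd z0) = c (fst z0)"
      then obtain n :: int where n: "snd z0 = fst z0 + of_int n * L" using c_eq_iff by blast
      have "0 < 1 / (2 * K)" using K1 by simp
      then have "\<bar>of_int n * L\<bar> \<le> L / 2" "0 < \<bar>of_int n * L\<bar>" using z0(1) n by (auto simp: A_def)
      then have "\<bar>real_of_int n\<bar> * L \<le> (1 / 2) * L" "n \<noteq> 0" using L by (auto simp: abs_mult)
      then have "\<bar>real_of_int n\<bar> \<le> 1 / 2" using L by (simp only: mult_le_cancel_right)
      then show False using \<open>n \<noteq> 0\<close> by linarith
    qed
    then show ?thesis using z0(2) by (intro exI[of _ "norm (c (snd z0) - c (fst z0))"]) auto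
  qed (auto intro: exI[of _ 1])
  then obtain \<mu> where \<mu>: "\<mu> > 0" "\<And>z. z \<in> A \<Longrightarrow> \<mu> \<le> norm (c (snd z) - c (fst z))" by blast
  show thesis
  proof (rule that[of "min (1 / 2) (\<mu> / L)"])
    show "0 < min (1 / 2) (\<mu> / L)" "min (1 / 2) (\<mu> / L) \<le> 1" using \<mu> L by auto
    fix s t assume st: "\<bar>t - s\<bar> \<le> L / 2"
    show "min (1 / 2) (\<mu> / L) * \<bar>t - s\<bar> \<le> norm (c t - c s)"
    proof (cases "\<bar>t - s\<bar> < 1 / (2 * K)")
      case True
      have "min (1 / 2) (\<mu> / L) * \<bar>t - s\<bar> \<le> 1 / 2 * \<bar>t - s\<bar>"
        by (rule mult_right_mono[OF min.cobounded1 abs_ge_zero])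
      then show ?thesis using near[OF True] by linarith
    next
      case False
      obtain n :: int where n: "s + of_int n * L \<in> {0..<0 + L}" by (rule period_representative[OF L])
      have "t - s \<in> {- (L / 2)..L / 2}" using abs_le_D1[OF st] abs_le_D2[OF st] by simp
      then have "(s + of_int n * L, t + of_int n * L) \<in> A" using n False by (simp add: A_def)
      from \<mu>(2)[OF this] have "\<mu> \<le> norm (c t - c s)" using periodic_int_shift[of c L, OF per] by simp
      moreover have "min (1 / 2) (\<mu> / L) * \<bar>t - s\<bar> \<le> \<mu> / L * L"
        using st \<mu> L by (intro mult_mono) auto
      ultimately show ?thesis using L by simp
    qed
  qed
qed

abbreviation foot :: "point \<Rightarrow> point" where "foot \<equiv> closest_point \<Gamma>"

lemma foot_in: "foot x \<in> \<Gamma>"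
  using closest_point_in_set[OF curve_closed_nonempty] .

lemma foot_le: "dist x (foot x) \<le> dist x (c t)"
  using closest_point_le[OF curve_closed_nonempty(1) c_in] .

lemma foot_orthogonal:
  assumes "foot x = c \<theta>"
  shows "(x - c \<theta>) \<bullet> c1 \<theta> = 0"
proof -
  define f where "f = (\<lambda>t. (x - c t) \<bullet> (x - c t))"
  have "(f has_real_derivative (x - c \<theta>) \<bullet> (- c1 \<theta>) + (- c1 \<theta>) \<bullet> (x - c \<theta>)) (at \<theta>)"
  proof -
    have d: "((\<lambda>t. x - c t) has_derivative (\<lambda>h. - (h *\<^sub>R c1 \<theta>))) (at \<theta>)"
      using c1[of \<theta>] by (auto simp: has_vector_derivative_def intro!: derivative_eq_intros)
    show ?thesis
      unfolding has_field_derivative_def f_def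
      by (rule has_derivative_eq_rhs[OF has_derivative_inner[OF d d]]) (auto simp: inner_simps algebra_simps)
  qed
  moreover have "f \<theta> \<le> f t" for t
    using foot_le[of x t] assms by (simp add: f_def dot_square_norm dist_norm)
  ultimately have "(x - c \<theta>) \<bullet> (- c1 \<theta>) + (- c1 \<theta>) \<bullet> (x - c \<theta>) = 0"
    by (intro DERIV_local_min[of f _ \<theta> 1]) simp_all
  then have "- ((x - c \<theta>) \<bullet> c1 \<theta>) + - ((x - c \<theta>) \<bullet> c1 \<theta>) = 0"
    by (simp only: inner_minus_left inner_minus_right inner_commute[of "c1 \<theta>"])
  then show ?thesis by linarith
qed

end

context unit_speed_closed_curve
begin

lemma near_representative:
  assumes "y \<in> \<Gamma>"
  obtains t where "c t = y" "\<bar>t - s\<bar> \<le> L / 2"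
proof -
  obtain t where t: "c t = y" "t \<in> {s - L / 2..<s - L / 2 + L}" using representative[OF assms] by blast
  have "\<bar>t - s\<bar> \<le> L / 2" using t(2) by (intro abs_leI) auto
  with t(1) show thesis by (rule that)
qed

end

section \<open>Closest points in a tube around the curve\<close>

locale bi_lipschitz_curve = unit_speed_closed_curve +
  fixes m :: real
  assumes m: "0 < m" "m \<le> 1" and bi: "\<And>s t. \<bar>t - s\<bar> \<le> L / 2 \<Longrightarrow> m * \<bar>t - s\<bar> \<le> norm (c t - c s)"
begin

text \<open>\<open>x - foot x\<close> is normal to the curve, so only the quadratic Taylor remainder
  of \<open>y - foot x\<close> contributes. The tube radius \<open>m\<^sup>2 / (4 * K)\<close> is
  chosen to cancel the \<open>K\<close> of the remainder and the \<open>m\<^sup>2\<close> of the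
  bi-Lipschitz bound, leaving 1/4.\<close>

lemma foot_inner_le:
  assumes x: "norm (x - foot x) \<le> m\<^sup>2 / (4 * K)" and y: "y \<in> \<Gamma>"
  shows "(x - foot x) \<bullet> (y - foot x) \<le> (norm (y - foot x))\<^sup>2 / 4"
proof -
  obtain s where s: "c s = foot x" using representative[OF foot_in] by metis
  obtain t where t: "c t = y" "\<bar>t - s\<bar> \<le> L / 2" by (rule near_representative[OF y])
  have orth: "(x - foot x) \<bullet> c1 s = 0" using foot_orthogonal[of x s] s by simp
  have ms: "m\<^sup>2 * (t - s)\<^sup>2 \<le> (norm (y - foot x))\<^sup>2"
    using power_mono[OF bi[OF t(2)], of 2] m by (simp add: power_mult_distrib t s)
  have "(x - foot x) \<bullet> (y - foot x) = (x - foot x) \<bullet> (c t - c s - (t - s) *\<^sub>R c1 s)"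
    using orth by (simp add: t s inner_diff_right)
  also have "\<dots> \<le> norm (x - foot x) * norm (c t - c s - (t - s) *\<^sub>R c1 s)" by (rule norm_cauchy_schwarz)
  also have "\<dots> \<le> m\<^sup>2 / (4 * K) * (K * (t - s)\<^sup>2)"
    using x c_taylor[of t s] K1 by (intro mult_mono) auto
  also have "\<dots> = m\<^sup>2 * (t - s)\<^sup>2 / 4" using K1 by simp
  also have "\<dots> \<le> (norm (y - foot x))\<^sup>2 / 4" using ms by simp
  finally show ?thesis .
qed

text \<open>The square of \<open>d\<close> is expanded through \<open>x - x'\<close> and the two
  normal parts. By \<open>foot_inner_le\<close> the normal parts take up at most half of it, and the
  rest is at most the product of the norms of \<open>x - x'\<close> and \<open>d\<close>.\<close>

lemma foot_lipschitz:
  assumes x: "norm (x - foot x) \<le> m\<^sup>2 / (4 * K)" and x': "norm (x' - foot x') \<le> m\<^sup>2 / (4 * K)"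
  shows "norm (foot x - foot x') \<le> 2 * norm (x - x')"
proof -
  define d where "d = foot x - foot x'"
  have 1: "- ((x - foot x) \<bullet> d) \<le> (norm d)\<^sup>2 / 4"
    using foot_inner_le[OF x foot_in[of x']]
    by (simp add: d_def norm_minus_commute inner_diff_right)
  have 2: "(x' - foot x') \<bullet> d \<le> (norm d)\<^sup>2 / 4"
    using foot_inner_le[OF x' foot_in[of x]] by (simp add: d_def)
  have "d \<bullet> d = (x - x') \<bullet> d - (x - foot x) \<bullet> d + (x' - foot x') \<bullet> d"
    by (simp add: d_def inner_diff_left)
  then have "(norm d)\<^sup>2 \<le> (x - x') \<bullet> d + (norm d)\<^sup>2 / 2"
    using 1 2 by (simp add: power2_norm_eq_inner)
  moreover have "(x - x') \<bullet> d \<le> norm (x - x') * norm d" by (rule norm_cauchy_schwarz)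
  ultimately have "norm d * norm d \<le> (2 * norm (x - x')) * norm d" by (simp add: power2_eq_square)
  then have "norm d \<le> 2 * norm (x - x')"
    by (cases "norm d = 0") (auto simp: mult_le_cancel_right)
  then show ?thesis by (simp add: d_def)
qed

text \<open>A short chord projects injectively into its arc: the chord direction has positive inner product
  with every tangent of the arc.\<close>

lemma foot_on_chord:
  assumes ab: "\<alpha> \<le> \<beta>" and small: "K * ((2 / m + 2) * (\<beta> - \<alpha>)) < 1" "2 * (\<beta> - \<alpha>) \<le> m * (L / 2)"
  shows "foot ` closed_segment (c \<alpha>) (c \<beta>) \<subseteq> c ` {\<alpha>..\<beta>}"
    and "inj_on foot (closed_segment (c \<alpha>) (c \<beta>))"
proof -
  have Kle: "K * x < 1" if "x \<le> (2 / m + 2) * (\<beta> - \<alpha>)" for x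
    using small(1) mult_left_mono[OF that, of K] K1 by linarith
  have arc: "\<exists>\<theta>\<in>{\<alpha>..\<beta>}. foot x = c \<theta>" if x: "x \<in> closed_segment (c \<alpha>) (c \<beta>)" for x
  proof -
    obtain l where l: "0 \<le> l" "l \<le> 1" "x = (1 - l) *\<^sub>R c \<alpha> + l *\<^sub>R c \<beta>"
      using x by (auto simp: in_segment)
    obtain \<theta> where \<theta>: "c \<theta> = foot x" "\<bar>\<theta> - \<alpha>\<bar> \<le> L / 2" by (rule near_representative[OF foot_in])
    have xa: "norm (x - c \<alpha>) \<le> \<beta> - \<alpha>"
    proof -
      have "x - c \<alpha> = l *\<^sub>R (c \<beta> - c \<alpha>)" by (simp add: l algebra_simps)
      then have "norm (x - c \<alpha>) = l * norm (c \<beta> - c \<alpha>)" using l by simp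
      also have "\<dots> \<le> 1 * norm (c \<beta> - c \<alpha>)" using l by (intro mult_right_mono) auto
      also have "\<dots> \<le> \<beta> - \<alpha>" using c_lipschitz[of \<beta> \<alpha>] ab by simp
      finally show ?thesis .
    qed
    have xf: "norm (x - foot x) \<le> norm (x - c \<alpha>)" using foot_le[of x \<alpha>] by (simp add: dist_norm)
    note bi[OF \<theta>(2)]
    also have "norm (c \<theta> - c \<alpha>) \<le> norm (x - c \<alpha>) + norm (x - foot x)"
      using norm_triangle_ineq4[of "x - c \<alpha>" "x - foot x"] \<theta> by simp
    also have "\<dots> \<le> 2 * (\<beta> - \<alpha>)" using xa xf by simp
    finally have "m * \<bar>\<theta> - \<alpha>\<bar> \<le> 2 * (\<beta> - \<alpha>)" .
    then have near: "\<bar>\<theta> - \<alpha>\<bar> \<le> 2 / m * (\<beta> - \<alpha>)" using m by (simp add: field_simps)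
    \<comment> \<open>\<open>2 / m\<close> is the bound just found for the distance of
      \<open>\<theta>\<close> from \<open>\<alpha>\<close>; the additional 2 leaves room to measure
      from \<open>\<beta>\<close> as well.\<close>
    define R where "R = (2 / m + 2) * (\<beta> - \<alpha>)"
    have "R = 2 / m * (\<beta> - \<alpha>) + 2 * (\<beta> - \<alpha>)" by (simp add: R_def algebra_simps)
    then have "\<bar>\<theta> - \<alpha>\<bar> \<le> R - 2 * (\<beta> - \<alpha>)" using near by simp
    then have nr: "\<bar>\<theta> - \<alpha>\<bar> \<le> R - 2 * \<beta> + 2 * \<alpha>" by (simp add: algebra_simps)
    have R: "\<alpha> - \<theta> \<le> R" "\<beta> - \<theta> \<le> R" "\<theta> - \<alpha> \<le> R" "\<theta> - \<beta> \<le> R"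
      using abs_le_D1[OF nr] abs_le_D2[OF nr] ab by linarith+
    note KR = Kle[folded R_def]
    have orth: "(1 - l) * ((c \<alpha> - c \<theta>) \<bullet> c1 \<theta>) + l * ((c \<beta> - c \<theta>) \<bullet> c1 \<theta>) = 0"
    proof -
      have "(x - c \<theta>) \<bullet> c1 \<theta> = 0" using foot_orthogonal \<theta>(1) by metis
      moreover have "x - c \<theta> = (1 - l) *\<^sub>R (c \<alpha> - c \<theta>) + l *\<^sub>R (c \<beta> - c \<theta>)" by (simp add: l algebra_simps)
      ultimately show ?thesis by (simp add: inner_add_left)
    qed
    have pos: "0 < (1 - l) * u + l * v" if "0 < u" "0 < v" for u v
    proof (cases "l = 1")
      case False
      then have "0 < (1 - l) * u" "0 \<le> l * v" using l that by auto
      then show ?thesis by (rule add_pos_nonneg)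
    qed (use that in simp)
    \<comment> \<open>If \<open>\<theta>\<close> were outside the arc, both end points would lie
      strictly on the same side of the normal line at \<open>c \<theta>\<close>, and so would their
      convex combination \<open>x\<close>, against \<open>orth\<close>.\<close>
    have "\<alpha> \<le> \<theta>"
    proof (rule ccontr)
      assume "\<not> \<alpha> \<le> \<theta>"
      then have lt: "\<theta> < \<alpha>" "\<theta> < \<beta>" using ab by auto
      have a: "0 < (c \<alpha> - c \<theta>) \<bullet> c1 \<theta>" "0 < (c \<beta> - c \<theta>) \<bullet> c1 \<theta>"
        by (rule c_dot_pos[OF lt(1) KR[OF R(1)]], rule c_dot_pos[OF lt(2) KR[OF R(2)]])
      have "0 < (1 - l) * ((c \<alpha> - c \<theta>) \<bullet> c1 \<theta>) + l * ((c \<beta> - c \<theta>) \<bullet> c1 \<theta>)"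
        by (rule pos[OF a])
      then show False using orth by simp
    qed
    moreover have "\<theta> \<le> \<beta>"
    proof (rule ccontr)
      assume "\<not> \<theta> \<le> \<beta>"
      then have lt: "\<alpha> < \<theta>" "\<beta> < \<theta>" using ab by auto
      have a: "0 < - ((c \<alpha> - c \<theta>) \<bullet> c1 \<theta>)" "0 < - ((c \<beta> - c \<theta>) \<bullet> c1 \<theta>)"
        using c_dot_neg[OF lt(1) KR[OF R(3)]] c_dot_neg[OF lt(2) KR[OF R(4)]] by simp_all
      have "0 < (1 - l) * - ((c \<alpha> - c \<theta>) \<bullet> c1 \<theta>) + l * - ((c \<beta> - c \<theta>) \<bullet> c1 \<theta>)"
        by (rule pos[OF a])
      then show False using orth by simp
    qed
    ultimately show ?thesis using \<theta>(1) by (intro bexI[of _ \<theta>]) auto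
  qed
  then show "foot ` closed_segment (c \<alpha>) (c \<beta>) \<subseteq> c ` {\<alpha>..\<beta>}" by blast
  show "inj_on foot (closed_segment (c \<alpha>) (c \<beta>))"
  proof (rule inj_onI)
    fix x x' assume x: "x \<in> closed_segment (c \<alpha>) (c \<beta>)" and x': "x' \<in> closed_segment (c \<alpha>) (c \<beta>)"
      and eq: "foot x = foot x'"
    obtain \<theta> where \<theta>: "\<alpha> \<le> \<theta>" "\<theta> \<le> \<beta>" "foot x = c \<theta>" using arc[OF x] by auto
    obtain l where l: "x = (1 - l) *\<^sub>R c \<alpha> + l *\<^sub>R c \<beta>" using x by (auto simp: in_segment)
    obtain l' where l': "x' = (1 - l') *\<^sub>R c \<alpha> + l' *\<^sub>R c \<beta>" using x' by (auto simp: in_segment)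
    have "(x - c \<theta>) \<bullet> c1 \<theta> = 0" "(x' - c \<theta>) \<bullet> c1 \<theta> = 0"
      using foot_orthogonal[of x \<theta>] foot_orthogonal[of x' \<theta>] \<theta>(3) eq by auto
    then have "(x - x') \<bullet> c1 \<theta> = 0" by (simp add: inner_diff_left)
    moreover have "x - x' = (l - l') *\<^sub>R (c \<beta> - c \<alpha>)" by (simp add: l l' algebra_simps)
    ultimately have z: "(l - l') * ((c \<beta> - c \<alpha>) \<bullet> c1 \<theta>) = 0" by simp
    show "x = x'"
    proof (cases "\<alpha> = \<beta>")
      case False
      then have lt: "\<alpha> < \<beta>" using ab by simp
      have K0: "\<beta> - \<alpha> \<le> (2 / m + 2) * (\<beta> - \<alpha>)"
        using mult_right_mono[of 1 "2 / m + 2" "\<beta> - \<alpha>"] m ab by simp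
      have p: "0 < (c \<beta> - c \<theta>) \<bullet> c1 \<theta>" if "\<theta> < \<beta>"
        by (rule c_dot_pos[OF that Kle]) (rule order_trans[OF _ K0], use \<theta> in simp)
      have n: "(c \<alpha> - c \<theta>) \<bullet> c1 \<theta> < 0" if "\<alpha> < \<theta>"
        by (rule c_dot_neg[OF that Kle]) (rule order_trans[OF _ K0], use \<theta> in simp)
      have "(c \<beta> - c \<alpha>) \<bullet> c1 \<theta> = (c \<beta> - c \<theta>) \<bullet> c1 \<theta> - (c \<alpha> - c \<theta>) \<bullet> c1 \<theta>"
        by (simp add: inner_diff_left)
      also have "\<dots> > 0"
      proof (cases "\<theta> = \<alpha>")
        case True
        then show ?thesis using p lt by simp
      next
        case 1: False
        then show ?thesis using p n \<theta> by (cases "\<theta> = \<beta>") auto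
      qed
      finally have "l = l'" using z by simp
      then show ?thesis by (simp add: l l')
    qed (use x x' in simp)
  qed
qed

end

section \<open>Cells of the mesh\<close>

lemma mem_cell_iff:
  "x \<in> cell h a k \<longleftrightarrow>
     fst a + h * of_int (fst k) \<le> fst x \<and> fst x \<le> fst a + h * (of_int (fst k) + 1) \<and>
     snd a + h * of_int (snd k) \<le> snd x \<and> snd x \<le> snd a + h * (of_int (snd k) + 1)"
  by (auto simp: cell_def vertex_def mem_box Basis_prod_def inner_prod_def)

lemma interior_cellI:
  assumes "fst a + h * of_int (fst k) < fst x" "fst x < fst a + h * (of_int (fst k) + 1)"
    "snd a + h * of_int (snd k) < snd x" "snd x < snd a + h * (of_int (snd k) + 1)"
  shows "x \<in> interior (cell h a k)"
proof (rule interiorI)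
  show "open ({x. fst a + h * of_int (fst k) < fst x} \<inter> {x. fst x < fst a + h * (of_int (fst k) + 1)} \<inter>
      ({x. snd a + h * of_int (snd k) < snd x} \<inter> {x. snd x < snd a + h * (of_int (snd k) + 1)}))"
    by (intro open_Int open_Collect_less continuous_intros)
qed (use assms in \<open>auto simp: mem_cell_iff\<close>)

lemma frontier_cell_cases:
  assumes "x \<in> frontier (cell h a k)"
  obtains "x \<in> cell h a k" "fst x = fst a + h * of_int (fst k)"
    | "x \<in> cell h a k" "fst x = fst a + h * (of_int (fst k) + 1)"
    | "x \<in> cell h a k" "snd x = snd a + h * of_int (snd k)"
    | "x \<in> cell h a k" "snd x = snd a + h * (of_int (snd k) + 1)"
proof -
  have "closed (cell h a k)" by (simp add: cell_def closed_cbox)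
  then have x: "x \<in> cell h a k" "x \<notin> interior (cell h a k)"
    using assms by (auto simp: frontier_def)
  then show thesis using that x interior_cellI[of a h k x] unfolding mem_cell_iff by force
qed

lemma interior_cell_unique:
  assumes h: "0 < h" and x: "x \<in> cell h a k" "x \<in> cell h a k'" "x \<notin> frontier (cell h a k)"
  shows "k' = k"
proof -
  have "x \<in> interior (cell h a k)"
    using x closure_subset[of "cell h a k"] by (auto simp: frontier_def)
  then have i: "x \<in> box (vertex h a k) (vertex h a (k + (1, 1)))"
    by (simp add: cell_def)
  then have "fst a + h * of_int (fst k) < fst x \<and> fst x < fst a + h * (of_int (fst k) + 1) \<and>
     snd a + h * of_int (snd k) < snd x \<and> snd x < snd a + h * (of_int (snd k) + 1)"
    by (auto simp: mem_box Basis_prod_def vertex_def inner_prod_def)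
  then have "h * of_int (fst k) < h * (of_int (fst k') + 1)" "h * of_int (fst k') < h * (of_int (fst k) + 1)"
    "h * of_int (snd k) < h * (of_int (snd k') + 1)" "h * of_int (snd k') < h * (of_int (snd k) + 1)"
    using x(2) unfolding mem_cell_iff by linarith+
  then have "real_of_int (fst k) < of_int (fst k') + 1" "real_of_int (fst k') < of_int (fst k) + 1"
    "real_of_int (snd k) < of_int (snd k') + 1" "real_of_int (snd k') < of_int (snd k) + 1"
    using h by auto
  then have "fst k = fst k'" "snd k = snd k'" by linarith+
  then show ?thesis by (simp add: prod_eq_iff)
qed

lemma cell_diameter:
  assumes h: "0 < h" and "x \<in> cell h a k" "y \<in> cell h a k"
  shows "norm (x - y) \<le> 2 * h"
proof -
  have "\<bar>fst x - fst y\<bar> \<le> h" "\<bar>snd x - snd y\<bar> \<le> h"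
    using assms(2,3) unfolding mem_cell_iff by (auto simp: distrib_left abs_le_iff)
  then show ?thesis
    using norm_Pair_le[of "fst x - fst y" "snd x - snd y"] by (simp flip: minus_prod_def) 
qed

section \<open>The closest-point projection of the discrete surface\<close>

context unit_speed_closed_curve
begin

lemma DERIV_fst_c: "((\<lambda>t. fst (c t)) has_real_derivative fst (c1 t)) (at t)"
  using bounded_linear.has_vector_derivative[OF bounded_linear_fst c1[of t]]
  by (simp add: has_real_derivative_iff_has_vector_derivative)

lemma DERIV_snd_c: "((\<lambda>t. snd (c t)) has_real_derivative snd (c1 t)) (at t)"
  using bounded_linear.has_vector_derivative[OF bounded_linear_snd c1[of t]]
  by (simp add: has_real_derivative_iff_has_vector_derivative)

lemma vector_derivative_c: "vector_derivative c (at t) = c1 t"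
  using c1 by (rule vector_derivative_at)

text \<open>Transversality forces the curve to leave the cell wherever it meets the boundary of the cell,
  so only the endpoints of the arc inside the cell can be crossings.\<close>

lemma frontier_cell_endpoint:
  assumes tr: "transverse_to_mesh h a c" and cell: "\<And>s. s \<in> {\<alpha>..\<beta>} \<Longrightarrow> c s \<in> cell h a k"
    and t: "t \<in> {\<alpha>..\<beta>}" "c t \<in> frontier (cell h a k)"
  shows "t = \<alpha> \<or> t = \<beta>"
proof (rule ccontr)
  assume "\<not> (t = \<alpha> \<or> t = \<beta>)"
  then have st: "\<alpha> < t" "t < \<beta>" using t(1) by auto
  define d where "d = min (t - \<alpha>) (\<beta> - t)"
  have d: "d > 0" using st by (simp add: d_def)
  have near: "c s \<in> cell h a k" if "\<bar>t - s\<bar> < d" for s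
  proof (rule cell)
    have "\<bar>t - s\<bar> < t - \<alpha>" "\<bar>t - s\<bar> < \<beta> - t" using that by (auto simp: d_def)
    then show "s \<in> {\<alpha>..\<beta>}" by (simp add: abs_less_iff)
  qed
  have trf: "fst (c1 t) \<noteq> 0" if "fst (c t) = fst a + h * of_int j" for j
  proof -
    have "fst (c t) = fst (vertex h a (j, 0))" using that by (simp add: vertex_def)
    then show ?thesis using tr unfolding transverse_to_mesh_def vector_derivative_c by blast
  qed
  have trs: "snd (c1 t) \<noteq> 0" if "snd (c t) = snd a + h * of_int j" for j
  proof -
    have "snd (c t) = snd (vertex h a (0, j))" using that by (simp add: vertex_def)
    then show ?thesis using tr unfolding transverse_to_mesh_def vector_derivative_c by blast
  qed
  from t(2) show False
  proof (cases rule: frontier_cell_cases)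
    case 1
    have "fst (c1 t) = 0"
      using near unfolding mem_cell_iff 1(2)[symmetric] by (intro DERIV_local_min[OF DERIV_fst_c d]) blast
    then show False using trf[OF 1(2)] by simp
  next
    case 2
    have "fst (c1 t) = 0"
      using near unfolding mem_cell_iff 2(2)[symmetric] by (intro DERIV_local_max[OF DERIV_fst_c d]) blast
    then show False using trf[of "fst k + 1"] 2(2) by simp
  next
    case 3
    have "snd (c1 t) = 0"
      using near unfolding mem_cell_iff 3(2)[symmetric] by (intro DERIV_local_min[OF DERIV_snd_c d]) blast
    then show False using trs[OF 3(2)] by simp
  next
    case 4
    have "snd (c1 t) = 0"
      using near unfolding mem_cell_iff 4(2)[symmetric] by (intro DERIV_local_max[OF DERIV_snd_c d]) blast
    then show False using trs[of "snd k + 1"] 4(2) by simp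
  qed
qed

end

context bi_lipschitz_curve
begin

text \<open>On the set \<open>A\<close> of parameters near \<open>t0\<close> that belong to the
  cell, \<open>c\<close> is injective, since they span at most half a period. Being a homeomorphism
  of the compact set \<open>A\<close> onto the connected part of the curve in the cell, it shows
  that \<open>A\<close> is an interval.\<close>

lemma cell_arc:
  assumes h: "0 < h" "8 * h < m * L" and \<psi>: "{x. \<psi> x = 0} = \<Gamma>" and k: "k \<in> active h a \<psi>"
    and tr: "transverse_to_mesh h a c" and conn: "connected (cell h a k \<inter> {x. \<psi> x = 0})"
  obtains \<alpha> \<beta> where "\<alpha> \<le> \<beta>" "\<beta> - \<alpha> \<le> 4 * h / m" "cell h a k \<inter> \<Gamma> = c ` {\<alpha>..\<beta>}"
    "crossings h a \<psi> k \<subseteq> {c \<alpha>, c \<beta>}"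
proof -
  obtain x0 where x0: "x0 \<in> cell h a k" "x0 \<in> \<Gamma>" using k \<psi> unfolding active_def by blast
  obtain t0 where t0: "c t0 = x0" using representative[OF x0(2)] by metis
  have close: "\<bar>t - t0\<bar> \<le> 2 * h / m" if "\<bar>t - t0\<bar> \<le> L / 2" "c t \<in> cell h a k" for t
  proof -
    have "m * \<bar>t - t0\<bar> \<le> 2 * h"
      using bi[OF that(1)] cell_diameter[OF h(1) that(2) x0(1)] t0 by simp
    then show ?thesis using m by (simp add: field_simps)
  qed
  \<comment> \<open>Points of a cell are at most \<open>2 * h\<close> apart, so
    \<open>8 * h < m * L\<close> places the parameters strictly inside the window of radius
    \<open>L / 4\<close>, and cutting with that window loses no point of the curve in the
    cell.\<close>
  have hm: "2 * h / m < L / 4" using h m by (simp add: field_simps)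
  define I where "I = {t0 - L / 4..t0 + L / 4}"
  define A where "A = I \<inter> c -` cell h a k"
  have A_iff: "t \<in> A \<longleftrightarrow> \<bar>t - t0\<bar> \<le> L / 4 \<and> c t \<in> cell h a k" for t
    unfolding A_def I_def Int_iff vimage_eq atLeastAtMost_iff abs_le_iff by (safe; linarith)
  have img: "c ` A = cell h a k \<inter> \<Gamma>"
  proof (rule equalityI)
    show "c ` A \<subseteq> cell h a k \<inter> \<Gamma>" using c_in by (auto simp: A_iff)
    show "cell h a k \<inter> \<Gamma> \<subseteq> c ` A"
    proof
      fix y assume y: "y \<in> cell h a k \<inter> \<Gamma>"
      then obtain t where t: "c t = y" "\<bar>t - t0\<bar> \<le> L / 2" using near_representative[of y t0] by blast
      have "\<bar>t - t0\<bar> \<le> L / 4" using close[OF t(2)] y t(1) hm by simp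
      then have "t \<in> A" using y t(1) by (simp add: A_iff)
      then show "y \<in> c ` A" using t(1) by blast
    qed
  qed
  have injA: "inj_on c A"
  proof (rule inj_onI)
    fix s t assume st: "s \<in> A" "t \<in> A" "c s = c t"
    have "\<bar>t - s\<bar> \<le> \<bar>t - t0\<bar> + \<bar>s - t0\<bar>" by linarith
    then have "\<bar>t - s\<bar> \<le> L / 2" using st(1,2) unfolding A_iff by linarith
    then have "m * \<bar>t - s\<bar> \<le> 0" using bi st(3) by fastforce
    then show "s = t" using m by (simp add: mult_le_0_iff)
  qed
  have clA: "closed (c -` cell h a k)"
    by (rule closed_vimage) (simp_all add: cell_def closed_cbox c_continuous)
  have cptA: "compact A" unfolding A_def I_def by (rule compact_Int_closed[OF compact_Icc clA])
  have "continuous_on (c ` A) (the_inv_into A c)"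
    by (rule continuous_on_inv[OF c_continuous cptA]) (simp add: the_inv_into_f_f[OF injA])
  moreover have "connected (c ` A)" using conn unfolding img \<psi> .
  ultimately have "connected (the_inv_into A c ` (c ` A))" by (rule connected_continuous_image)
  moreover have "the_inv_into A c ` (c ` A) = A" using the_inv_into_onto[OF injA] .
  ultimately have "connected A" by simp
  then obtain \<alpha> \<beta> where A: "A = {\<alpha>..\<beta>}" using cptA connected_compact_interval_1 by blast
  have t0A: "t0 \<in> A" using x0 t0 L by (simp add: A_iff)
  then have ab: "\<alpha> \<le> \<beta>" unfolding A by simp
  show thesis
  proof (rule that[OF ab])
    have "\<alpha> \<in> A" "\<beta> \<in> A" unfolding A using ab by auto
    then have "\<bar>\<alpha> - t0\<bar> \<le> 2 * h / m" "\<bar>\<beta> - t0\<bar> \<le> 2 * h / m"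
      using close L unfolding A_iff by auto
    moreover have "4 * h / m = 2 * h / m + 2 * h / m" by simp
    ultimately show "\<beta> - \<alpha> \<le> 4 * h / m" by linarith
    show "cell h a k \<inter> \<Gamma> = c ` {\<alpha>..\<beta>}" using img A by simp
    show "crossings h a \<psi> k \<subseteq> {c \<alpha>, c \<beta>}"
    proof
      fix x assume x: "x \<in> crossings h a \<psi> k"
      then have xf: "x \<in> frontier (cell h a k)" "x \<in> \<Gamma>" using \<psi> by (auto simp: crossings_def)
      have "closed (cell h a k)" by (simp add: cell_def closed_cbox)
      then have "x \<in> cell h a k" using xf(1) by (simp add: frontier_def)
      then obtain t where t: "t \<in> {\<alpha>..\<beta>}" "x = c t" using xf(2) img A by blast
      have "t = \<alpha> \<or> t = \<beta>"
      proof (rule frontier_cell_endpoint[OF tr _ t(1)])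
        show "c s \<in> cell h a k" if s: "s \<in> {\<alpha>..\<beta>}" for s
        proof -
          have "s \<in> A" unfolding A by (rule s)
          then show ?thesis unfolding A_iff by (rule conjunct2)
        qed
        show "c t \<in> frontier (cell h a k)" using xf(1) t(2) by simp
      qed
      then show "x \<in> {c \<alpha>, c \<beta>}" using t(2) by blast
    qed
  qed
qed

text \<open>The segment of a cell lies in the chord of its arc, because all crossings are end points
  of the arc. Feet of chord points stay on the arc, hence in the cell.\<close>

lemma foot_on_cell_segment:
  assumes h: "0 < h" "8 * h < m * L" "K * ((2 / m + 2) * (4 * h / m)) < 1" "16 * h < m\<^sup>2 * L"
    and \<psi>: "{x. \<psi> x = 0} = \<Gamma>" and k: "k \<in> active h a \<psi>" and g: "active_grid_geometry h a \<psi> c"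
  shows "foot ` cell_segment h a \<psi> k \<subseteq> cell h a k" and "inj_on foot (cell_segment h a \<psi> k)"
proof -
  have tr: "transverse_to_mesh h a c" and conn: "connected (cell h a k \<inter> {x. \<psi> x = 0})"
    using g k unfolding active_grid_geometry_def by blast+
  obtain \<alpha> \<beta> where ab: "\<alpha> \<le> \<beta>" "\<beta> - \<alpha> \<le> 4 * h / m" "cell h a k \<inter> \<Gamma> = c ` {\<alpha>..\<beta>}"
    "crossings h a \<psi> k \<subseteq> {c \<alpha>, c \<beta>}"
    by (rule cell_arc[OF h(1,2) \<psi> k tr conn])
  have "(2 / m + 2) * (\<beta> - \<alpha>) \<le> (2 / m + 2) * (4 * h / m)" using ab(2) m by (intro mult_left_mono) auto
  then have "K * ((2 / m + 2) * (\<beta> - \<alpha>)) \<le> K * ((2 / m + 2) * (4 * h / m))"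
    by (rule mult_left_mono) (use K1 in simp)
  then have small1: "K * ((2 / m + 2) * (\<beta> - \<alpha>)) < 1" using h(3) by linarith
  have "2 * (4 * h / m) \<le> m * (L / 2)" using h(4) m by (simp add: field_simps power2_eq_square)
  then have small2: "2 * (\<beta> - \<alpha>) \<le> m * (L / 2)" using ab(2) by simp
  have seg: "cell_segment h a \<psi> k \<subseteq> closed_segment (c \<alpha>) (c \<beta>)"
  proof -
    have "closed_segment x y \<subseteq> closed_segment (c \<alpha>) (c \<beta>)"
      if "x \<in> crossings h a \<psi> k" "y \<in> crossings h a \<psi> k" for x y
    proof -
      have "x \<in> closed_segment (c \<alpha>) (c \<beta>)" "y \<in> closed_segment (c \<alpha>) (c \<beta>)" using that ab(4) by auto
      then show ?thesis by (simp add: subset_closed_segment)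
    qed
    then show ?thesis unfolding cell_segment_def by blast
  qed
  show "foot ` cell_segment h a \<psi> k \<subseteq> cell h a k"
    using foot_on_chord(1)[OF ab(1) small1 small2] seg ab(3) by blast
  show "inj_on foot (cell_segment h a \<psi> k)"
    using foot_on_chord(2)[OF ab(1) small1 small2] seg by (rule inj_on_subset)
qed

text \<open>The new case is that of points in different cells with a common foot. The foot lies in
  both cells, so on both boundaries, and is a crossing. It therefore belongs to both segments, and
  it is its own foot; injectivity in each cell makes both points equal to it.\<close>

lemma foot_inj_on_discrete_surface:
  assumes h: "0 < h" "8 * h < m * L" "K * ((2 / m + 2) * (4 * h / m)) < 1" "16 * h < m\<^sup>2 * L"
    and \<psi>: "{x. \<psi> x = 0} = \<Gamma>" and g: "active_grid_geometry h a \<psi> c"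
  shows "inj_on foot (discrete_surface h a \<psi>)"
proof (rule inj_onI)
  fix w w' assume w: "w \<in> discrete_surface h a \<psi>" and w': "w' \<in> discrete_surface h a \<psi>"
    and eq: "foot w = foot w'"
  obtain k where k: "k \<in> active h a \<psi>" "w \<in> cell_segment h a \<psi> k"
    using w unfolding discrete_surface_def by blast
  obtain k' where k': "k' \<in> active h a \<psi>" "w' \<in> cell_segment h a \<psi> k'"
    using w' unfolding discrete_surface_def by blast
  note fk = foot_on_cell_segment[OF h \<psi> k(1) g]
  note fk' = foot_on_cell_segment[OF h \<psi> k'(1) g]
  have y: "foot w \<in> cell h a k" "foot w \<in> cell h a k'"
    using fk(1) k(2) fk'(1) k'(2) eq by auto
  have onG: "\<psi> (foot w) = 0" using foot_in[of w] \<psi> by blast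
  have ff: "foot (foot w) = foot w" by (rule closest_point_self[OF foot_in])
  show "w = w'"
  proof (cases "k = k'")
    case True
    then show ?thesis using inj_onD[OF fk(2) eq k(2)] k'(2) by blast
  next
    case False
    have f: "foot w \<in> frontier (cell h a k)" "foot w \<in> frontier (cell h a k')"
      using interior_cell_unique[OF h(1) y] interior_cell_unique[OF h(1) y(2) y(1)] False by blast+
    then have "foot w \<in> crossings h a \<psi> k" "foot w \<in> crossings h a \<psi> k'"
      using onG by (auto simp: crossings_def)
    then have s: "foot w \<in> cell_segment h a \<psi> k" "foot w \<in> cell_segment h a \<psi> k'"
      unfolding cell_segment_def by force+
    have "w = foot w" using inj_onD[OF fk(2) _ k(2) s(1)] ff by simp
    moreover have "w' = foot w" using inj_onD[OF fk'(2) _ k'(2) s(2)] ff eq by simp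
    ultimately show ?thesis by simp
  qed
qed

section \<open>Lifting the projection to the arclength parameter\<close>

lemma local_lipschitz_imp_lipschitz:
  fixes s :: "real \<Rightarrow> real"
  assumes M: "0 \<le> M" and loc: "\<And>t. \<exists>d>0. \<forall>t'. \<bar>t' - t\<bar> < d \<longrightarrow> \<bar>s t' - s t\<bar> \<le> M * \<bar>t' - t\<bar>"
  shows "M-lipschitz_on UNIV s"
proof -
  have main: "\<bar>s b - s a\<bar> \<le> M * (b - a)" if "a \<le> b" for a b
    using that
  proof (induction rule: Bolzano)
    case (trans a b c)
    then have "\<bar>s c - s a\<bar> \<le> M * (b - a) + M * (c - b)" by linarith
    then show ?case by (simp add: algebra_simps)
  next
    \<comment> \<open>Bisection asks only for short intervals that contain \<open>x\<close>, so the
      estimates against \<open>s x\<close> on its two sides add up.\<close>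
    case (local x)
    obtain d where d: "d > 0" "\<And>t'. \<bar>t' - x\<bar> < d \<Longrightarrow> \<bar>s t' - s x\<bar> \<le> M * \<bar>t' - x\<bar>" using loc[of x] by blast
    show ?case
    proof (intro exI conjI allI impI)
      fix u v assume uv: "u \<le> x \<and> x \<le> v \<and> v - u < d"
      then have e: "\<bar>u - x\<bar> = x - u" "\<bar>v - x\<bar> = v - x" "x - u < d" "v - x < d" by linarith+
      have "\<bar>s u - s x\<bar> \<le> M * (x - u)" "\<bar>s v - s x\<bar> \<le> M * (v - x)"
        using d(2)[of u] d(2)[of v] unfolding e(1,2) using e(3,4) by blast+
      then have "\<bar>s v - s u\<bar> \<le> M * (x - u) + M * (v - x)" by linarith
      then show "\<bar>s v - s u\<bar> \<le> M * (v - u)" by (simp add: algebra_simps)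
    qed (rule d(1))
  qed
  show ?thesis
  proof (rule lipschitz_onI)
    fix x y
    show "dist (s x) (s y) \<le> M * dist x y"
      using main[of x y] main[of y x] by (cases "x \<le> y") (auto simp: dist_real_def abs_minus_commute)
  qed fact
qed

text \<open>Composing with \<open>t \<mapsto> exp (2\<pi>it/L)\<close> turns the lifting problem for the covering \<open>c\<close> into the
  existence of a continuous logarithm.\<close>

lemma lift_to_parameter:
  fixes q :: "real \<Rightarrow> point"
  assumes q: "2-lipschitz_on UNIV q" and qin: "\<And>t. q t \<in> \<Gamma>"
  obtains s where "(2 / m)-lipschitz_on UNIV s" "\<And>t. c (s t) = q t"
proof -
  \<comment> \<open>\<open>\<tau>\<close> picks parameters without any continuity. \<open>W\<close>
    does not see the choice, because \<open>cis (2 * pi / L * x)\<close> has the period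
    \<open>L\<close> of \<open>c\<close>.\<close>
  have "\<exists>r. c r = q t" for t using representative[OF qin[of t], of 0] by blast
  then obtain \<tau> where \<tau>: "\<And>t. c (\<tau> t) = q t" by metis
  define W where "W t = cis (2 * pi / L * \<tau> t)" for t
  have cis_eq: "cis (2 * pi / L * (x + of_int n * L)) = cis (2 * pi / L * x)" for x and n :: int
  proof -
    have "2 * pi / L * (x + of_int n * L) = 2 * pi / L * x + 2 * pi * of_int n"
      using L by (simp add: field_simps)
    then have "cis (2 * pi / L * (x + of_int n * L)) = cis (2 * pi / L * x) * cis (2 * pi * of_int n)"
      by (simp only: cis_mult)
    then show ?thesis by (simp only: cis_multiple_2pi Ints_of_int mult_1_right)
  qed
  have cis_lip: "norm (cis x - cis y) \<le> \<bar>x - y\<bar>" for x y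
  proof -
    have "norm (cis x - cis y) \<le> 1 * norm (x - y)"
      by (intro differentiable_bound[where S=UNIV and f'="\<lambda>x h. h *\<^sub>R (\<i> * cis x)"] onorm_scaleR_le)
        (auto simp: norm_mult intro!: has_derivative_cis[OF has_derivative_ident])
    then show ?thesis by simp
  qed
  have Wlip: "norm (W t' - W t) \<le> 2 * pi / L * (2 / m) * \<bar>t' - t\<bar>" for t t'
  proof -
    \<comment> \<open>The parameter of \<open>q t'\<close> is chosen anew within half a period of
      \<open>\<tau> t\<close>, where the bi-Lipschitz bound applies; \<open>W t'\<close> stays the
      same.\<close>
    obtain \<theta> where \<theta>: "c \<theta> = q t'" "\<bar>\<theta> - \<tau> t\<bar> \<le> L / 2" by (rule near_representative[OF qin])
    obtain n :: int where "\<theta> = \<tau> t' + of_int n * L" using \<theta>(1) \<tau>[of t'] c_eq_iff by metis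
    then have "W t' = cis (2 * pi / L * \<theta>)" by (simp only: W_def cis_eq)
    then have "norm (W t' - W t) \<le> \<bar>2 * pi / L * \<theta> - 2 * pi / L * \<tau> t\<bar>" by (simp only: W_def cis_lip)
    also have "\<dots> = 2 * pi / L * \<bar>\<theta> - \<tau> t\<bar>"
      using L by (simp only: right_diff_distrib[symmetric] abs_mult) simp
    also have "\<dots> \<le> 2 * pi / L * (2 / m * \<bar>t' - t\<bar>)"
    proof (rule mult_left_mono)
      have "m * \<bar>\<theta> - \<tau> t\<bar> \<le> norm (q t' - q t)" using bi[OF \<theta>(2)] \<theta>(1) \<tau> by simp
      also have "\<dots> \<le> 2 * \<bar>t' - t\<bar>" using lipschitz_onD[OF q, of t' t] by (simp add: dist_norm)
      finally show "\<bar>\<theta> - \<tau> t\<bar> \<le> 2 / m * \<bar>t' - t\<bar>" using m by (simp add: field_simps)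
    qed (use L in simp)
    finally show ?thesis by (simp add: mult.assoc)
  qed
  have "(2 * pi / L * (2 / m))-lipschitz_on UNIV W"
    using Wlip L m by (intro lipschitz_onI) (auto simp: dist_norm)
  then have Wc: "continuous_on UNIV W" by (rule lipschitz_on_continuous_on)
  obtain g where g: "continuous_on UNIV g" "\<And>t. W t = exp (g t)"
    by (rule continuous_logarithm_on_contractible[OF Wc])
      (auto simp: W_def convex_imp_contractible)
  define s where "s t = L / (2 * pi) * Im (g t)" for t
  have s_rep: "\<exists>n::int. s t = \<tau> t + of_int n * L" for t
  proof -
    \<comment> \<open>\<open>W\<close> has modulus 1, so its logarithm is purely imaginary and gives
      the angle.\<close>
    have "norm (exp (g t)) = 1" using g(2)[of t] by (simp add: W_def flip: g(2))
    then have "Re (g t) = 0" by (simp add: norm_exp_eq_Re)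
    then have "exp (g t) = cis (Im (g t))" by (simp add: exp_eq_polar)
    then have "cis (Im (g t)) = cis (2 * pi / L * \<tau> t)" using g(2)[of t] by (simp add: W_def)
    then have "sin (Im (g t)) = sin (2 * pi / L * \<tau> t) \<and> cos (Im (g t)) = cos (2 * pi / L * \<tau> t)"
      by (simp add: complex_eq_iff)
    then obtain n :: int where n: "Im (g t) = 2 * pi / L * \<tau> t + 2 * pi * n" using sin_cos_eq_iff by blast
    have "s t = \<tau> t + of_int n * L" using L by (simp add: s_def n field_simps)
    then show ?thesis by blast
  qed
  have cs: "c (s t) = q t" for t
  proof -
    obtain n :: int where "s t = \<tau> t + of_int n * L" using s_rep[of t] by blast
    then show ?thesis using periodic_int_shift[of c L, OF per] \<tau>[of t] by simp
  qed
  have sc: "continuous_on UNIV s" unfolding s_def by (intro continuous_intros g(1))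
  have "(2 / m)-lipschitz_on UNIV s"
  proof (rule local_lipschitz_imp_lipschitz)
    fix t
    \<comment> \<open>Continuity confines \<open>s t'\<close> to within \<open>L / 2\<close> of
      \<open>s t\<close>; there the bi-Lipschitz bound yields a Lipschitz constant that does not
      depend on the neighbourhood.\<close>
    have "isCont s t" using sc by (simp add: continuous_on_eq_continuous_at)
    then obtain d where d: "d > 0" "\<And>t'. dist t' t < d \<Longrightarrow> dist (s t') (s t) < L / 2"
      using L unfolding continuous_at_eps_delta by (metis half_gt_zero)
    show "\<exists>d>0. \<forall>t'. \<bar>t' - t\<bar> < d \<longrightarrow> \<bar>s t' - s t\<bar> \<le> 2 / m * \<bar>t' - t\<bar>"
    proof (intro exI conjI allI impI)
      fix t' assume "\<bar>t' - t\<bar> < d"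
      then have "\<bar>s t' - s t\<bar> \<le> L / 2" using d(2)[of t'] by (simp add: dist_real_def)
      from bi[OF this] have "m * \<bar>s t' - s t\<bar> \<le> norm (q t' - q t)" using cs by simp
      also have "\<dots> \<le> 2 * \<bar>t' - t\<bar>" using lipschitz_onD[OF q, of t' t] by (simp add: dist_norm)
      finally show "\<bar>s t' - s t\<bar> \<le> 2 / m * \<bar>t' - t\<bar>" using m by (simp add: field_simps)
    qed (rule d(1))
  qed (use m in simp)
  then show thesis using cs by (rule that)
qed

text \<open>Implicit differentiation of \<open>(\<sigma> t - c (s t)) \<bullet> c' (s t) = 0\<close>, with \<open>k\<close> the Caratheodory slope of the
  dependence on \<open>s\<close>.\<close>

lemma lift_differentiable:
  fixes \<sigma> :: "real \<Rightarrow> point" and s :: "real \<Rightarrow> real"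
  assumes s: "isCont s t" and foot: "\<And>t. c (s t) = foot (\<sigma> t)"
    and \<sigma>: "(\<sigma> has_vector_derivative v) (at t)" and small: "norm (\<sigma> t - c (s t)) * K < 1"
  shows "s differentiable (at t)"
proof -
  define x0 where "x0 = \<sigma> t"
  \<comment> \<open>\<open>D\<close> will be the derivative of \<open>f\<close> at
    \<open>s t\<close>. It cannot vanish: the distance to the curve times the curvature bound is
    less than 1.\<close>
  define D where "D = - 1 + (x0 - c (s t)) \<bullet> c2 (s t)"
  have "(x0 - c (s t)) \<bullet> c2 (s t) \<le> norm (x0 - c (s t)) * norm (c2 (s t))" by (rule norm_cauchy_schwarz)
  also have "\<dots> \<le> norm (x0 - c (s t)) * K" using K by (intro mult_left_mono) auto
  finally have D: "D < 0" using small by (simp add: D_def x0_def)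
  define f where "f \<theta> = (x0 - c \<theta>) \<bullet> c1 \<theta>" for \<theta>
  have df: "(f has_real_derivative D) (at (s t))"
  proof -
    have d1: "((\<lambda>\<theta>. x0 - c \<theta>) has_derivative (\<lambda>h. - (h *\<^sub>R c1 (s t)))) (at (s t))"
      using c1[of "s t"] by (auto simp: has_vector_derivative_def intro!: derivative_eq_intros)
    have d2: "(c1 has_derivative (\<lambda>h. h *\<^sub>R c2 (s t))) (at (s t))"
      using c2[of "s t"] by (simp add: has_vector_derivative_def)
    show ?thesis
      unfolding has_field_derivative_def f_def
      by (rule has_derivative_eq_rhs[OF has_derivative_inner[OF d1 d2]])
        (auto simp: D_def c1_dot_self algebra_simps)
  qed
  then obtain k where k: "\<And>z. f z - f (s t) = k z * (z - s t)" "isCont k (s t)" "k (s t) = D"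
    unfolding CARAT_DERIV by blast
  have f0: "f (s t) = 0" using foot_orthogonal[of x0 "s t"] foot[of t] by (simp add: f_def x0_def)
  have eq: "k (s y) * (s y - s t) = - ((\<sigma> y - x0) \<bullet> c1 (s y))" for y
  proof -
    have "(\<sigma> y - c (s y)) \<bullet> c1 (s y) = 0" using foot_orthogonal[of "\<sigma> y" "s y"] foot[of y] by simp
    then have "f (s y) = - ((\<sigma> y - x0) \<bullet> c1 (s y))" by (simp add: f_def inner_diff_left)
    then show ?thesis using k(1)[of "s y"] f0 by simp
  qed
  have ks: "((\<lambda>y. k (s y)) \<longlongrightarrow> D) (at t)"
    using isCont_tendsto_compose[OF k(2) s[unfolded isCont_def]] k(3) by simp
  have ev: "eventually (\<lambda>y. k (s y) \<noteq> 0) (at t)"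
    using tendsto_imp_eventually_ne[OF ks] D by simp
  have \<sigma>l: "((\<lambda>y. (\<sigma> y - x0) /\<^sub>R (y - t)) \<longlongrightarrow> v) (at t)"
  proof -
    have "((\<lambda>y. (\<sigma> y - x0 - (y - t) *\<^sub>R v) /\<^sub>R norm (y - t)) \<longlongrightarrow> 0) (at t)"
      using \<sigma> unfolding has_vector_derivative_def has_derivative_at_within x0_def by simp
    then have "((\<lambda>y. norm ((\<sigma> y - x0 - (y - t) *\<^sub>R v) /\<^sub>R norm (y - t))) \<longlongrightarrow> 0) (at t)"
      by (rule tendsto_norm_zero)
    then have "((\<lambda>y. (\<sigma> y - x0) /\<^sub>R (y - t) - v) \<longlongrightarrow> 0) (at t)"
    proof (rule Lim_null_comparison[rotated])
      have "norm ((\<sigma> y - x0) /\<^sub>R (y - t) - v) \<le> norm ((\<sigma> y - x0 - (y - t) *\<^sub>R v) /\<^sub>R norm (y - t))"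
        if "y \<noteq> t" for y
      proof -
        have "(\<sigma> y - x0) /\<^sub>R (y - t) - v = (\<sigma> y - x0 - (y - t) *\<^sub>R v) /\<^sub>R (y - t)"
          using that by (simp add: scaleR_right_diff_distrib)
        then show ?thesis by simp
      qed
      then show "\<forall>\<^sub>F y in at t. norm ((\<sigma> y - x0) /\<^sub>R (y - t) - v)
          \<le> norm ((\<sigma> y - x0 - (y - t) *\<^sub>R v) /\<^sub>R norm (y - t))"
        by (auto simp: eventually_at_filter)
    qed
    then show ?thesis by (simp add: Lim_null[symmetric])
  qed
  have c1s: "((\<lambda>y. c1 (s y)) \<longlongrightarrow> c1 (s t)) (at t)"
  proof -
    have "isCont c1 (s t)" using c1_continuous[of UNIV] by (simp add: continuous_on_eq_continuous_at)
    then show ?thesis using s[unfolded isCont_def] by (rule isCont_tendsto_compose)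
  qed
  have "((\<lambda>y. - (((\<sigma> y - x0) /\<^sub>R (y - t)) \<bullet> c1 (s y)) / k (s y)) \<longlongrightarrow> - (v \<bullet> c1 (s t)) / D) (at t)"
    using D by (intro tendsto_intros \<sigma>l c1s ks) simp
  moreover have "\<forall>\<^sub>F y in at t. - (((\<sigma> y - x0) /\<^sub>R (y - t)) \<bullet> c1 (s y)) / k (s y) = (s y - s t) / (y - t)"
    using ev
  proof eventually_elim
    case (elim y)
    have "s y - s t = - ((\<sigma> y - x0) \<bullet> c1 (s y)) / k (s y)"
      using eq[of y] elim by (simp add: field_simps)
    then show ?case by (simp add: divide_inverse mult_ac)
  qed
  ultimately have "((\<lambda>y. (s y - s t) / (y - t)) \<longlongrightarrow> - (v \<bullet> c1 (s t)) / D) (at t)"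
    by (rule Lim_transform_eventually)
  then have "(s has_real_derivative - (v \<bullet> c1 (s t)) / D) (at t)" by (simp add: has_field_derivative_iff)
  then show ?thesis by (auto simp: real_differentiable_def)
qed

end

section \<open>Comparison with the pulled-back solution\<close>

lemma translation_integral:
  fixes f :: "real \<Rightarrow> real"
  assumes per: "\<And>t. f (t + p) = f t" and f: "f absolutely_integrable_on {a..b}"
  shows "f absolutely_integrable_on {a + p..b + p}" "integral {a + p..b + p} f = integral {a..b} f"
proof -
  have img: "(\<lambda>x. x + p) ` {a..b} = {a + p..b + p}"
    by (auto simp: image_iff intro!: bexI[of _ "x - p" for x])
  have "(\<lambda>x. \<bar>1\<bar> * f (x + p)) absolutely_integrable_on {a..b} \<and>
      integral {a..b} (\<lambda>x. \<bar>1\<bar> * f (x + p)) = integral {a..b} f \<longleftrightarrow>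
      f absolutely_integrable_on ((\<lambda>x. x + p) ` {a..b}) \<and> integral ((\<lambda>x. x + p) ` {a..b}) f = integral {a..b} f"
    by (rule has_absolute_integral_change_of_variables_1') (auto intro!: derivative_eq_intros inj_onI)
  then have "f absolutely_integrable_on {a + p..b + p} \<and> integral {a + p..b + p} f = integral {a..b} f"
    using f per by (simp add: img)
  then show "f absolutely_integrable_on {a + p..b + p}" "integral {a + p..b + p} f = integral {a..b} f"
    by auto
qed

text \<open>By bisection only short intervals matter, and these lie in one translate of the period
  or straddle a single seam between two.\<close>

lemma periodic_absolutely_integrable:
  fixes f :: "real \<Rightarrow> real"
  assumes L: "0 < L" and per: "\<And>t. f (t + L) = f t" and f: "f absolutely_integrable_on {0..L}" and "a \<le> b"
  shows "f absolutely_integrable_on {a..b}"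
  using \<open>a \<le> b\<close>
proof (induction rule: Bolzano)
  case (trans a b c)
  then show ?case using absolutely_integrable_on_combine by blast
next
  case (local x)
  have win: "f absolutely_integrable_on {a..b}" if "of_int n * L \<le> a" "b \<le> of_int n * L + L" for n :: int and a b
  proof -
    have "f absolutely_integrable_on {0 + of_int n * L..L + of_int n * L}"
      by (rule translation_integral(1)[OF _ f]) (rule periodic_int_shift[of f L, OF per])
    then show ?thesis
      by (rule absolutely_integrable_on_subinterval) (use that in auto)
  qed
  obtain n0 :: int where n0: "x + of_int n0 * L \<in> {0..<0 + L}" by (rule period_representative[OF L])
  define n where "n = - n0"
  have n: "of_int n * L \<le> x" "x < of_int n * L + L" using n0 by (auto simp: n_def)
  show ?case
  proof (cases "x = of_int n * L")
    case True
    have "f absolutely_integrable_on {u..v}" if "u \<le> x" "x \<le> v" "v - u < L" for u v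
    proof -
      have "of_int (n - 1) * L \<le> u" "x \<le> of_int (n - 1) * L + L" "of_int n * L \<le> x" "v \<le> of_int n * L + L"
        using that True by (auto simp: algebra_simps)
      then show ?thesis using win that absolutely_integrable_on_combine by blast
    qed
    then show ?thesis using L by blast
  next
    case False
    have "f absolutely_integrable_on {u..v}"
      if "u \<le> x" "x \<le> v" "v - u < min (x - of_int n * L) (of_int n * L + L - x)" for u v
      using that by (intro win[of n]) auto
    moreover have "min (x - of_int n * L) (of_int n * L + L - x) > 0" using n False by simp
    ultimately show ?thesis by blast
  qed
qed

text \<open>The interval is cut at the multiple \<open>x\<close> of \<open>L\<close> that it
  contains; its left piece, moved by one period, completes the right one to
  \<open>{x..x + L}\<close>.\<close>

lemma periodic_integral:
  fixes f :: "real \<Rightarrow> real"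
  assumes L: "0 < L" and per: "\<And>t. f (t + L) = f t" and f: "f absolutely_integrable_on {0..L}"
  shows "integral {a..a + L} f = integral {0..L} f"
proof -
  note ai = periodic_absolutely_integrable[OF L per f]
  note i = set_lebesgue_integral_eq_integral(1)[OF ai]
  obtain n0 :: int where n0: "0 + of_int n0 * L \<in> {a..<a + L}" by (rule period_representative[OF L])
  define x where "x = of_int n0 * L"
  have x: "a \<le> x" "x \<le> a + L" using n0 by (auto simp: x_def)
  have "integral {a..x} f + integral {x..a + L} f = integral {a..a + L} f"
    using x L by (intro Henstock_Kurzweil_Integration.integral_combine i) auto
  moreover have "integral {a + L..x + L} f = integral {a..x} f"
    by (rule translation_integral(2)[OF per ai[OF x(1)]])
  moreover have "integral {x..a + L} f + integral {a + L..x + L} f = integral {x..x + L} f"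
    using x L by (intro Henstock_Kurzweil_Integration.integral_combine i) auto
  moreover have "integral {0 + x..L + x} f = integral {0..L} f"
    unfolding x_def using f by (rule translation_integral(2)[rotated]) (rule periodic_int_shift[of f L, OF per])
  ultimately show ?thesis by (simp add: add.commute)
qed

text \<open>A primitive on the whole line, needed because the lift may leave \<open>{0..L}\<close>.
  Absolute integrability is what the change of variables works with.\<close>

definition is_primitive :: "(real \<Rightarrow> real) \<Rightarrow> (real \<Rightarrow> real) \<Rightarrow> bool" where
  "is_primitive F f \<longleftrightarrow> (\<forall>a b. a \<le> b \<longrightarrow> f absolutely_integrable_on {a..b} \<and> integral {a..b} f = F b - F a)"

lemma is_primitiveD:
  assumes "is_primitive F f" "a \<le> b"
  shows "f absolutely_integrable_on {a..b}" "integral {a..b} f = F b - F a"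
  using assms by (auto simp: is_primitive_def)

lemma is_primitive_signed_integral:
  fixes f :: "real \<Rightarrow> real"
  assumes ai: "\<And>a b. a \<le> b \<Longrightarrow> f absolutely_integrable_on {a..b}"
  shows "is_primitive (\<lambda>t. k + (if 0 \<le> t then integral {0..t} f else - integral {t..0} f)) f"
proof -
  note i = set_lebesgue_integral_eq_integral(1)[OF ai]
  define F where "F t = k + (if 0 \<le> t then integral {0..t} f else - integral {t..0} f)" for t
  have prim: "integral {a..b} f = F b - F a" if "a \<le> b" for a b
  proof -
    consider "0 \<le> a" | "a < 0" "0 \<le> b" | "b < 0" using that by linarith
    then show ?thesis
    proof cases
      case 1
      then have "integral {0..a} f + integral {a..b} f = integral {0..b} f"
        using that by (intro Henstock_Kurzweil_Integration.integral_combine i) auto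
      then show ?thesis using 1 that by (simp add: F_def)
    next
      case 2
      then have "integral {a..0} f + integral {0..b} f = integral {a..b} f"
        using that by (intro Henstock_Kurzweil_Integration.integral_combine i) auto
      then show ?thesis using 2 that by (simp add: F_def)
    next
      case 3
      then have "integral {a..b} f + integral {b..0} f = integral {a..0} f"
        using that by (intro Henstock_Kurzweil_Integration.integral_combine i) auto
      then show ?thesis using 3 that by (simp add: F_def)
    qed
  qed
  then have "is_primitive F f" unfolding is_primitive_def using ai by blast
  then show ?thesis unfolding F_def .
qed

lemma periodic_primitive_extend:
  fixes f :: "real \<Rightarrow> real"
  assumes L: "0 < L" and per: "\<And>t. f (t + L) = f t" and F: "periodic_primitive L F0 f"
  obtains F where "is_primitive F f" "\<And>t. F (t + L) = F t" "\<And>t. t \<in> {0..L} \<Longrightarrow> F t = F0 t"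
proof -
  have f: "f absolutely_integrable_on {0..L}"
    using L2_per_absolutely_integrable_on[OF periodic_primitiveD(1)[OF F], of 0 L] by simp
  note ai = periodic_absolutely_integrable[OF L per f]
  have zero: "integral {0..L} f = 0"
    using periodic_primitiveD(3)[OF F, of L] periodic_primitiveD(2)[OF F] L by simp
  define F where "F t = F0 0 + (if 0 \<le> t then integral {0..t} f else - integral {t..0} f)" for t
  have prim: "is_primitive F f" unfolding F_def by (rule is_primitive_signed_integral[OF ai])
  show thesis
  proof (rule that)
    show "is_primitive F f" by (rule prim)
    show "F (t + L) = F t" for t
      using is_primitiveD(2)[OF prim, of t "t + L"] periodic_integral[OF L per f, of t] zero L by simp
    show "F t = F0 t" if "t \<in> {0..L}" for t
      using that periodic_primitiveD(3)[OF F, of t] by (simp add: F_def)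
  qed
qed

text \<open>The properties of the parameter \<open>s\<close> of the projected point.
  \<open>e\<close> is the orientation, because \<open>\<sigma>\<close> may run around the polygon in
  either sense; \<open>range\<close> says that \<open>s\<close> makes at most one turn.\<close>

locale monotone_lift =
  fixes l L M \<rho> e :: real and s :: "real \<Rightarrow> real"
  assumes l: "0 < l" and L: "0 < L" and lip: "M-lipschitz_on UNIV s"
    and diff: "AE t in lebesgue. s differentiable (at t)"
    and e: "e = 1 \<or> e = - 1"
    and mono: "\<And>x y. x \<in> {0..l} \<Longrightarrow> y \<in> {0..l} \<Longrightarrow> x \<le> y \<Longrightarrow> e * s x \<le> e * s y"
    and inj: "inj_on s {0<..<l}"
    and speed: "AE t in lebesgue. \<bar>1 - \<bar>deriv s t\<bar>\<bar> \<le> \<rho>" and \<rho>: "0 \<le> \<rho>" "\<rho> \<le> 1 / 2"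
    and range: "\<bar>s l - s 0\<bar> \<le> L" and closed: "\<exists>n::int. s l = s 0 + of_int n * L"
begin

lemma s_continuous: "continuous_on A s"
  using lipschitz_on_continuous_on[OF lip] continuous_on_subset by blast

lemma deriv_L2: "deriv s \<in> L2_per r" if "0 \<le> r"
  by (rule lipschitz_deriv_L2_per[OF lip diff that])

lemma speed_L2: "(\<lambda>t. \<bar>deriv s t\<bar>) \<in> L2_per r" if "0 \<le> r"
  using deriv_L2[OF that] by (auto simp: L2_per_def)

lemma s_image:
  assumes t: "t \<in> {0..l}"
  shows "s ` {0..t} = closed_segment (s 0) (s t)"
proof (rule equalityI)
  show "s ` {0..t} \<subseteq> closed_segment (s 0) (s t)"
  proof
    fix y assume "y \<in> s ` {0..t}"
    then obtain x where x: "x \<in> {0..t}" "y = s x" by blast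
    have "e * s 0 \<le> e * s x" "e * s x \<le> e * s t" using mono[of 0 x] mono[of x t] x t by auto
    then show "y \<in> closed_segment (s 0) (s t)"
      using e x(2) by (auto simp: closed_segment_eq_real_ivl)
  qed
  have "connected (s ` {0..t})" by (intro connected_continuous_image s_continuous) simp
  then have "convex (s ` {0..t})" by (simp only: connected_convex_1)
  then show "closed_segment (s 0) (s t) \<subseteq> s ` {0..t}"
    using t by (intro closed_segment_subset) auto
qed

text \<open>The substitution rule for injective differentiable maps, applied outside the end points
  and the null set \<open>N\<close> where \<open>s\<close> has no derivative. A Lipschitz map sends
  \<open>N\<close> to a null set, so the image still fills the segment from \<open>s 0\<close> to
  \<open>s t\<close> up to a null set. The rule is unsigned, whence
  \<open>\<bar>deriv s x\<bar>\<close> on the left and the orientation \<open>e\<close> on the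
  right.\<close>

lemma change_of_variables:
  assumes F: "is_primitive F f" and t: "t \<in> {0..l}"
  shows "(\<lambda>x. \<bar>deriv s x\<bar> * f (s x)) absolutely_integrable_on {0..t}"
    and "integral {0..t} (\<lambda>x. \<bar>deriv s x\<bar> * f (s x)) = e * (F (s t) - F (s 0))"
proof -
  define N where "N = {x. \<not> s differentiable (at x)}"
  have N: "negligible N"
    using diff unfolding N_def by (simp add: eventually_ae_filter_negligible) (metis (mono_tags, lifting) negligible_subset)
  define S where "S = {0<..<t} - N"
  have Sm: "S \<in> sets lebesgue" unfolding S_def by (intro sets.Diff negligible_imp_sets[OF N]) simp
  have injS: "inj_on s S" by (rule inj_on_subset[OF inj]) (use t in \<open>auto simp: S_def\<close>)
  have der: "(s has_field_derivative deriv s x) (at x within S)" if "x \<in> S" for x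
    using that by (auto simp: S_def N_def DERIV_deriv_iff_real_differentiable intro: has_field_derivative_at_within)
  note cov = has_absolute_integral_change_of_variables_1'[OF Sm der injS, of f]
  define J where "J = closed_segment (s 0) (s t)"
  have Jval: "f absolutely_integrable_on J" "integral J f = e * (F (s t) - F (s 0))"
  proof -
    have m0: "e * s 0 \<le> e * s t" using mono[of 0 t] t by auto
    have "f absolutely_integrable_on J \<and> integral J f = e * (F (s t) - F (s 0))"
      using e
    proof
      assume e1: "e = 1"
      then have le: "s 0 \<le> s t" using m0 by simp
      then have "J = {s 0..s t}" by (simp add: J_def closed_segment_eq_real_ivl)
      then show ?thesis using is_primitiveD[OF F le] e1 by simp
    next
      assume e1: "e = - 1"
      then have le: "s t \<le> s 0" using m0 by simp
      then have "J = {s t..s 0}" by (simp add: J_def closed_segment_eq_real_ivl)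
      then show ?thesis using is_primitiveD[OF F le] e1 by simp
    qed
    then show "f absolutely_integrable_on J" "integral J f = e * (F (s t) - F (s 0))"
      by (rule conjunct1, rule conjunct2)
  qed
  have sJ: "J = s ` {0..t}" unfolding J_def s_image[OF t] ..
  have "S \<subseteq> {0..t}" by (auto simp: S_def)
  then have sub: "s ` S \<subseteq> J" unfolding sJ by (rule image_mono)
  have negN: "negligible (s ` N)"
  proof (rule negligible_locally_Lipschitz_image[OF _ N])
    show "\<exists>T B. open T \<and> x \<in> T \<and> (\<forall>y\<in>N \<inter> T. norm (s y - s x) \<le> B * norm (y - x))" for x
      using lipschitz_onD[OF lip] by (intro exI[of _ UNIV] exI[of _ M]) (auto simp: dist_norm)
  qed simp
  have "J - s ` S \<subseteq> s ` N \<union> {s 0, s t}"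
  proof
    fix y assume y: "y \<in> J - s ` S"
    then obtain x where x: "x \<in> {0..t}" "y = s x" unfolding sJ by blast
    then show "y \<in> s ` N \<union> {s 0, s t}" using y by (cases "x \<in> N"; cases "x = 0"; cases "x = t") (auto simp: S_def)
  qed
  moreover have "negligible (s ` N \<union> {s 0, s t})" using negN by (simp add: negligible_Un)
  ultimately have neg: "negligible (J - s ` S)" by (rule negligible_subset[rotated])
  have img: "f absolutely_integrable_on (s ` S)" "integral (s ` S) f = integral J f"
  proof -
    have n1: "negligible {x \<in> J - s ` S. f x \<noteq> 0}" by (rule negligible_subset[OF neg]) auto
    have n2: "negligible {x \<in> s ` S - J. f x \<noteq> 0}"
    proof -
      have "{x \<in> s ` S - J. f x \<noteq> 0} = {}" using sub by blast
      then show ?thesis by (simp only: negligible_empty)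
    qed
    show "f absolutely_integrable_on (s ` S)"
      by (rule absolutely_integrable_spike_set_eq[OF n1 n2, THEN iffD1, OF Jval(1)])
    show "integral (s ` S) f = integral J f"
      by (rule integral_spike_set[OF n2 n1])
  qed
  have res: "(\<lambda>x. \<bar>deriv s x\<bar> * f (s x)) absolutely_integrable_on S \<and>
      integral S (\<lambda>x. \<bar>deriv s x\<bar> * f (s x)) = e * (F (s t) - F (s 0))"
    using cov[of "e * (F (s t) - F (s 0))"] img Jval(2) by simp
  have n1: "negligible {x \<in> S - {0..t}. \<bar>deriv s x\<bar> * f (s x) \<noteq> 0}"
  proof -
    have "{x \<in> S - {0..t}. \<bar>deriv s x\<bar> * f (s x) \<noteq> 0} = {}" by (auto simp: S_def)
    then show ?thesis by (simp only: negligible_empty)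
  qed
  have n2: "negligible {x \<in> {0..t} - S. \<bar>deriv s x\<bar> * f (s x) \<noteq> 0}"
    by (rule negligible_subset[of "N \<union> {0, t}"]) (use N in \<open>auto simp: S_def negligible_Un\<close>)
  show "(\<lambda>x. \<bar>deriv s x\<bar> * f (s x)) absolutely_integrable_on {0..t}"
    by (rule absolutely_integrable_spike_set_eq[OF n1 n2, THEN iffD1, OF conjunct1[OF res]])
  show "integral {0..t} (\<lambda>x. \<bar>deriv s x\<bar> * f (s x)) = e * (F (s t) - F (s 0))"
    using integral_spike_set[OF n1 n2] res by simp
qed

lemma AE_on: "AE t in lebesgue_on {0..l}. P t" if "AE t in lebesgue. P t"
  using that by (auto simp: AE_restrict_space_iff elim!: eventually_mono)

lemma speed_bounds: "AE t in lebesgue_on {0..l}. 1 / 2 \<le> \<bar>deriv s t\<bar> \<and> \<bar>1 - \<bar>deriv s t\<bar>\<bar> \<le> \<rho>"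
  using AE_on[OF speed]
proof eventually_elim
  case (elim t)
  then show ?case using \<rho> abs_le_D1[OF elim] by linarith
qed

text \<open>The integral of the speed is the length of the parameter range, at most
  \<open>L\<close>, and the speed is at least 1/2.\<close>

lemma length_le: "l \<le> 2 * L"
proof -
  have p: "is_primitive (\<lambda>x. x) (\<lambda>x. 1)" unfolding is_primitive_def by auto
  have "integral {0..l} (\<lambda>x. \<bar>deriv s x\<bar>) = e * (s l - s 0)"
    using change_of_variables(2)[OF p, of l] l by simp
  also have "\<dots> \<le> \<bar>s l - s 0\<bar>" using e by auto
  finally have "integral {0..l} (\<lambda>x. \<bar>deriv s x\<bar>) \<le> L" using range by linarith
  then have "integral\<^sup>L (lebesgue_on {0..l}) (\<lambda>x. \<bar>deriv s x\<bar>) \<le> L"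
    using L2_per_integral_eq[OF speed_L2[of l]] l by simp
  moreover have "integral\<^sup>L (lebesgue_on {0..l}) (\<lambda>x. 1 / 2) \<le> integral\<^sup>L (lebesgue_on {0..l}) (\<lambda>x. \<bar>deriv s x\<bar>)"
    using speed_bounds L2_per_integrable[OF speed_L2[of l]] l L2_per_integrable[OF L2_per_const[of "1/2" l]]
    by (intro integral_mono_AE) (auto elim!: eventually_mono)
  moreover have "integral\<^sup>L (lebesgue_on {0..l}) (\<lambda>x. 1 / 2) = l / 2" using l by simp
  ultimately show ?thesis by linarith
qed

text \<open>With speed at least 1/2 the square of \<open>g (s t)\<close> is at most twice its
  product with the speed, and that product integrates to an integral of the square of
  \<open>g\<close> over at most one period.\<close>

lemma pullback_L2:
  assumes per: "\<And>t. g (t + L) = g t" and g: "g \<in> L2_per L"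
  shows "(\<lambda>t. g (s t)) \<in> L2_per l" "L2_norm_on l (\<lambda>t. g (s t)) \<le> 2 * L2_norm_on L g"
proof -
  have prim: "\<exists>F. is_primitive F f" if f: "f absolutely_integrable_on {0..L}" and fp: "\<And>t. f (t + L) = f t" for f
    using is_primitive_signed_integral[OF periodic_absolutely_integrable[OF L fp f]] by blast
  have ga: "g absolutely_integrable_on {0..L}"
    using L2_per_absolutely_integrable_on[OF g, of 0 L] by simp
  have g2: "(\<lambda>t. (g t)\<^sup>2) absolutely_integrable_on {0..L}"
    using g by (simp add: L2_per_def set_integrable_def integrable_restrict_space)
  obtain F where F: "is_primitive F g" using prim[OF ga] per by blast
  obtain G where G: "is_primitive G (\<lambda>t. (g t)\<^sup>2)" using prim[OF g2] per by auto
  have i1: "integrable (lebesgue_on {0..l}) (\<lambda>x. \<bar>deriv s x\<bar> * g (s x))"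
    using change_of_variables(1)[OF F, of l] l by (simp add: set_integrable_def integrable_restrict_space)
  have i2: "integrable (lebesgue_on {0..l}) (\<lambda>x. \<bar>deriv s x\<bar> * (g (s x))\<^sup>2)"
    using change_of_variables(1)[OF G, of l] l by (simp add: set_integrable_def integrable_restrict_space)
  have dm: "(\<lambda>x. \<bar>deriv s x\<bar>) \<in> borel_measurable (lebesgue_on {0..l})"
    using speed_L2[of l] l by (simp add: L2_per_def)
  \<comment> \<open>The composition of a Lebesgue measurable function with a Lipschitz one need not
    be measurable; here measurability is recovered from the product with the speed, by dividing by
    the speed.\<close>
  have m: "(\<lambda>t. g (s t)) \<in> borel_measurable (lebesgue_on {0..l})"
  proof (rule borel_measurable_lebesgue_on_AE)
    show "(\<lambda>x. (\<bar>deriv s x\<bar> * g (s x)) / \<bar>deriv s x\<bar>) \<in> borel_measurable (lebesgue_on {0..l})"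
      using i1 dm by (intro borel_measurable_divide) auto
    show "AE t in lebesgue_on {0..l}. \<bar>deriv s t\<bar> * g (s t) / \<bar>deriv s t\<bar> = g (s t)"
      using speed_bounds by eventually_elim auto
  qed simp
  have le: "AE t in lebesgue_on {0..l}. (g (s t))\<^sup>2 \<le> 2 * (\<bar>deriv s t\<bar> * (g (s t))\<^sup>2)"
    using speed_bounds
  proof eventually_elim
    case (elim t)
    then have "1 / 2 * (g (s t))\<^sup>2 \<le> \<bar>deriv s t\<bar> * (g (s t))\<^sup>2" by (intro mult_right_mono) auto
    then show ?case by simp
  qed
  have i3: "integrable (lebesgue_on {0..l}) (\<lambda>x. 2 * (\<bar>deriv s x\<bar> * (g (s x))\<^sup>2))" using i2 by simp
  have i4: "integrable (lebesgue_on {0..l}) (\<lambda>x. (g (s x))\<^sup>2)"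
    by (rule Bochner_Integration.integrable_bound[OF i3]) (use m le in auto)
  with m show "(\<lambda>t. g (s t)) \<in> L2_per l" by (simp add: L2_per_def)
  define a where "a = min (s 0) (s l)"
  have Gm: "G x \<le> G y" if "x \<le> y" for x y
  proof -
    have "0 \<le> integral {x..y} (\<lambda>t. (g t)\<^sup>2)"
      using set_lebesgue_integral_eq_integral(1)[OF is_primitiveD(1)[OF G that]]
      by (intro Henstock_Kurzweil_Integration.integral_nonneg) auto
    then show ?thesis using is_primitiveD(2)[OF G that] by simp
  qed
  have "integral {0..l} (\<lambda>x. \<bar>deriv s x\<bar> * (g (s x))\<^sup>2) = e * (G (s l) - G (s 0))"
    using change_of_variables(2)[OF G, of l] l by simp
  also have "\<dots> \<le> G (max (s 0) (s l)) - G a"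
    using e Gm[of "s 0" "s l"] Gm[of "s l" "s 0"] by (auto simp: a_def min_def max_def)
  also have "\<dots> \<le> G (a + L) - G a"
  proof -
    have "max (s 0) (s l) \<le> a + L" using abs_le_D1[OF range] abs_le_D2[OF range] by (simp add: a_def min_def max_def)
    then show ?thesis using Gm by simp
  qed
  also have "\<dots> = integral {a..a + L} (\<lambda>t. (g t)\<^sup>2)" using is_primitiveD(2)[OF G, of a "a + L"] L by simp
  also have "\<dots> = integral {0..L} (\<lambda>t. (g t)\<^sup>2)" by (rule periodic_integral[OF L _ g2]) (simp add: per)
  also have "\<dots> = (L2_norm_on L g)\<^sup>2"
    unfolding L2_norm_on_sq using g by (simp add: L2_per_def lebesgue_integral_eq_integral)
  finally have bound: "integral\<^sup>L (lebesgue_on {0..l}) (\<lambda>x. \<bar>deriv s x\<bar> * (g (s x))\<^sup>2) \<le> (L2_norm_on L g)\<^sup>2"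
    using i2 by (simp add: lebesgue_integral_eq_integral)
  show "L2_norm_on l (\<lambda>t. g (s t)) \<le> 2 * L2_norm_on L g"
  proof (rule power2_le_imp_le)
    have "(L2_norm_on l (\<lambda>t. g (s t)))\<^sup>2 \<le> integral\<^sup>L (lebesgue_on {0..l}) (\<lambda>x. 2 * (\<bar>deriv s x\<bar> * (g (s x))\<^sup>2))"
      unfolding L2_norm_on_sq by (rule integral_mono_AE[OF i4 i3 le])
    also have "\<dots> \<le> 2 * (L2_norm_on L g)\<^sup>2" using bound by simp
    also have "\<dots> \<le> (2 * L2_norm_on L g)\<^sup>2" by (simp add: power_mult_distrib)
    finally show "(L2_norm_on l (\<lambda>t. g (s t)))\<^sup>2 \<le> (2 * L2_norm_on L g)\<^sup>2" .
  qed simp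
qed

end

context monotone_lift
begin

text \<open>With \<open>\<zeta> t = e U' (s t)\<close> one has \<open>(U \<circ> s)' = \<bar>s'\<bar> \<zeta>\<close> and \<open>\<zeta>' = - \<bar>s'\<bar> (g \<circ> s)\<close>, whereas
  \<open>P'' = - (g \<circ> s - m)\<close>; all deviations carry a factor \<open>1 - \<bar>s'\<bar>\<close>.\<close>

lemma pullback_comparison:
  assumes U: "is_primitive U U1" "is_primitive U1 (\<lambda>t. - g t)"
    and per: "\<And>t. U (t + L) = U t" "\<And>t. U1 (t + L) = U1 t" "\<And>t. g (t + L) = g t"
    and g: "g \<in> L2_per L" and Z: "\<And>t. \<bar>U1 t\<bar> \<le> Z"
    and P: "periodic_primitive l P P1"
      "periodic_primitive l P1 (\<lambda>t. - (g (s t) - integral\<^sup>L (lebesgue_on {0..l}) (\<lambda>t. g (s t)) / l))"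
    and P0: "integral\<^sup>L (lebesgue_on {0..l}) P = 0"
  defines "d \<equiv> \<lambda>t. U (s t) - integral\<^sup>L (lebesgue_on {0..l}) (\<lambda>t. U (s t)) / l - P t"
  shows "continuous_on {0..l} d"
    and "L2_norm_on l d \<le> sqrt l * (l * (2 * \<rho> * (sqrt l * L2_norm_on l (\<lambda>t. g (s t)) + Z)))"
proof -
  let ?I = "integral\<^sup>L (lebesgue_on {0..l})"
  have ki: "integrable (lebesgue_on {0..l}) (\<lambda>t. k)" for k :: real
    using L2_per_integrable[OF L2_per_const] .
  define f where "f = (\<lambda>t. g (s t))"
  define \<zeta> where "\<zeta> = (\<lambda>t. e * U1 (s t))"
  define \<delta> where "\<delta> = ?I (\<lambda>t. \<bar>f t\<bar>)"
  have fL: "f \<in> L2_per l" unfolding f_def by (rule pullback_L2(1)[OF per(3) g])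
  have fi: "integrable (lebesgue_on {0..l}) f" and fai: "integrable (lebesgue_on {0..l}) (\<lambda>t. \<bar>f t\<bar>)"
    using L2_per_integrable[OF fL] by auto
  have Z0: "0 \<le> Z" using Z[of 0] by linarith
  have \<zeta>Z: "\<bar>\<zeta> t\<bar> \<le> Z" for t using Z[of "s t"] e by (auto simp: \<zeta>_def abs_mult)
  have \<delta>0: "0 \<le> \<delta>" unfolding \<delta>_def by (intro integral_nonneg_AE) auto
  obtain n :: int where n: "s l = s 0 + of_int n * L" using closed by blast
  have U1l: "U1 (s l) = U1 (s 0)" unfolding n by (rule periodic_int_shift[of U1 L, OF per(2)])
  have Ul: "U (s l) = U (s 0)" unfolding n by (rule periodic_int_shift[of U L, OF per(1)])
  have ee: "e * e = 1" using e by auto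
  have dL: "(\<lambda>t. \<bar>deriv s t\<bar>) \<in> L2_per l" using speed_L2[of l] l by simp
  have U1prim: "is_primitive (\<lambda>t. - U1 t) g"
    unfolding is_primitive_def
  proof (intro allI impI conjI)
    fix a b :: real assume ab: "a \<le> b"
    from is_primitiveD(1)[OF U(2) ab] show "g absolutely_integrable_on {a..b}"
      by (simp add: set_integrable_def)
    show "integral {a..b} g = - U1 b - - U1 a" using is_primitiveD(2)[OF U(2) ab] by simp
  qed
  have absm: "(\<lambda>t. \<bar>deriv s t\<bar> * f t) \<in> borel_measurable (lebesgue_on {0..l})"
    using dL fL by (auto simp: L2_per_def)
  have df_L2: "(\<lambda>t. \<bar>deriv s t\<bar> * f t) \<in> L2_per l"
  proof -
    have b2: "AE t in lebesgue_on {0..l}. \<bar>deriv s t\<bar> \<le> 2"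
      using speed_bounds by eventually_elim (use \<rho> in linarith)
    have "integrable (lebesgue_on {0..l}) (\<lambda>t. 4 * (f t)\<^sup>2)" using fL by (simp add: L2_per_def)
    then have "integrable (lebesgue_on {0..l}) (\<lambda>t. (\<bar>deriv s t\<bar> * f t)\<^sup>2)"
    proof (rule Bochner_Integration.integrable_bound)
      show "(\<lambda>t. (\<bar>deriv s t\<bar> * f t)\<^sup>2) \<in> borel_measurable (lebesgue_on {0..l})" using absm by simp
      show "AE t in lebesgue_on {0..l}. norm ((\<bar>deriv s t\<bar> * f t)\<^sup>2) \<le> norm (4 * (f t)\<^sup>2)"
        using b2
      proof eventually_elim
        case (elim t)
        have "\<bar>deriv s t\<bar>\<^sup>2 \<le> 2\<^sup>2" using elim by (intro power_mono) auto
        then have "\<bar>deriv s t\<bar>\<^sup>2 * (f t)\<^sup>2 \<le> 4 * (f t)\<^sup>2" by (intro mult_right_mono) auto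
        then show ?case by (simp add: power_mult_distrib)
      qed
    qed
    with absm show ?thesis by (simp add: L2_per_def)
  qed
  have p\<zeta>: "periodic_primitive l \<zeta> (\<lambda>t. - (\<bar>deriv s t\<bar> * f t))"
  proof (rule periodic_primitiveI)
    show "(\<lambda>t. - (\<bar>deriv s t\<bar> * f t)) \<in> L2_per l" by (rule L2_per_minus[OF df_L2])
    show "\<zeta> l = \<zeta> 0" by (simp add: \<zeta>_def U1l)
    fix t assume t: "0 \<le> t" "t \<le> l"
    have "integral {0..t} (\<lambda>t. \<bar>deriv s t\<bar> * f t) = e * (- U1 (s t) - - U1 (s 0))"
      unfolding f_def using t by (intro change_of_variables(2)[OF U1prim]) simp
    then show "\<zeta> t = \<zeta> 0 + integral {0..t} (\<lambda>t. - (\<bar>deriv s t\<bar> * f t))"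
      by (simp add: \<zeta>_def algebra_simps)
  qed
  have pw: "periodic_primitive l (\<lambda>t. U (s t)) (\<lambda>t. \<bar>deriv s t\<bar> * \<zeta> t)"
  proof (rule periodic_primitiveI)
    have "\<zeta> \<in> L2_per l" by (rule periodic_primitive_L2[OF p\<zeta>])
    show "(\<lambda>t. \<bar>deriv s t\<bar> * \<zeta> t) \<in> L2_per l"
    proof (rule L2_per_bounded)
      show "(\<lambda>t. \<bar>deriv s t\<bar> * \<zeta> t) \<in> borel_measurable (lebesgue_on {0..l})"
        using dL \<open>\<zeta> \<in> L2_per l\<close> by (auto simp: L2_per_def)
      show "AE t in lebesgue_on {0..l}. \<bar>\<bar>deriv s t\<bar> * \<zeta> t\<bar> \<le> 2 * Z"
        using speed_bounds
      proof eventually_elim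
        case (elim t)
        then have "\<bar>deriv s t\<bar> \<le> 2" using \<rho> by linarith
        then show ?case using \<zeta>Z[of t] by (auto simp: abs_mult intro!: mult_mono)
      qed
    qed
    show "U (s l) = U (s 0)" by (rule Ul)
    fix t assume t: "0 \<le> t" "t \<le> l"
    have "integral {0..t} (\<lambda>t. \<bar>deriv s t\<bar> * \<zeta> t) = integral {0..t} (\<lambda>t. e * (\<bar>deriv s t\<bar> * U1 (s t)))"
      by (simp add: \<zeta>_def mult_ac)
    also have "\<dots> = e * (e * (U (s t) - U (s 0)))"
      using t by (subst integral_mult_right) (simp add: change_of_variables(2)[OF U(1)])
    also have "\<dots> = U (s t) - U (s 0)" using ee by (simp flip: mult.assoc)
    finally show "U (s t) = U (s 0) + integral {0..t} (\<lambda>t. \<bar>deriv s t\<bar> * \<zeta> t)" by simp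
  qed
  define mf where "mf = ?I f / l"
  \<comment> \<open>The speed may be discontinuous, so the derivative of \<open>U \<circ> s\<close>
    itself is not compared with \<open>P1\<close> by integration. \<open>\<zeta>\<close>, which
    lacks the factor \<open>\<bar>deriv s t\<bar>\<close>, is: the derivative of
    \<open>\<eta>\<close> contains only the deviation of the speed from 1 and the mean
    \<open>mf\<close>.\<close>
  define \<eta> where "\<eta> = (\<lambda>t. \<zeta> t - P1 t)"
  have p\<eta>: "periodic_primitive l \<eta> (\<lambda>t. - (\<bar>deriv s t\<bar> * f t) - - (f t - mf))"
    unfolding \<eta>_def using periodic_primitive_diff[OF p\<zeta> P(2)] by (simp add: f_def mf_def)
  have dev: "?I (\<lambda>t. \<bar>f t * (1 - \<bar>deriv s t\<bar>)\<bar>) \<le> \<rho> * \<delta>"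
    and devi: "integrable (lebesgue_on {0..l}) (\<lambda>t. f t * (1 - \<bar>deriv s t\<bar>))"
  proof -
    have eq: "f t * (1 - \<bar>deriv s t\<bar>) = f t - \<bar>deriv s t\<bar> * f t" for t by (simp add: algebra_simps)
    show i: "integrable (lebesgue_on {0..l}) (\<lambda>t. f t * (1 - \<bar>deriv s t\<bar>))"
      unfolding eq using fi L2_per_integrable[OF df_L2] by simp
    have "?I (\<lambda>t. \<bar>f t * (1 - \<bar>deriv s t\<bar>)\<bar>) \<le> ?I (\<lambda>t. \<rho> * \<bar>f t\<bar>)"
    proof (rule integral_mono_AE)
      show "AE t in lebesgue_on {0..l}. \<bar>f t * (1 - \<bar>deriv s t\<bar>)\<bar> \<le> \<rho> * \<bar>f t\<bar>"
        using speed_bounds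
      proof eventually_elim
        case (elim t)
        then have "\<bar>f t\<bar> * \<bar>1 - \<bar>deriv s t\<bar>\<bar> \<le> \<bar>f t\<bar> * \<rho>" by (intro mult_left_mono) auto
        then show ?case by (simp add: abs_mult mult.commute)
      qed
    qed (use i fai in auto)
    then show "?I (\<lambda>t. \<bar>f t * (1 - \<bar>deriv s t\<bar>)\<bar>) \<le> \<rho> * \<delta>" by (simp add: \<delta>_def)
  qed
  have zero: "?I (\<lambda>t. \<bar>deriv s t\<bar> * f t) = 0"
    using periodic_primitive_integral_zero[OF p\<zeta>] l by simp
  \<comment> \<open>\<open>\<zeta>\<close> is periodic, so the integral of
    \<open>\<bar>deriv s t\<bar> * f t\<close> vanishes; the mean of \<open>f\<close> comes from the
    deviation of the speed alone.\<close>
  have mfb: "l * \<bar>mf\<bar> \<le> \<rho> * \<delta>"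
  proof -
    have "l * \<bar>mf\<bar> = \<bar>?I f\<bar>" using l by (simp add: mf_def)
    also have "?I f = ?I (\<lambda>t. f t * (1 - \<bar>deriv s t\<bar>))"
    proof -
      have "?I (\<lambda>t. f t * (1 - \<bar>deriv s t\<bar>)) = ?I (\<lambda>t. f t - \<bar>deriv s t\<bar> * f t)"
        by (intro Bochner_Integration.integral_cong) (auto simp: algebra_simps)
      also have "\<dots> = ?I f" using fi L2_per_integrable[OF df_L2] zero by simp
      finally show ?thesis by simp
    qed
    also have "\<bar>?I (\<lambda>t. f t * (1 - \<bar>deriv s t\<bar>))\<bar> \<le> \<rho> * \<delta>"
      using dev by (rule order_trans[OF integral_abs_bound])
    finally show ?thesis .
  qed
  have osc\<eta>: "\<bar>\<eta> t - \<eta> r\<bar> \<le> 2 * \<rho> * \<delta>" if "r \<in> {0..l}" "t \<in> {0..l}" for r t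
  proof -
    have "\<bar>\<eta> t - \<eta> r\<bar> \<le> ?I (\<lambda>t. \<bar>- (\<bar>deriv s t\<bar> * f t) - - (f t - mf)\<bar>)"
      by (rule periodic_primitive_osc[OF p\<eta> that])
    also have "\<dots> \<le> ?I (\<lambda>t. \<bar>f t * (1 - \<bar>deriv s t\<bar>)\<bar> + \<bar>mf\<bar>)"
    proof (rule integral_mono_AE)
      show "integrable (lebesgue_on {0..l}) (\<lambda>t. \<bar>- (\<bar>deriv s t\<bar> * f t) - - (f t - mf)\<bar>)"
        using L2_per_integrable[OF periodic_primitiveD(1)[OF p\<eta>]] by simp
      show "AE t in lebesgue_on {0..l}. \<bar>- (\<bar>deriv s t\<bar> * f t) - - (f t - mf)\<bar> \<le> \<bar>f t * (1 - \<bar>deriv s t\<bar>)\<bar> + \<bar>mf\<bar>"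
      proof (rule AE_I2)
        fix t
        have "- (\<bar>deriv s t\<bar> * f t) - - (f t - mf) = f t * (1 - \<bar>deriv s t\<bar>) - mf" by (simp add: algebra_simps)
        then show "\<bar>- (\<bar>deriv s t\<bar> * f t) - - (f t - mf)\<bar> \<le> \<bar>f t * (1 - \<bar>deriv s t\<bar>)\<bar> + \<bar>mf\<bar>"
          by (simp only: abs_triangle_ineq4)
      qed
    qed (use devi ki in auto)
    also have "\<dots> = ?I (\<lambda>t. \<bar>f t * (1 - \<bar>deriv s t\<bar>)\<bar>) + l * \<bar>mf\<bar>"
      using devi ki l by simp
    also have "\<dots> \<le> 2 * \<rho> * \<delta>" using dev mfb by simp
    finally show ?thesis .
  qed
  define d1 where "d1 = (\<lambda>t. \<bar>deriv s t\<bar> * \<zeta> t - P1 t)"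
  have pd: "periodic_primitive l (\<lambda>t. U (s t) - P t) d1"
    unfolding d1_def by (rule periodic_primitive_diff[OF pw P(1)])
  have \<zeta>c: "\<zeta> \<in> L2_per l" by (rule periodic_primitive_L2[OF p\<zeta>])
  have \<eta>L: "\<eta> \<in> L2_per l" by (rule periodic_primitive_L2[OF p\<eta>])
  have d1_eq: "d1 t - \<eta> t = (\<bar>deriv s t\<bar> - 1) * \<zeta> t" for t by (simp add: d1_def \<eta>_def algebra_simps)
  have d1L: "d1 \<in> L2_per l" by (rule periodic_primitiveD(1)[OF pd])
  have d1z: "?I d1 = 0" using periodic_primitive_integral_zero[OF pd] l by simp
  have d1\<eta>: "AE t in lebesgue_on {0..l}. \<bar>d1 t - \<eta> t\<bar> \<le> \<rho> * Z"
    using speed_bounds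
  proof eventually_elim
    case (elim t)
    then have "\<bar>\<bar>deriv s t\<bar> - 1\<bar> \<le> \<rho>" by (simp add: abs_minus_commute)
    then show ?case unfolding d1_eq abs_mult using \<zeta>Z[of t] \<rho> by (intro mult_mono) auto
  qed
  \<comment> \<open>The mean of \<open>\<eta>\<close> need not be zero, but that of
    \<open>d1\<close> is, and \<open>d1 - \<eta>\<close> is small.\<close>
  have mean\<eta>: "\<bar>?I \<eta>\<bar> \<le> l * (\<rho> * Z)"
  proof -
    have "\<bar>?I \<eta>\<bar> = \<bar>?I (\<lambda>t. d1 t - \<eta> t)\<bar>"
      using L2_per_integrable[OF d1L] L2_per_integrable[OF \<eta>L] d1z by simp
    also have "\<dots> \<le> ?I (\<lambda>t. \<bar>d1 t - \<eta> t\<bar>)" by (rule integral_abs_bound)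
    also have "\<dots> \<le> ?I (\<lambda>t. \<rho> * Z)"
      using L2_per_integrable[OF d1L] L2_per_integrable[OF \<eta>L] ki d1\<eta>
      by (intro integral_mono_AE integrable_abs Bochner_Integration.integrable_diff)
    also have "\<dots> = l * (\<rho> * Z)" using l by simp
    finally show ?thesis .
  qed
  have \<eta>b: "\<bar>\<eta> t\<bar> \<le> 2 * \<rho> * \<delta> + \<rho> * Z" if t: "t \<in> {0..l}" for t
  proof -
    define k where "k = ?I \<eta> / l"
    have "\<bar>\<eta> t - k\<bar> \<le> 2 * \<rho> * \<delta>"
    proof (rule mean_zero_sup_bound[OF l _ _ _ t])
      show "integrable (lebesgue_on {0..l}) (\<lambda>t. \<eta> t - k)" using L2_per_integrable[OF \<eta>L] ki by simp
      show "?I (\<lambda>t. \<eta> t - k) = 0" using L2_per_integrable[OF \<eta>L] ki[of k] l by (simp add: k_def)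
      show "\<bar>\<eta> t - k - (\<eta> r - k)\<bar> \<le> 2 * \<rho> * \<delta>" if "r \<in> {0..l}" "t \<in> {0..l}" for r t
        using osc\<eta>[OF that] by simp
    qed
    moreover have "\<bar>k\<bar> \<le> \<rho> * Z" using mean\<eta> l by (simp add: k_def field_simps)
    ultimately show ?thesis by linarith
  qed
  define B where "B = 2 * \<rho> * (\<delta> + Z)"
  have d1b: "AE t in lebesgue_on {0..l}. \<bar>d1 t\<bar> \<le> B"
    using d1\<eta> AE_space
  proof eventually_elim
    case (elim t)
    then have "\<bar>\<eta> t\<bar> \<le> 2 * \<rho> * \<delta> + \<rho> * Z" by (intro \<eta>b) simp
    then have "\<bar>d1 t\<bar> \<le> 2 * \<rho> * \<delta> + \<rho> * Z + \<rho> * Z" using elim(1) by linarith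
    then show ?case by (simp add: B_def algebra_simps)
  qed
  define k where "k = ?I (\<lambda>t. U (s t)) / l"
  have d_eq: "d = (\<lambda>t. U (s t) - P t - k)" by (auto simp: d_def k_def)
  have di: "integrable (lebesgue_on {0..l}) (\<lambda>t. U (s t) - P t)"
    by (rule L2_per_integrable[OF periodic_primitive_L2[OF pd]])
  show dc: "continuous_on {0..l} d"
    unfolding d_eq by (intro continuous_on_diff periodic_primitive_continuous[OF pd] continuous_on_const)
  have db: "\<bar>d t\<bar> \<le> l * B" if t: "t \<in> {0..l}" for t
  proof (rule mean_zero_sup_bound[OF l _ _ _ t])
    show "integrable (lebesgue_on {0..l}) d" unfolding d_eq using di ki by simp
    have "?I d = ?I (\<lambda>t. U (s t)) - ?I P - l * k"
      unfolding d_eq using L2_per_integrable[OF periodic_primitive_L2[OF pw]]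
        L2_per_integrable[OF periodic_primitive_L2[OF P(1)]] ki l by simp
    then show "?I d = 0" using P0 l by (simp add: k_def)
    show "\<bar>d t - d r\<bar> \<le> l * B" if "r \<in> {0..l}" "t \<in> {0..l}" for r t
    proof -
      have "\<bar>d t - d r\<bar> = \<bar>(U (s t) - P t) - (U (s r) - P r)\<bar>" by (simp add: d_eq)
      also have "\<dots> \<le> ?I (\<lambda>t. \<bar>d1 t\<bar>)" by (rule periodic_primitive_osc[OF pd that])
      also have "\<dots> \<le> ?I (\<lambda>t. B)"
        by (rule integral_mono_AE[OF integrable_abs[OF L2_per_integrable[OF d1L]] ki d1b])
      also have "\<dots> = l * B" using l by simp
      finally show ?thesis .
    qed
  qed
  have B0: "0 \<le> B" using \<rho> \<delta>0 Z0 by (simp add: B_def)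
  have "L2_norm_on l d \<le> sqrt l * (l * B)"
    using l B0 db by (intro L2_norm_on_bound) auto
  also have "\<dots> \<le> sqrt l * (l * (2 * \<rho> * (sqrt l * L2_norm_on l f + Z)))"
  proof -
    have "\<delta> \<le> sqrt l * L2_norm_on l f" unfolding \<delta>_def using l by (intro integral_abs_le_L2_norm[OF fL]) simp
    then have "B \<le> 2 * \<rho> * (sqrt l * L2_norm_on l f + Z)"
      unfolding B_def using \<rho> by (intro mult_left_mono) auto
    then show ?thesis using l by (intro mult_left_mono) auto
  qed
  finally show "L2_norm_on l d \<le> sqrt l * (l * (2 * \<rho> * (sqrt l * L2_norm_on l (\<lambda>t. g (s t)) + Z)))"
    by (simp add: f_def)
qed

end

text \<open>\<open>u1\<close> is constrained on \<open>{0..L}\<close> only, hence the passage to its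
  periodic extension \<open>U1\<close>. As the derivative of a periodic function it has mean zero,
  which gives the supremum bound.\<close>

lemma periodic_extension_of_primitives:
  assumes L: "0 < L" and per: "\<And>t. u (t + L) = u t" "\<And>t. g (t + L) = g t"
    and u: "periodic_primitive L u u1" and u1: "periodic_primitive L u1 (\<lambda>t. - g t)"
  obtains U1 where "is_primitive u U1" "is_primitive U1 (\<lambda>t. - g t)" "\<And>t. U1 (t + L) = U1 t"
    "\<And>t. \<bar>U1 t\<bar> \<le> sqrt L * L2_norm_on L g"
proof -
  obtain U1 where U1: "is_primitive U1 (\<lambda>t. - g t)" "\<And>t. U1 (t + L) = U1 t"
    "\<And>t. t \<in> {0..L} \<Longrightarrow> U1 t = u1 t"
    using periodic_primitive_extend[OF L _ u1] per(2) by auto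
  have pu: "periodic_primitive L u U1"
  proof (rule periodic_primitiveI)
    show "U1 \<in> L2_per L"
      using periodic_primitiveD(1)[OF u] U1(3) by (subst L2_per_cong[where g=u1]) auto
    show "u L = u 0" using periodic_primitiveD(2)[OF u] .
    fix t assume t: "0 \<le> t" "t \<le> L"
    have "integral {0..t} U1 = integral {0..t} u1"
      using t U1(3) by (intro Henstock_Kurzweil_Integration.integral_cong) auto
    then show "u t = u 0 + integral {0..t} U1" using periodic_primitiveD(3)[OF u t] by simp
  qed
  obtain V where V: "is_primitive V U1" "\<And>t. V (t + L) = V t" "\<And>t. t \<in> {0..L} \<Longrightarrow> V t = u t"
    using periodic_primitive_extend[OF L U1(2) pu] by auto
  have "V t = u t" for t
  proof -
    obtain n :: int where n: "t + of_int n * L \<in> {0..<0 + L}" by (rule period_representative[OF L])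
    then have "V (t + of_int n * L) = u (t + of_int n * L)" by (intro V(3)) auto
    then show ?thesis using periodic_int_shift[of V L, OF V(2)] periodic_int_shift[of u L, OF per(1)] by simp
  qed
  then have "V = u" by auto
  have bound: "\<bar>U1 t\<bar> \<le> sqrt L * L2_norm_on L g" for t
  proof -
    obtain n :: int where n: "t + of_int n * L \<in> {0..<0 + L}" by (rule period_representative[OF L])
    then have t': "t + of_int n * L \<in> {0..L}" by auto
    have "integral\<^sup>L (lebesgue_on {0..L}) u1 = 0" using periodic_primitive_integral_zero[OF u] L by simp
    from periodic_primitive_Poincare_sup[OF u1 L this t']
    have "\<bar>u1 (t + of_int n * L)\<bar> \<le> sqrt L * L2_norm_on L (\<lambda>t. - g t)" .
    then show ?thesis
      using U1(3)[OF t'] periodic_int_shift[of U1 L, OF U1(2)] by (simp add: L2_norm_on_def)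
  qed
  show thesis using that[OF _ U1(1,2) bound] V(1) \<open>V = u\<close> by simp
qed

context bi_lipschitz_curve
begin

text \<open>Injectivity of the projection on the polygon makes the lift injective on
  \<open>{0..<l}\<close>; a continuous injective function on an interval is strictly monotone, and
  this fixes the orientation.\<close>

lemma discrete_surface_lift:
  assumes h: "0 < h" "8 * h < m * L" "K * ((2 / m + 2) * (4 * h / m)) < 1" "16 * h < m\<^sup>2 * L"
    and Bh: "\<bar>B\<bar> * h\<^sup>2 \<le> m\<^sup>2 / (4 * K)"
    and \<psi>: "{x. \<psi> x = 0} = \<Gamma>" and grid: "active_grid_geometry h a \<psi> c"
    and ap: "arclength_param l \<sigma> (discrete_surface h a \<psi>)"
    and proj: "projection_estimates B \<Omega> c h a \<psi> \<sigma>"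
  obtains s e where "monotone_lift l L (2 / m) (\<bar>B\<bar> * h\<^sup>2) e s" "\<And>t. c (s t) = foot (\<sigma> t)"
proof -
  note D = arclength_paramD[OF ap]
  define \<rho> where "\<rho> = \<bar>B\<bar> * h\<^sup>2"
  have "m\<^sup>2 \<le> 1" using m by (simp add: power_le_one)
  then have mK: "m\<^sup>2 / (4 * K) \<le> 1 / 4" using K1 by (simp add: divide_le_eq)
  have \<rho>: "0 \<le> \<rho>" "\<rho> \<le> 1 / 2" using Bh mK by (auto simp: \<rho>_def)
  have B\<rho>: "B * h\<^sup>2 \<le> \<rho>" unfolding \<rho>_def by (intro mult_right_mono) auto
  have D_in: "\<sigma> t \<in> discrete_surface h a \<psi>" for t by (rule arclength_param_in[OF ap])
  have dist: "norm (\<sigma> t - foot (\<sigma> t)) \<le> \<rho>" for t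
  proof -
    have "norm (foot (\<sigma> t) - \<sigma> t) \<le> B * h\<^sup>2"
      using proj D_in[of t] unfolding projection_estimates_def \<psi> Let_def by blast
    then show ?thesis using B\<rho> by (simp add: norm_minus_commute)
  qed
  define q where "q = (\<lambda>t. foot (\<sigma> t))"
  have qlip: "2-lipschitz_on UNIV q"
  proof (rule lipschitz_onI)
    fix x y
    have "norm (q x - q y) \<le> 2 * norm (\<sigma> x - \<sigma> y)"
      unfolding q_def using dist[of x] dist[of y] Bh by (intro foot_lipschitz) (auto simp: \<rho>_def)
    then show "dist (q x) (q y) \<le> 2 * dist x y"
      using lipschitz_onD[OF D(5), of x y] by (simp add: dist_norm)
  qed simp
  have qin: "q t \<in> \<Gamma>" for t unfolding q_def by (rule foot_in)
  obtain s where s: "(2 / m)-lipschitz_on UNIV s" "\<And>t. c (s t) = q t"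
    using lift_to_parameter[OF qlip qin] by metis
  have sc: "continuous_on A s" for A
    using lipschitz_on_continuous_on[OF s(1)] by (rule continuous_on_subset) simp
  have diff: "s differentiable (at t)" if v: "(\<sigma> has_vector_derivative v) (at t)" for t v
  proof (rule lift_differentiable[OF _ _ v])
    show "isCont s t" using sc[of UNIV] by (simp add: continuous_on_eq_continuous_at)
    show "c (s t) = foot (\<sigma> t)" for t using s(2) by (simp add: q_def)
    have "norm (\<sigma> t - c (s t)) * K \<le> m\<^sup>2 / (4 * K) * K"
      using dist[of t] s(2)[of t] Bh K1 by (intro mult_right_mono) (auto simp: q_def \<rho>_def)
    also have "\<dots> = m\<^sup>2 / 4" using K1 by simp
    also have "\<dots> < 1" using \<open>m\<^sup>2 \<le> 1\<close> by simp
    finally show "norm (\<sigma> t - c (s t)) * K < 1" .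
  qed
  have aed: "AE t in lebesgue. s differentiable (at t)"
    using D(6) by eventually_elim (use diff in blast)
  have "AE t in lebesgue. \<bar>1 - norm (vector_derivative (foot \<circ> \<sigma>) (at t))\<bar> \<le> B * h\<^sup>2"
    using proj unfolding projection_estimates_def \<psi> Let_def by blast
  then have speed: "AE t in lebesgue. \<bar>1 - \<bar>deriv s t\<bar>\<bar> \<le> \<rho>"
    using aed
  proof eventually_elim
    case (elim t)
    then have "(s has_real_derivative deriv s t) (at t)" by (simp add: DERIV_deriv_iff_real_differentiable)
    then have "(s has_vector_derivative deriv s t) (at t)"
      by (simp add: has_real_derivative_iff_has_vector_derivative)
    from vector_diff_chain_at[OF this c1]
    have "((c \<circ> s) has_vector_derivative deriv s t *\<^sub>R c1 (s t)) (at t)" .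
    moreover have "c \<circ> s = foot \<circ> \<sigma>" using s(2) by (auto simp: q_def)
    ultimately have "vector_derivative (foot \<circ> \<sigma>) (at t) = deriv s t *\<^sub>R c1 (s t)"
      by (simp add: vector_derivative_at)
    then show ?case using elim(1) unit B\<rho> by simp
  qed
  have inj_s: "x = y" if "x \<in> {0..<l}" "y \<in> {0..<l}" "c (s x) = c (s y)" for x y
  proof -
    have "foot (\<sigma> x) = foot (\<sigma> y)" using that(3) s(2) by (simp add: q_def)
    then have "\<sigma> x = \<sigma> y"
      by (rule inj_onD[OF foot_inj_on_discrete_surface[OF h \<psi> grid]]) (rule D_in)+
    then show ?thesis by (rule inj_onD[OF D(3)]) (rule that)+
  qed
  then have inj: "inj_on s {0..<l}" by (intro inj_onI) metis
  then have "strict_mono_on {0..<l} s \<or> strict_antimono_on {0..<l} s"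
    using injective_eq_monotone_map[of "{0..<l}" s] sc by (simp add: is_interval_co)
  then obtain e where e: "e = 1 \<or> e = - 1" and m0: "\<And>x y. x \<in> {0..<l} \<Longrightarrow> y \<in> {0..<l} \<Longrightarrow> x < y \<Longrightarrow> e * s x \<le> e * s y"
  proof
    assume "strict_mono_on {0..<l} s"
    then show thesis using that[of 1] by (auto simp: monotone_on_def less_imp_le)
  next
    assume "strict_antimono_on {0..<l} s"
    then show thesis using that[of "- 1"] by (auto simp: monotone_on_def less_imp_le)
  qed
  have mono: "e * s x \<le> e * s y" if "x \<in> {0..l}" "y \<in> {0..l}" "x \<le> y" for x y
  proof (cases "x = y \<or> y < l")
    case True
    then show ?thesis using m0[of x y] that by (cases "x = y") auto
  next
    \<comment> \<open>At the end point \<open>l\<close>, where \<open>\<sigma>\<close> has returned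
      to its start, injectivity is of no help and monotonicity is obtained by continuity.\<close>
    case False
    then have y: "y = l" "x < l" using that by auto
    have "continuous_on (closure {x..<l}) (\<lambda>t. e * s t)" by (intro continuous_intros sc)
    moreover have "y \<in> closure {x..<l}" using y by simp
    ultimately show ?thesis
    proof (rule continuous_ge_on_closure)
      show "e * s x \<le> e * s t" if t: "t \<in> {x..<l}" for t
        using m0[of x t] t \<open>x \<in> {0..l}\<close> by (cases "x = t") auto
    qed
  qed
  have m0l: "e * s 0 \<le> e * s l" using mono[of 0 l] D(1) by simp
  \<comment> \<open>A longer range would, by the intermediate value theorem, attain
    \<open>s 0 + L\<close> or \<open>s 0 - L\<close> before \<open>l\<close>; the projection would
    then be back at its starting point, against injectivity.\<close>
  have range: "\<bar>s l - s 0\<bar> \<le> L"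
  proof (rule ccontr)
    assume "\<not> \<bar>s l - s 0\<bar> \<le> L"
    then have big: "e * s 0 + L < e * s l" using e m0l by auto
    have "\<exists>t\<ge>0. t \<le> l \<and> e * s t = e * s 0 + L"
      using big D(1) L by (intro IVT') (auto intro!: continuous_intros sc)
    then obtain t where t: "0 \<le> t" "t \<le> l" "e * s t = e * s 0 + L" by blast
    have tl: "t < l" using t big by (cases "t = l") auto
    have "s t = s 0 + L \<or> s t = s 0 - L" using e t(3) by auto
    then have "c (s t) = c (s 0)"
      using c_eq_iff[of "s t" "s 0"] by (auto intro: exI[of _ 1] exI[of _ "- 1"])
    then have "t = 0" using inj_s[of t 0] t tl D(1) by auto
    then show False using t(3) L by simp
  qed
  have "\<sigma> l = \<sigma> 0" using D(2)[of 0] by simp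
  then have "c (s l) = c (s 0)" using s(2) by (simp add: q_def)
  then have closed: "\<exists>n::int. s l = s 0 + of_int n * L" using c_eq_iff by simp
  have "monotone_lift l L (2 / m) \<rho> e s"
  proof
    show "inj_on s {0<..<l}" by (rule inj_on_subset[OF inj]) auto
  qed (use D(1) L s(1) aed e mono speed \<rho> range closed in auto)
  then show thesis using that s(2) by (simp add: \<rho>_def q_def)
qed

end

section \<open>Assembly of the error estimate\<close>

lemma H2_curve_primitive:
  assumes ap: "arclength_param L c \<Gamma>" and g: "g \<in> L2_curve L c" and u: "u \<in> H2_curve L c"
    and eq: "solves_laplace_beltrami L c u g" and cont: "continuous_on {0..L} (u \<circ> c)"
  obtains u1 where "periodic_primitive L (u \<circ> c) u1" "periodic_primitive L u1 (\<lambda>t. - g (c t))"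
proof -
  note D = arclength_paramD[OF ap]
  define w where "w = weak_deriv_per L 2 (u \<circ> c)"
  have "\<exists>f'. has_weak_deriv_per L 2 (u \<circ> c) f'" using u by (auto simp: H2_curve_def H_per_def)
  then have w: "has_weak_deriv_per L 2 (u \<circ> c) w"
    unfolding w_def weak_deriv_per_def by (rule someI_ex)
  have gL: "(\<lambda>t. - g (c t)) \<in> L2_per L"
    using L2_per_minus[of "g \<circ> c" L] g by (simp add: L2_curve_def o_def)
  have ae: "AE t in lebesgue_on {0..L}. w t = - g (c t)"
    using eq unfolding solves_laplace_beltrami_def w_def[symmetric] by eventually_elim simp
  have "has_weak_deriv_per L 2 (u \<circ> c) (\<lambda>t. - g (c t))"
    unfolding has_weak_deriv_per_def
  proof (intro conjI allI impI)
    show "u \<circ> c \<in> L2_per L" "(\<lambda>t. - g (c t)) \<in> L2_per L" using has_weak_deriv_perD(1)[OF w] gL by auto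
    fix \<phi> :: "real \<Rightarrow> real" assume \<phi>: "smooth_on UNIV \<phi> \<and> (\<forall>t. \<phi> (t + L) = \<phi> t)"
    have "integral\<^sup>L (lebesgue_on {0..L}) (\<lambda>t. w t * \<phi> t) = integral\<^sup>L (lebesgue_on {0..L}) (\<lambda>t. - g (c t) * \<phi> t)"
    proof (rule integral_cong_AE)
      have pL: "\<phi> \<in> L2_per L" using \<phi> smooth_on_L2_per by blast
      show "(\<lambda>t. w t * \<phi> t) \<in> borel_measurable (lebesgue_on {0..L})"
        using L2_per_mult[OF has_weak_deriv_perD(2)[OF w] pL] by auto
      show "(\<lambda>t. - g (c t) * \<phi> t) \<in> borel_measurable (lebesgue_on {0..L})"
        using L2_per_mult[OF gL pL] by auto
      show "AE t in lebesgue_on {0..L}. w t * \<phi> t = - g (c t) * \<phi> t" using ae by eventually_elim simp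
    qed
    then show "integral\<^sup>L (lebesgue_on {0..L}) (\<lambda>t. (u \<circ> c) t * (deriv ^^ 2) \<phi> t) =
        (- 1) ^ 2 * integral\<^sup>L (lebesgue_on {0..L}) (\<lambda>t. - g (c t) * \<phi> t)"
      using has_weak_deriv_perD(3)[OF w, of \<phi>] \<phi> by simp
  qed
  then show thesis using weak_deriv_2_primitives[OF D(1) _ cont] that by blast
qed

lemma L2_norm_minus_mean:
  assumes l: "0 < l" and f: "f \<in> L2_per l"
  shows "L2_norm_on l (\<lambda>t. f t - integral\<^sup>L (lebesgue_on {0..l}) f / l) \<le> 2 * L2_norm_on l f"
proof -
  define k where "k = integral\<^sup>L (lebesgue_on {0..l}) f / l"
  have "\<bar>integral\<^sup>L (lebesgue_on {0..l}) f\<bar> \<le> sqrt l * L2_norm_on l f"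
    by (rule order_trans[OF integral_abs_bound integral_abs_le_L2_norm[OF f]]) (use l in simp)
  then have "\<bar>k\<bar> * l \<le> sqrt l * L2_norm_on l f" using l by (simp add: k_def)
  then have "\<bar>k\<bar> * (sqrt l * sqrt l) \<le> sqrt l * L2_norm_on l f" using l by simp
  then have "sqrt l * (sqrt l * \<bar>k\<bar>) \<le> sqrt l * L2_norm_on l f" by (simp add: mult_ac)
  then have "sqrt l * \<bar>k\<bar> \<le> L2_norm_on l f" using l by (simp only: mult_le_cancel_left_pos real_sqrt_gt_zero)
  moreover have "L2_norm_on l (\<lambda>t. - k) \<le> sqrt l * \<bar>k\<bar>" using l by (intro L2_norm_on_bound) auto
  moreover have "L2_norm_on l (\<lambda>t. f t + - k) \<le> L2_norm_on l f + L2_norm_on l (\<lambda>t. - k)"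
    by (rule L2_norm_on_triangle[OF f L2_per_const])
  ultimately show ?thesis by (simp add: k_def)
qed

lemma Winf_norm_nonneg: "f \<in> Winf k S \<Longrightarrow> 0 \<le> Winf_norm k S f"
  unfolding Winf_norm_def Winf_def by (intro cInf_greatest) (auto simp: Winf_bound_def)

context bi_lipschitz_curve
begin

text \<open>The error is split at \<open>P\<close>. The first summand of the constant bounds the
  distance of the lifted solution from \<open>P\<close>, the second the Galerkin error. The pullback
  of \<open>g\<close> has at most twice the norm \<open>G\<close> of \<open>g\<close>, subtraction
  of its mean at most doubles this once more, and \<open>l \<le> 2 * L\<close> removes the length of
  the polygon.\<close>

lemma trace_error_estimate:
  assumes h: "0 < h" "8 * h < m * L" "K * ((2 / m + 2) * (4 * h / m)) < 1" "16 * h < m\<^sup>2 * L"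
    and Bh: "\<bar>B\<bar> * h\<^sup>2 \<le> m\<^sup>2 / (4 * K)"
    and \<psi>: "{x. \<psi> x = 0} = \<Gamma>" and grid: "active_grid_geometry h a \<psi> c"
    and cap: "arclength_param L c \<Gamma>"
    and ap: "arclength_param l \<sigma> (discrete_surface h a \<psi>)"
    and proj: "projection_estimates B \<Omega> c h a \<psi> \<sigma>"
    and appr: "reduced_approximation C\<^sub>0 ly w h a \<psi> l \<sigma>"
    and g: "g \<in> L2_curve L c" and u: "u \<in> H2_curve L c"
    and eq: "solves_laplace_beltrami L c u g" and cont: "continuous_on {0..L} (u \<circ> c)"
    and sol: "reduced_trace_solution ly w h a \<psi> l \<sigma> g u\<^sub>h"
  shows "L2_curve_norm l \<sigma> (\<lambda>x. lifted_solution \<psi> l \<sigma> u x - u\<^sub>h x)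
    \<le> (sqrt (2 * L) * (2 * L * (2 * \<bar>B\<bar> * (sqrt (2 * L) * 2 + sqrt L)))
        + (\<bar>C\<^sub>0\<bar> * (1 + 2 * L + (2 * L)\<^sup>2))\<^sup>2 * 4) * h\<^sup>2 * H2_curve_norm L c u"
proof -
  let ?I = "integral\<^sup>L (lebesgue_on {0..l})"
  obtain s e where s: "monotone_lift l L (2 / m) (\<bar>B\<bar> * h\<^sup>2) e s" "\<And>t. c (s t) = foot (\<sigma> t)"
    using discrete_surface_lift[OF h Bh \<psi> grid ap proj] by blast
  interpret lift: monotone_lift l L "2 / m" "\<bar>B\<bar> * h\<^sup>2" e s by (rule s(1))
  have gL: "(\<lambda>t. g (c t)) \<in> L2_per L" using g by (simp add: L2_curve_def o_def)
  obtain u1 where u1: "periodic_primitive L (u \<circ> c) u1" "periodic_primitive L u1 (\<lambda>t. - g (c t))"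
    by (rule H2_curve_primitive[OF cap g u eq cont])
  define G where "G = L2_norm_on L (\<lambda>t. g (c t))"
  have perg: "g (c (t + L)) = g (c t)" and peru: "(u \<circ> c) (t + L) = (u \<circ> c) t" for t
    using per by simp_all
  obtain U1 where U1: "is_primitive (u \<circ> c) U1" "is_primitive U1 (\<lambda>t. - g (c t))"
    "\<And>t. U1 (t + L) = U1 t" "\<And>t. \<bar>U1 t\<bar> \<le> sqrt L * G"
    using periodic_extension_of_primitives[OF L peru perg u1] unfolding G_def by blast
  have G0: "0 \<le> G" by (simp add: G_def)
  \<comment> \<open>\<open>g\<close> is, up to sign, the second derivative of
    \<open>u\<close>.\<close>
  have GH: "G \<le> H2_curve_norm L c u"
  proof -
    have "G = L2_norm_on L (\<lambda>t. - g (c t))" by (simp add: G_def L2_norm_on_def)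
    also have "\<dots> \<le> H_per_norm 2 L (u \<circ> c)"
      unfolding H_per_2_primitives(2)[OF u1 L] by (rule real_le_rsqrt) simp
    finally show ?thesis by (simp add: H2_curve_norm_def)
  qed
  define f where "f = (\<lambda>t. g (c (s t)))"
  have fL: "f \<in> L2_per l" and fG: "L2_norm_on l f \<le> 2 * G"
    unfolding f_def G_def using lift.pullback_L2[of "\<lambda>t. g (c t)", OF perg gL] by auto
  define mf where "mf = ?I f / l"
  have fmL: "(\<lambda>t. - (f t - mf)) \<in> L2_per l" by (intro L2_per_minus L2_per_diff fL L2_per_const)
  have "?I (\<lambda>t. - (f t - mf)) = 0"
    using L2_per_integrable[OF fL] L2_per_integrable[OF L2_per_const[of mf l]] lift.l by (simp add: mf_def)
  then obtain P1 where P1: "periodic_primitive l P1 (\<lambda>t. - (f t - mf))" "?I P1 = 0"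
    using periodic_primitive_exists[OF fmL _ lift.l] by blast
  obtain P where P: "periodic_primitive l P P1" "?I P = 0"
    using periodic_primitive_exists[OF periodic_primitive_L2[OF P1(1)] P1(2) lift.l] by blast
  define d where "d = (\<lambda>t. (u \<circ> c) (s t) - ?I (\<lambda>t. (u \<circ> c) (s t)) / l - P t)"
  have dc: "continuous_on {0..l} d"
    and db: "L2_norm_on l d \<le> sqrt l * (l * (2 * (\<bar>B\<bar> * h\<^sup>2) * (sqrt l * L2_norm_on l f + sqrt L * G)))"
    unfolding d_def f_def
    by (rule lift.pullback_comparison[OF U1(1,2) peru U1(3) perg gL U1(4) P(1) P1(1)[unfolded mf_def f_def] P(2)])+
  have uh: "u\<^sub>h \<in> W_red_mean_zero ly w h a \<psi> l \<sigma>"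
    and uhv: "\<And>v. v \<in> W_red_mean_zero ly w h a \<psi> l \<sigma> \<Longrightarrow>
      dirichlet_form l \<sigma> u\<^sub>h v = ?I (\<lambda>t. f t * v (\<sigma> t))"
    using sol by (auto simp: reduced_trace_solution_def curve_integral_def f_def s(2) \<psi>)
  have gal: "L2_norm_on l (\<lambda>t. P t - u\<^sub>h (\<sigma> t)) \<le>
      (\<bar>C\<^sub>0\<bar> * h * (1 + l + l\<^sup>2))\<^sup>2 * L2_norm_on l (\<lambda>t. f t - mf)"
    by (rule galerkin_L2_estimate[OF ap h(1) appr uh fL uhv P(1) P1(1) P(2)])
  have fm: "L2_norm_on l (\<lambda>t. f t - mf) \<le> 4 * G"
    using L2_norm_minus_mean[OF lift.l fL] fG by (simp add: mf_def)
  have l2: "0 < l" "l \<le> 2 * L" using lift.l lift.length_le by auto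
  have B1: "L2_norm_on l d \<le> sqrt (2 * L) * (2 * L * (2 * (\<bar>B\<bar> * h\<^sup>2) * (sqrt (2 * L) * (2 * G) + sqrt L * G)))"
    using G0 fG l2 L
    by (intro order_trans[OF db] mult_mono add_mono real_sqrt_le_mono order_refl mult_nonneg_nonneg
        add_nonneg_nonneg) auto
  have B2: "L2_norm_on l (\<lambda>t. P t - u\<^sub>h (\<sigma> t)) \<le> (\<bar>C\<^sub>0\<bar> * h * (1 + 2 * L + (2 * L)\<^sup>2))\<^sup>2 * (4 * G)"
    using fm l2 L h(1)
    by (intro order_trans[OF gal] mult_mono power_mono add_mono order_refl) auto
  have eL: "(\<lambda>t. P t - u\<^sub>h (\<sigma> t)) \<in> L2_per l"
  proof -
    have "u\<^sub>h \<in> W_red ly w h a \<psi>" using uh by (simp add: W_red_mean_zero_def)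
    then have "(u\<^sub>h \<circ> \<sigma>) \<in> L2_per l" by (rule periodic_primitive_L2[OF W_red_primitive[OF ap h(1)]])
    from L2_per_diff[OF periodic_primitive_L2[OF P(1)] this] show ?thesis by (simp add: comp_def)
  qed
  define A1 where "A1 = sqrt (2 * L) * (2 * L * (2 * \<bar>B\<bar> * (sqrt (2 * L) * 2 + sqrt L)))"
  define A2 where "A2 = (\<bar>C\<^sub>0\<bar> * (1 + 2 * L + (2 * L)\<^sup>2))\<^sup>2 * 4"
  have "L2_curve_norm l \<sigma> (\<lambda>x. lifted_solution \<psi> l \<sigma> u x - u\<^sub>h x) =
      L2_norm_on l (\<lambda>t. d t + (P t - u\<^sub>h (\<sigma> t)))"
    unfolding L2_curve_norm_eq
    by (rule arg_cong[of _ _ "L2_norm_on l"])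
      (simp add: fun_eq_iff lifted_solution_def \<psi> d_def curve_integral_def s(2))
  also have "\<dots> \<le> L2_norm_on l d + L2_norm_on l (\<lambda>t. P t - u\<^sub>h (\<sigma> t))"
    by (rule L2_norm_on_triangle[OF continuous_on_L2_per[OF dc] eL])
  also have "\<dots> \<le> A1 * h\<^sup>2 * G + A2 * h\<^sup>2 * G"
  proof (rule add_mono[OF order_trans[OF B1] order_trans[OF B2]])
    have "x * (2 * L * (2 * (b * h\<^sup>2) * (x * (2 * G) + y * G))) = x * (2 * L * (2 * b * (x * 2 + y))) * h\<^sup>2 * G"
      for x y b :: real by (simp add: algebra_simps)
    then show "sqrt (2 * L) * (2 * L * (2 * (\<bar>B\<bar> * h\<^sup>2) * (sqrt (2 * L) * (2 * G) + sqrt L * G))) \<le> A1 * h\<^sup>2 * G"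
      unfolding A1_def by (rule eq_refl)
    have "(b * h * x)\<^sup>2 * (4 * G) = (b * x)\<^sup>2 * 4 * h\<^sup>2 * G" for b x :: real
      by (simp add: power_mult_distrib)
    then show "(\<bar>C\<^sub>0\<bar> * h * (1 + 2 * L + (2 * L)\<^sup>2))\<^sup>2 * (4 * G) \<le> A2 * h\<^sup>2 * G"
      unfolding A2_def by (rule eq_refl)
  qed
  also have "\<dots> = (A1 + A2) * h\<^sup>2 * G" by (simp add: algebra_simps)
  also have "\<dots> \<le> (A1 + A2) * h\<^sup>2 * H2_curve_norm L c u"
    using GH L by (intro mult_left_mono) (auto simp: A1_def A2_def intro!: mult_nonneg_nonneg add_nonneg_nonneg)
  finally show ?thesis by (simp add: A1_def A2_def)
qed

end

theorem theorem22:
  fixes \<Omega> \<Gamma> U\<^sub>\<Gamma> :: "point set" and \<psi> :: "point \<Rightarrow> real"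
    and c :: "real \<Rightarrow> point" and L \<delta> C\<^sub>0 C\<^sub>p C\<^sub>E C\<^sub>N B :: real
    and E :: "(point \<Rightarrow> real) \<Rightarrow> point \<Rightarrow> real"
  assumes curve: "smooth_closed_curve L c \<Gamma>"
    and domain: "open \<Omega>" "connected \<Omega>" "\<Omega> \<noteq> {}" "bounded \<Omega>" "frontier \<Omega> = \<Gamma>"
    and level_set: "level_set_function \<Omega> \<Gamma> \<psi>"
    and tube: "0 < \<delta>" "U\<^sub>\<Gamma> = {x. infdist x \<Gamma> < \<delta>}"
    and extension: "bounded_extension_operator 4 \<Omega> C\<^sub>E E"
  shows "\<exists>h\<^sub>0>0. \<exists>C. \<forall>h a \<sigma> Lh w ly g u U u\<^sub>h.
    0 < h \<longrightarrow> h < h\<^sub>0 \<longrightarrow>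
    active_grid_geometry h a \<psi> c \<longrightarrow>
    arclength_param Lh \<sigma> (discrete_surface h a \<psi>) \<longrightarrow>
    projection_estimates C\<^sub>p \<Omega> c h a \<psi> \<sigma> \<longrightarrow>
    local_extrapolation B h a \<psi> w \<longrightarrow>
    block_invertible (gam2 h a \<psi>) (layer_kernel ly h a \<psi>) \<longrightarrow>
    reduced_approximation C\<^sub>0 ly w h a \<psi> Lh \<sigma> \<longrightarrow>
    g \<in> L2_curve L c \<longrightarrow> curve_integral L c g = 0 \<longrightarrow>
    u \<in> H2_curve L c \<longrightarrow> curve_integral L c u = 0 \<longrightarrow>
    solves_laplace_beltrami L c u g \<longrightarrow>
    harmonic_extension \<Omega> u U \<longrightarrow>
    U \<in> Winf 4 (\<Omega> \<inter> U\<^sub>\<Gamma>) \<longrightarrow> U \<in> Winf 4 \<Omega> \<longrightarrow>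
    Winf_norm 4 \<Omega> U \<le> C\<^sub>N * Winf_norm 4 (\<Omega> \<inter> U\<^sub>\<Gamma>) U \<longrightarrow>
    reduced_trace_solution ly w h a \<psi> Lh \<sigma> g u\<^sub>h \<longrightarrow>
    L2_curve_norm Lh \<sigma> (\<lambda>x. lifted_solution \<psi> Lh \<sigma> u x - u\<^sub>h x)
      \<le> C * h\<^sup>2 * (H2_curve_norm L c u + Winf_norm 4 (\<Omega> \<inter> U\<^sub>\<Gamma>) U)"
proof -
  obtain c1 c2 K where usc: "unit_speed_closed_curve L c \<Gamma> c1 c2 K"
    by (rule smooth_closed_curve_unit_speed[OF curve])
  interpret unit_speed_closed_curve L c \<Gamma> c1 c2 K by (rule usc)
  obtain m where m: "0 < m" "m \<le> 1" "\<And>s t. \<bar>t - s\<bar> \<le> L / 2 \<Longrightarrow> m * \<bar>t - s\<bar> \<le> norm (c t - c s)"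
    using bi_lipschitz by metis
  interpret bi_lipschitz_curve L c \<Gamma> c1 c2 K m by unfold_locales (use m in auto)
  have cap: "arclength_param L c \<Gamma>" using curve by (simp add: smooth_closed_curve_def)
  have \<psi>: "{x. \<psi> x = 0} = \<Gamma>" using level_set by (simp add: level_set_function_def)
  define \<kappa> where "\<kappa> = K * ((2 / m + 2) * (4 / m))"
  have "0 < 2 / m + 2" "0 < 4 / m" "0 < K" using m K1 by (auto intro: add_pos_pos)
  then have \<kappa>: "0 < \<kappa>" unfolding \<kappa>_def by (intro mult_pos_pos)
  \<comment> \<open>\<open>m * L / 8\<close> confines the curve in a cell to a quarter of the period
    on either side; \<open>1 / \<kappa>\<close> and \<open>m\<^sup>2 * L / 16\<close> meet the two
    smallness conditions for chords of arcs of length at most \<open>4 * h / m\<close>; the last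
    entry keeps \<open>\<bar>C\<^sub>p\<bar> * h\<^sup>2\<close> below the tube radius, with
    \<open>h < 1\<close> giving \<open>h\<^sup>2 \<le> h\<close> and the added 1 avoiding a division
    by 0. None of them depends on the position of the mesh.\<close>
  define h0 where "h0 = Min {1, m * L / 8, 1 / \<kappa>, m\<^sup>2 * L / 16, m\<^sup>2 / (4 * K) / (\<bar>C\<^sub>p\<bar> + 1)}"
  have h0: "0 < h0" using m L K1 \<kappa> by (auto simp: h0_def intro!: divide_pos_pos add_nonneg_pos)
  define C where "C = sqrt (2 * L) * (2 * L * (2 * \<bar>C\<^sub>p\<bar> * (sqrt (2 * L) * 2 + sqrt L)))
        + (\<bar>C\<^sub>0\<bar> * (1 + 2 * L + (2 * L)\<^sup>2))\<^sup>2 * 4"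
  have C0: "0 \<le> C" using L by (auto simp: C_def intro!: mult_nonneg_nonneg add_nonneg_nonneg)
  show ?thesis
  proof (rule exI[of _ h0], rule conjI[OF h0], rule exI[of _ C], intro allI impI)
    fix h a \<sigma> Lh w ly g u U u\<^sub>h
    assume h: "0 < h" "h < h0"
      and grid: "active_grid_geometry h a \<psi> c"
      and ap: "arclength_param Lh \<sigma> (discrete_surface h a \<psi>)"
      and proj: "projection_estimates C\<^sub>p \<Omega> c h a \<psi> \<sigma>"
      and appr: "reduced_approximation C\<^sub>0 ly w h a \<psi> Lh \<sigma>"
      and g: "g \<in> L2_curve L c" and u: "u \<in> H2_curve L c"
      and eq: "solves_laplace_beltrami L c u g"
      and harm: "harmonic_extension \<Omega> u U"
      and U: "U \<in> Winf 4 (\<Omega> \<inter> U\<^sub>\<Gamma>)"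
      and sol: "reduced_trace_solution ly w h a \<psi> Lh \<sigma> g u\<^sub>h"
    have hs: "h < 1" "h < m * L / 8" "h < 1 / \<kappa>" "h < m\<^sup>2 * L / 16" "h < m\<^sup>2 / (4 * K) / (\<bar>C\<^sub>p\<bar> + 1)"
      using h(2) by (simp_all add: h0_def)
    have s1: "8 * h < m * L" "16 * h < m\<^sup>2 * L" using hs(2,4) by auto
    have s2: "K * ((2 / m + 2) * (4 * h / m)) < 1"
    proof -
      have "K * ((2 / m + 2) * (4 * h / m)) = h * \<kappa>" by (simp add: \<kappa>_def)
      then show ?thesis using hs(3) \<kappa> by (simp add: pos_less_divide_eq)
    qed
    have s3: "\<bar>C\<^sub>p\<bar> * h\<^sup>2 \<le> m\<^sup>2 / (4 * K)"
    proof -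
      have "h\<^sup>2 \<le> h" using h hs(1) by (simp add: power2_eq_square mult_left_le)
      then have "\<bar>C\<^sub>p\<bar> * h\<^sup>2 \<le> (\<bar>C\<^sub>p\<bar> + 1) * h" using h by (intro mult_mono) auto
      also have "\<dots> \<le> m\<^sup>2 / (4 * K)"
      proof -
        have "0 < \<bar>C\<^sub>p\<bar> + 1" by linarith
        then have "h * (\<bar>C\<^sub>p\<bar> + 1) < m\<^sup>2 / (4 * K)" using hs(5) by (simp only: pos_less_divide_eq)
        then show ?thesis by (simp only: mult.commute less_imp_le)
      qed
      finally show ?thesis .
    qed
    have cont: "continuous_on {0..L} (u \<circ> c)"
    proof -
      have "continuous_on {0..L} (\<lambda>t. U (c t))"
      proof (rule continuous_on_compose2[OF _ c_continuous])
        show "continuous_on (closure \<Omega>) U" using harm by (simp add: harmonic_extension_def)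
        show "c ` {0..L} \<subseteq> closure \<Omega>" using c_in domain(5) by (auto simp: frontier_def)
      qed
      moreover have "U (c t) = u (c t)" for t
        using harm c_in[of t] domain(5) by (simp add: harmonic_extension_def)
      ultimately show ?thesis by (simp add: comp_def)
    qed
    have "L2_curve_norm Lh \<sigma> (\<lambda>x. lifted_solution \<psi> Lh \<sigma> u x - u\<^sub>h x) \<le> C * h\<^sup>2 * H2_curve_norm L c u"
      unfolding C_def
      by (rule trace_error_estimate[OF h(1) s1(1) s2 s1(2) s3 \<psi> grid cap ap proj appr g u eq cont sol])
    also have "\<dots> \<le> C * h\<^sup>2 * (H2_curve_norm L c u + Winf_norm 4 (\<Omega> \<inter> U\<^sub>\<Gamma>) U)"
      using C0 Winf_norm_nonneg[OF U] by (intro mult_left_mono) auto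
    finally show "L2_curve_norm Lh \<sigma> (\<lambda>x. lifted_solution \<psi> Lh \<sigma> u x - u\<^sub>h x)
      \<le> C * h\<^sup>2 * (H2_curve_norm L c u + Winf_norm 4 (\<Omega> \<inter> U\<^sub>\<Gamma>) U)" .
  qed
qed

end
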